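(* For every integer $m\ge1$ there is a complete noncompact strongly stable constant-mean-curvature embedding $M^{3m}\to\mathbb H^{3m+1}(-1)$ whose squared averaged mean curvature is $$H_m^2=\frac{(4m^2+12m+1)^2}{36m(2m+1)^2},\qquad\text{and}\qquad \lim_{m\to\infty}\frac{H_m^2}{3m}=\frac1{27}.$$ Consequently, there is no finite constant $T$ such that, in every dimension $n$, every complete two-sided constant-mean-curvature immersion $M^n\to\mathbb H^{n+1}(-1)$ of finite strong Morse index with $H^2\ge T$ has compact domain $M$.
   Context: For a smooth two-sided immersion $F:(M^n,g)\to\mathbb H^{n+1}(-1)$ with induced metric $g$ and chosen unit normal $N$: $A(X,Y)=\langle\bar\nabla_{dF(X)}N,dF(Y)\rangle$, the averaged mean curvature is $H=\frac1n\operatorname{tr}_gA$ (constant mean curvature means $H$ constant), and $$Q_{-1}(f)=\int_M\bigl(|\nabla f|^2-(|A|^2-n)f^2\bigr)\,dV_g,\qquad f\in C_c^\infty(M).$$ Strongly stable means $Q_{-1}(f)\ge0$ for all $f\in C_c^\infty(M)$. The strong Morse index is the supremum of the dimensions of linear subspaces of $C_c^\infty(M)$ on which $Q_{-1}$ is negative definite. Complete refers to the induced metric; manifolds are smooth, connected and without boundary. *)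

theory Defs
  imports
    "HOL-Analysis.Analysis"
    "HOL-Library.Function_Algebras"
    "HOL-Library.Extended_Nat"
    "Jordan_Normal_Form.Determinant"
    "Jordan_Normal_Form.Gauss_Jordan_Elimination"
begin

section \<open>Smooth functions on open subsets of n-dimensional space\<close>

text \<open>
  Dimensions are natural numbers that get quantified over, so \<open>n\<close>-dimensional space is the
  product of \<open>n\<close> real lines indexed by \<open>{..<n}\<close>. Its points are the functions in
  \<open>{..<n} \<rightarrow>\<^sub>E UNIV\<close>, and this is also the underlying set of the Lebesgue measure
  \<open>PiM {..<n} (\<lambda>_. lborel)\<close>.
\<close>

definition Rn :: "nat \<Rightarrow> (nat \<Rightarrow> real) topology" where
  "Rn n = product_topology (\<lambda>_. euclideanreal) {..<n}"

definition partial_deriv :: "nat \<Rightarrow> ((nat \<Rightarrow> real) \<Rightarrow> real) \<Rightarrow> (nat \<Rightarrow> real) \<Rightarrow> real" where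
  "partial_deriv i f x = deriv (\<lambda>t. f (x(i := t))) (x i)"

text \<open>Class \<open>C\<^sup>k\<close> on an open set \<open>U\<close>: partial derivatives up to order \<open>k\<close> exist and are continuous.\<close>

primrec Ck_on :: "nat \<Rightarrow> nat \<Rightarrow> (nat \<Rightarrow> real) set \<Rightarrow> ((nat \<Rightarrow> real) \<Rightarrow> real) \<Rightarrow> bool" where
  "Ck_on n 0 U f \<longleftrightarrow> continuous_map (subtopology (Rn n) U) euclideanreal f"
| "Ck_on n (Suc k) U f \<longleftrightarrow>
     continuous_map (subtopology (Rn n) U) euclideanreal f \<and>
     (\<forall>i<n. (\<forall>x\<in>U. (\<lambda>t. f (x(i := t))) differentiable (at (x i))) \<and>
            Ck_on n k U (partial_deriv i f))"

definition smooth_on :: "nat \<Rightarrow> (nat \<Rightarrow> real) set \<Rightarrow> ((nat \<Rightarrow> real) \<Rightarrow> real) \<Rightarrow> bool" where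
  "smooth_on n U f \<longleftrightarrow> (\<forall>k. Ck_on n k U f)"

section \<open>Smooth manifolds\<close>

text \<open>A chart is a pair of its domain and its coordinate map.\<close>

type_synonym 'a chart = "'a set \<times> ('a \<Rightarrow> nat \<Rightarrow> real)"

definition chart_inv :: "'a chart \<Rightarrow> (nat \<Rightarrow> real) \<Rightarrow> 'a" where
  "chart_inv c = inv_into (fst c) (snd c)"

definition smooth_atlas :: "nat \<Rightarrow> 'a topology \<Rightarrow> 'a chart set \<Rightarrow> bool" where
  "smooth_atlas n X \<A> \<longleftrightarrow>
     (\<forall>c\<in>\<A>. openin X (fst c) \<and> openin (Rn n) (snd c ` fst c) \<and>
        homeomorphic_map (subtopology X (fst c)) (subtopology (Rn n) (snd c ` fst c)) (snd c)) \<and>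
     (\<Union>c\<in>\<A>. fst c) = topspace X \<and>
     (\<forall>c\<in>\<A>. \<forall>c'\<in>\<A>. \<forall>i<n.
        smooth_on n (snd c ` (fst c \<inter> fst c')) (\<lambda>x. snd c' (chart_inv c x) i))"

definition smooth_manifold :: "nat \<Rightarrow> 'a topology \<Rightarrow> 'a chart set \<Rightarrow> bool" where
  "smooth_manifold n X \<A> \<longleftrightarrow>
     Hausdorff_space X \<and> second_countable X \<and> connected_space X \<and> topspace X \<noteq> {} \<and>
     smooth_atlas n X \<A>"

definition smooth_fun :: "nat \<Rightarrow> 'a chart set \<Rightarrow> ('a \<Rightarrow> real) \<Rightarrow> bool" where
  "smooth_fun n \<A> f \<longleftrightarrow> (\<forall>c\<in>\<A>. smooth_on n (snd c ` fst c) (f \<circ> chart_inv c))"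

text \<open>The coordinate vector field \<open>\<partial>/\<partial>x\<^sup>i\<close> of the chart \<open>c\<close>, applied to \<open>f\<close> at the point \<open>p\<close>.\<close>

definition chart_deriv :: "'a chart \<Rightarrow> nat \<Rightarrow> ('a \<Rightarrow> real) \<Rightarrow> 'a \<Rightarrow> real" where
  "chart_deriv c i f p = partial_deriv i (f \<circ> chart_inv c) (snd c p)"

text \<open>
  Traces, norms, lengths and the Riemannian measure are written in local coordinates and do not
  depend on the coordinates used. To have one definite chart at every point, a countable family of
  charts covering the manifold is chosen; it exists by second countability. The chart used at \<open>p\<close> is the
  first one in this family whose domain contains \<open>p\<close>.
\<close>

definition chart_cover :: "'a chart set \<Rightarrow> nat \<Rightarrow> 'a chart" where
  "chart_cover \<A> = (SOME c. range c \<subseteq> \<A> \<and> (\<Union>k. fst (c k)) = (\<Union>c'\<in>\<A>. fst c'))"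

definition base_index :: "'a chart set \<Rightarrow> 'a \<Rightarrow> nat" where
  "base_index \<A> p = (LEAST k. p \<in> fst (chart_cover \<A> k))"

definition base_chart :: "'a chart set \<Rightarrow> 'a \<Rightarrow> 'a chart" where
  "base_chart \<A> p = chart_cover \<A> (base_index \<A> p)"

section \<open>Riemannian notions\<close>

text \<open>
  A bilinear form on tangent spaces is given by its components: \<open>g c p i j\<close> is the value at the
  point \<open>p\<close> on the \<open>i\<close>-th and \<open>j\<close>-th coordinate vector of the chart \<open>c\<close>.
\<close>

type_synonym 'a form2 = "'a chart \<Rightarrow> 'a \<Rightarrow> nat \<Rightarrow> nat \<Rightarrow> real"

definition gram :: "nat \<Rightarrow> 'a form2 \<Rightarrow> 'a chart \<Rightarrow> 'a \<Rightarrow> real mat" where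
  "gram n g c p = mat n n (\<lambda>(i, j). g c p i j)"

definition metric_inv :: "nat \<Rightarrow> 'a form2 \<Rightarrow> 'a form2" where
  "metric_inv n g c p i j = the (mat_inverse (gram n g c p)) $$ (i, j)"

definition metric_trace :: "nat \<Rightarrow> 'a chart set \<Rightarrow> 'a form2 \<Rightarrow> 'a form2 \<Rightarrow> 'a \<Rightarrow> real" where
  "metric_trace n \<A> g B p =
     (let c = base_chart \<A> p in \<Sum>i<n. \<Sum>j<n. metric_inv n g c p i j * B c p i j)"

definition form_norm_sq :: "nat \<Rightarrow> 'a chart set \<Rightarrow> 'a form2 \<Rightarrow> 'a form2 \<Rightarrow> 'a \<Rightarrow> real" where
  "form_norm_sq n \<A> g B p =
     (let c = base_chart \<A> p in
      \<Sum>i<n. \<Sum>j<n. \<Sum>k<n. \<Sum>l<n.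
        metric_inv n g c p i k * metric_inv n g c p j l * B c p i j * B c p k l)"

definition grad_norm_sq :: "nat \<Rightarrow> 'a chart set \<Rightarrow> 'a form2 \<Rightarrow> ('a \<Rightarrow> real) \<Rightarrow> 'a \<Rightarrow> real" where
  "grad_norm_sq n \<A> g f p =
     (let c = base_chart \<A> p in
      \<Sum>i<n. \<Sum>j<n. metric_inv n g c p i j * chart_deriv c i f p * chart_deriv c j f p)"

text \<open>
  The Riemannian measure: cut \<open>E\<close> into Borel pieces lying in the domains of the charts of the
  chosen family and integrate \<open>sqrt (det g)\<close> over the coordinate image of each piece.
\<close>

definition riem_measure :: "nat \<Rightarrow> 'a topology \<Rightarrow> 'a chart set \<Rightarrow> 'a form2 \<Rightarrow> 'a measure" where
  "riem_measure n X \<A> g =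
     measure_of (topspace X) {U. openin X U}
       (\<lambda>E. \<Sum>k. \<integral>\<^sup>+x. ennreal (sqrt (Determinant.det
               (gram n g (chart_cover \<A> k) (chart_inv (chart_cover \<A> k) x)))) *
             indicator (snd (chart_cover \<A> k) ` {p\<in>E. base_index \<A> p = k}) x
           \<partial>PiM {..<n} (\<lambda>_. lborel))"

text \<open>Continuous curves on \<open>[0,1]\<close> that are \<open>C\<^sup>1\<close> off a finite set, and their lengths.\<close>

definition piecewise_C1_curve ::
    "nat \<Rightarrow> 'a topology \<Rightarrow> 'a chart set \<Rightarrow> (real \<Rightarrow> 'a) \<Rightarrow> bool" where
  "piecewise_C1_curve n X \<A> \<gamma> \<longleftrightarrow>
     continuous_map (top_of_set {0..1}) X \<gamma> \<and>
     (\<exists>S. finite S \<and>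
        (\<forall>c\<in>\<A>. \<forall>i<n. (\<lambda>t. snd c (\<gamma> t) i) C1_differentiable_on
                        {t \<in> {0<..<1} - S. \<gamma> t \<in> fst c}))"

definition speed :: "nat \<Rightarrow> 'a chart set \<Rightarrow> 'a form2 \<Rightarrow> (real \<Rightarrow> 'a) \<Rightarrow> real \<Rightarrow> real" where
  "speed n \<A> g \<gamma> t =
     (let c = base_chart \<A> (\<gamma> t); v = (\<lambda>i. deriv (\<lambda>s. snd c (\<gamma> s) i) t) in
      sqrt (\<Sum>i<n. \<Sum>j<n. g c (\<gamma> t) i j * v i * v j))"

definition curve_length :: "nat \<Rightarrow> 'a chart set \<Rightarrow> 'a form2 \<Rightarrow> (real \<Rightarrow> 'a) \<Rightarrow> ennreal" where
  "curve_length n \<A> g \<gamma> = (\<integral>\<^sup>+t\<in>{0..1}. ennreal (speed n \<A> g \<gamma> t) \<partial>lborel)"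

definition riem_dist ::
    "nat \<Rightarrow> 'a topology \<Rightarrow> 'a chart set \<Rightarrow> 'a form2 \<Rightarrow> 'a \<Rightarrow> 'a \<Rightarrow> ennreal" where
  "riem_dist n X \<A> g p q =
     (INF \<gamma>\<in>{\<gamma>. piecewise_C1_curve n X \<A> \<gamma> \<and> \<gamma> 0 = p \<and> \<gamma> 1 = q}. curve_length n \<A> g \<gamma>)"

text \<open>Every Cauchy sequence for the Riemannian distance converges.\<close>

definition complete_metric :: "nat \<Rightarrow> 'a topology \<Rightarrow> 'a chart set \<Rightarrow> 'a form2 \<Rightarrow> bool" where
  "complete_metric n X \<A> g \<longleftrightarrow>
     (\<forall>\<sigma> :: nat \<Rightarrow> 'a.
        range \<sigma> \<subseteq> topspace X \<longrightarrow>
        (\<forall>e>0. \<exists>N. \<forall>i\<ge>N. \<forall>j\<ge>N. riem_dist n X \<A> g (\<sigma> i) (\<sigma> j) < e) \<longrightarrow>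
        (\<exists>p\<in>topspace X. (\<lambda>k. riem_dist n X \<A> g (\<sigma> k) p) \<longlonglongrightarrow> 0))"

section \<open>Hypersurfaces of hyperbolic space\<close>

text \<open>
  Hyperbolic space of dimension \<open>d\<close> and sectional curvature \<open>-1\<close> is the upper sheet of the
  hyperboloid in Minkowski space with coordinates \<open>x 0, ..., x d\<close>. The metric is the restriction of
  the Minkowski form, and the Levi-Civita connection is the tangential projection of the flat
  derivative.
\<close>

definition mink :: "nat \<Rightarrow> (nat \<Rightarrow> real) \<Rightarrow> (nat \<Rightarrow> real) \<Rightarrow> real" where
  "mink d x y = - (x 0 * y 0) + (\<Sum>k=1..d. x k * y k)"

definition hyperbolic_space :: "nat \<Rightarrow> (nat \<Rightarrow> real) topology" where
  "hyperbolic_space d = subtopology (Rn (Suc d)) {x. mink d x x = -1 \<and> x 0 > 0}"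

text \<open>Componentwise derivative along a coordinate vector of a map or vector field along the manifold
  with values in Minkowski space.\<close>

definition vec_deriv :: "'a chart \<Rightarrow> nat \<Rightarrow> ('a \<Rightarrow> nat \<Rightarrow> real) \<Rightarrow> 'a \<Rightarrow> nat \<Rightarrow> real" where
  "vec_deriv c i F p k = chart_deriv c i (\<lambda>q. F q k) p"

text \<open>Since \<open>mink d (F p) (F p) = -1\<close>, the projection of a vector \<open>w\<close> to the tangent space of
  hyperbolic space at \<open>F p\<close> is \<open>w + mink d w (F p) F p\<close>.\<close>

definition hyp_connection ::
    "nat \<Rightarrow> ('a \<Rightarrow> nat \<Rightarrow> real) \<Rightarrow> ('a \<Rightarrow> nat \<Rightarrow> real) \<Rightarrow> 'a chart \<Rightarrow> nat \<Rightarrow> 'a \<Rightarrow> nat \<Rightarrow> real" where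
  "hyp_connection d F V c i p k =
     vec_deriv c i V p k + mink d (vec_deriv c i V p) (F p) * F p k"

definition immersion :: "nat \<Rightarrow> 'a topology \<Rightarrow> 'a chart set \<Rightarrow> ('a \<Rightarrow> nat \<Rightarrow> real) \<Rightarrow> bool" where
  "immersion n X \<A> F \<longleftrightarrow>
     (\<forall>p\<in>topspace X. F p \<in> topspace (hyperbolic_space (n + 1))) \<and>
     (\<forall>k\<le>n + 1. smooth_fun n \<A> (\<lambda>p. F p k)) \<and>
     (\<forall>c\<in>\<A>. \<forall>p\<in>fst c. \<forall>v :: nat \<Rightarrow> real.
        (\<forall>k\<le>n + 1. (\<Sum>i<n. v i * vec_deriv c i F p k) = 0) \<longrightarrow> (\<forall>i<n. v i = 0))"

definition unit_normal ::
    "nat \<Rightarrow> 'a topology \<Rightarrow> 'a chart set \<Rightarrow> ('a \<Rightarrow> nat \<Rightarrow> real) \<Rightarrow> ('a \<Rightarrow> nat \<Rightarrow> real) \<Rightarrow> bool" where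
  "unit_normal n X \<A> F N \<longleftrightarrow>
     (\<forall>k\<le>n + 1. smooth_fun n \<A> (\<lambda>p. N p k)) \<and>
     (\<forall>p\<in>topspace X. mink (n + 1) (N p) (F p) = 0 \<and> mink (n + 1) (N p) (N p) = 1) \<and>
     (\<forall>c\<in>\<A>. \<forall>p\<in>fst c. \<forall>i<n. mink (n + 1) (N p) (vec_deriv c i F p) = 0)"

text \<open>A two-sided immersion of a connected manifold together with a chosen unit normal \<open>N\<close>.\<close>

definition two_sided_immersion ::
    "nat \<Rightarrow> 'a topology \<Rightarrow> 'a chart set \<Rightarrow> ('a \<Rightarrow> nat \<Rightarrow> real) \<Rightarrow> ('a \<Rightarrow> nat \<Rightarrow> real) \<Rightarrow> bool" where
  "two_sided_immersion n X \<A> F N \<longleftrightarrow>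
     smooth_manifold n X \<A> \<and> immersion n X \<A> F \<and> unit_normal n X \<A> F N"

definition induced_metric :: "nat \<Rightarrow> ('a \<Rightarrow> nat \<Rightarrow> real) \<Rightarrow> 'a form2" where
  "induced_metric n F c p i j = mink (n + 1) (vec_deriv c i F p) (vec_deriv c j F p)"

definition second_fundamental_form ::
    "nat \<Rightarrow> ('a \<Rightarrow> nat \<Rightarrow> real) \<Rightarrow> ('a \<Rightarrow> nat \<Rightarrow> real) \<Rightarrow> 'a form2" where
  "second_fundamental_form n F N c p i j =
     mink (n + 1) (hyp_connection (n + 1) F N c i p) (vec_deriv c j F p)"

definition mean_curvature ::
    "nat \<Rightarrow> 'a chart set \<Rightarrow> ('a \<Rightarrow> nat \<Rightarrow> real) \<Rightarrow> ('a \<Rightarrow> nat \<Rightarrow> real) \<Rightarrow> 'a \<Rightarrow> real" where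
  "mean_curvature n \<A> F N p =
     metric_trace n \<A> (induced_metric n F) (second_fundamental_form n F N) p / real n"

definition has_constant_mean_curvature ::
    "nat \<Rightarrow> 'a topology \<Rightarrow> 'a chart set \<Rightarrow> ('a \<Rightarrow> nat \<Rightarrow> real) \<Rightarrow> ('a \<Rightarrow> nat \<Rightarrow> real) \<Rightarrow> real \<Rightarrow> bool"
  where
  "has_constant_mean_curvature n X \<A> F N h \<longleftrightarrow>
     (\<forall>p\<in>topspace X. mean_curvature n \<A> F N p = h)"

definition complete_immersion ::
    "nat \<Rightarrow> 'a topology \<Rightarrow> 'a chart set \<Rightarrow> ('a \<Rightarrow> nat \<Rightarrow> real) \<Rightarrow> bool" where
  "complete_immersion n X \<A> F \<longleftrightarrow> complete_metric n X \<A> (induced_metric n F)"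

section \<open>Stability\<close>

text \<open>The compactly supported smooth functions, set to \<open>0\<close> off the carrier of the manifold so that each
  of them is a single element of the function type.\<close>

definition test_functions :: "nat \<Rightarrow> 'a topology \<Rightarrow> 'a chart set \<Rightarrow> ('a \<Rightarrow> real) set" where
  "test_functions n X \<A> =
     {f. smooth_fun n \<A> f \<and> compactin X (X closure_of {p\<in>topspace X. f p \<noteq> 0}) \<and>
         (\<forall>p. p \<notin> topspace X \<longrightarrow> f p = 0)}"

definition stability_form ::
    "nat \<Rightarrow> 'a topology \<Rightarrow> 'a chart set \<Rightarrow> ('a \<Rightarrow> nat \<Rightarrow> real) \<Rightarrow> ('a \<Rightarrow> nat \<Rightarrow> real) \<Rightarrow>
     ('a \<Rightarrow> real) \<Rightarrow> real" where
  "stability_form n X \<A> F N f =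
     (let g = induced_metric n F; A = second_fundamental_form n F N in
      \<integral>p. grad_norm_sq n \<A> g f p - (form_norm_sq n \<A> g A p - real n) * (f p)\<^sup>2
        \<partial>riem_measure n X \<A> g)"

definition strongly_stable ::
    "nat \<Rightarrow> 'a topology \<Rightarrow> 'a chart set \<Rightarrow> ('a \<Rightarrow> nat \<Rightarrow> real) \<Rightarrow> ('a \<Rightarrow> nat \<Rightarrow> real) \<Rightarrow> bool" where
  "strongly_stable n X \<A> F N \<longleftrightarrow>
     (\<forall>f\<in>test_functions n X \<A>. stability_form n X \<A> F N f \<ge> 0)"

instantiation "fun" :: (type, real_vector) real_vector
begin

definition scaleR_fun :: "real \<Rightarrow> ('a \<Rightarrow> 'b) \<Rightarrow> 'a \<Rightarrow> 'b" where
  "scaleR_fun r f = (\<lambda>x. r *\<^sub>R f x)"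

instance
  by standard (auto simp: scaleR_fun_def plus_fun_def fun_eq_iff scaleR_add_right scaleR_add_left)

end

text \<open>
  The library assigns dimension \<open>0\<close> to infinite-dimensional subspaces. The supremum is unaffected:
  a form negative definite on such a subspace is negative definite on its subspaces of every finite
  dimension, which also occur in the set.
\<close>

definition strong_morse_index ::
    "nat \<Rightarrow> 'a topology \<Rightarrow> 'a chart set \<Rightarrow> ('a \<Rightarrow> nat \<Rightarrow> real) \<Rightarrow> ('a \<Rightarrow> nat \<Rightarrow> real) \<Rightarrow> enat" where
  "strong_morse_index n X \<A> F N =
     Sup {enat (dim V) | V. subspace V \<and> V \<subseteq> test_functions n X \<A> \<and>
            (\<forall>f\<in>V. f \<noteq> 0 \<longrightarrow> stability_form n X \<A> F N f < 0)}"

end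

theory Submission
  imports Defs
begin

text \<open>
  The hypersurfaces are the tubes of radius \<open>r\<close> around a totally geodesic hyperbolic subspace of
  dimension \<open>l = 2 m\<close>, that is, the products of a sphere of dimension \<open>K = m\<close> and radius
  \<open>b = sinh r\<close> with a hyperbolic space of dimension \<open>l\<close> scaled by \<open>a = cosh r\<close>. The principal
  curvatures are \<open>coth r\<close> on the sphere and \<open>tanh r\<close> on the hyperbolic factor, so the potential
  \<open>|A|\<^sup>2 - n = K / b\<^sup>2 - l / a\<^sup>2\<close> is constant. By McKean's inequality the bottom of the spectrum is
  \<open>(l - 1)\<^sup>2 / (4 a\<^sup>2)\<close>, and the radius is chosen so that the two numbers agree, which means
  \<open>4 K a\<^sup>2 = (l + 1)\<^sup>2 b\<^sup>2\<close>.

  In horospherical coordinates McKean's inequality is a weighted one-dimensional Hardy inequality on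
  each line along which only the height varies. Completeness holds because \<open>ln (P 0)\<close> and
  \<open>P k / P 0\<close> are Lipschitz on hyperbolic space in its Minkowski coordinates and the tube is closed.
\<close>

section \<open>Smooth functions\<close>

text \<open>Why \<open>K = m\<close> and \<open>l = 2 m\<close>: at equality
  \<open>coth r = a / b = (l + 1) / (2 sqrt K)\<close>. Put \<open>K = s n\<close>,
  \<open>l = (1 - s) n\<close> for large \<open>n\<close>. The hyperbolic curvatures stay below 1,
  so \<open>H\<close> is about \<open>s * coth r\<close> and \<open>H^2 / n\<close> tends to
  \<open>s (1 - s)^2 / 4\<close>. On \<open>(0, 1)\<close> this is largest at
  \<open>s = 1/3\<close>, with value \<open>1/27\<close>. A stable hypersurface has index 0, so the
  growth of \<open>H_m^2\<close> like \<open>m / 9\<close> excludes every threshold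
  \<open>T\<close>. What shapes the formal proof is that traces, measure and speeds are read in
  charts picked by Hilbert choice. The atlas therefore consists of just two charts that differ by a
  sign \<open>\<sigma>\<close>. Only \<open>\<sigma>^2 = 1\<close> enters the metric identities, so
  each is proved for both charts at once, whichever of them is the chosen one.\<close>

lemma topspace_Rn: "topspace (Rn n) = extensional {..<n}"
  by (auto simp: Rn_def PiE_def)

lemma continuous_map_Rn_iff:
  "continuous_map X (Rn n) f \<longleftrightarrow>
     (\<forall>x\<in>topspace X. f x \<in> extensional {..<n}) \<and> (\<forall>i<n. continuous_map X euclideanreal (\<lambda>x. f x i))"
  by (auto simp: Rn_def continuous_map_componentwise)

lemma continuous_map_Rn_component:
  "i < n \<Longrightarrow> continuous_map (subtopology (Rn n) U) euclideanreal (\<lambda>x. x i)"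
  unfolding Rn_def
  by (intro continuous_map_from_subtopology continuous_map_product_projection) auto

lemma fun_upd_extensional: "x \<in> extensional {..<n} \<Longrightarrow> i < n \<Longrightarrow> x(i := t) \<in> extensional {..<(n::nat)}"
  by (auto simp: extensional_def)

lemma continuous_map_fun_upd:
  assumes "x \<in> extensional {..<n}" "i < n"
  shows "continuous_map euclideanreal (Rn n) (\<lambda>t. x(i := t))"
  using assms by (auto simp: continuous_map_Rn_iff fun_upd_extensional)

lemma eventually_fun_upd_in_open:
  assumes "openin (Rn n) U" "x \<in> U" "i < n"
  shows "\<forall>\<^sub>F t in nhds (x i). x(i := t) \<in> U"
proof -
  have x: "x \<in> extensional {..<n}"
    using assms openin_subset[of "Rn n" U] by (auto simp: topspace_Rn)
  have "openin euclideanreal {t \<in> topspace euclideanreal. x(i := t) \<in> U}"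
    using continuous_map_fun_upd[OF x assms(3)] assms(1) by (rule openin_continuous_map_preimage)
  then have "open {t. x(i := t) \<in> U}"
    by simp
  then show ?thesis
    using assms(2) by (auto simp: eventually_nhds intro!: exI[of _ "{t. x(i := t) \<in> U}"])
qed

lemma differentiable_cong_nhds:
  fixes f g :: "real \<Rightarrow> real"
  assumes "\<forall>\<^sub>F t in nhds a. f t = g t"
  shows "f differentiable at a \<longleftrightarrow> g differentiable at a"
proof -
  have "(f has_real_derivative D) (at a) \<longleftrightarrow> (g has_real_derivative D) (at a)" for D
    using assms by (intro DERIV_cong_ev) auto
  then show ?thesis
    by (simp add: real_differentiable_def)
qed

lemma continuous_map_cong:
  assumes "\<And>x. x \<in> topspace X \<Longrightarrow> f x = g x"
  shows "continuous_map X Y f \<longleftrightarrow> continuous_map X Y g"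
  using continuous_map_eq[of X Y f g] continuous_map_eq[of X Y g f] assms by metis

text \<open>A partial derivative at a point of \<open>U\<close> only looks at nearby points of one
  coordinate line, and openness keeps these in \<open>U\<close>. This allows derivatives to be
  replaced by closed formulas that are valid on \<open>U\<close> only, as the closure rules below
  require.\<close>

lemma Ck_on_cong:
  assumes "openin (Rn n) U" "\<And>x. x \<in> U \<Longrightarrow> f x = g x"
  shows "Ck_on n k U f \<longleftrightarrow> Ck_on n k U g"
  using assms(2)
proof (induction k arbitrary: f g)
  case 0
  then show ?case
    using continuous_map_cong[of "subtopology (Rn n) U" f g] by simp
next
  case (Suc k)
  have ev: "\<forall>\<^sub>F t in nhds (x i). f (x(i := t)) = g (x(i := t))" if "x \<in> U" "i < n" for x i
    using eventually_fun_upd_in_open[OF assms(1) that] by (rule eventually_mono) (use Suc in auto)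
  have "partial_deriv i f x = partial_deriv i g x" if "x \<in> U" "i < n" for x i
    unfolding partial_deriv_def using ev[OF that] by (intro deriv_cong_ev) auto
  then have "Ck_on n k U (partial_deriv i f) \<longleftrightarrow> Ck_on n k U (partial_deriv i g)" if "i < n" for i
    using that by (intro Suc.IH) auto
  moreover have "(\<lambda>t. f (x(i := t))) differentiable (at (x i)) \<longleftrightarrow> (\<lambda>t. g (x(i := t))) differentiable (at (x i))"
    if "x \<in> U" "i < n" for x i
    using ev[OF that] by (rule differentiable_cong_nhds)
  moreover have "continuous_map (subtopology (Rn n) U) euclideanreal f \<longleftrightarrow>
      continuous_map (subtopology (Rn n) U) euclideanreal g"
    using Suc.prems continuous_map_cong[of "subtopology (Rn n) U" f g] by simp
  ultimately show ?case
    by auto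
qed

lemma Ck_on_Suc_imp: "Ck_on n (Suc k) U f \<Longrightarrow> Ck_on n k U f"
  by (induction k arbitrary: f) auto

lemma Ck_on_const: "Ck_on n k U (\<lambda>_. c)"
proof (induction k arbitrary: c)
  case (Suc k)
  have "partial_deriv i (\<lambda>_. c) = (\<lambda>_. 0)" for i
    by (auto simp: partial_deriv_def)
  with Suc show ?case by simp
qed auto

lemma Ck_on_coord:
  assumes "j < n"
  shows "Ck_on n k U (\<lambda>x. x j)"
proof (cases k)
  case 0
  then show ?thesis
    using assms by (simp add: continuous_map_Rn_component)
next
  case (Suc k')
  have "partial_deriv i (\<lambda>x. x j) = (\<lambda>_. if i = j then 1 else 0)" for i
    by (auto simp: partial_deriv_def fun_eq_iff)
  moreover have "(\<lambda>t. (x(i := t)) j) differentiable at (x i)" for i and x :: "nat \<Rightarrow> real"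
    by (cases "i = j") auto
  ultimately show ?thesis
    using assms Suc by (simp add: continuous_map_Rn_component Ck_on_const del: fun_upd_apply)
qed

lemma has_real_derivative_partial_deriv:
  assumes "(\<lambda>t. f (x(i := t))) differentiable (at (x i))"
  shows "((\<lambda>t. f (x(i := t))) has_real_derivative partial_deriv i f x) (at (x i))"
  using assms unfolding partial_deriv_def by (simp add: DERIV_deriv_iff_real_differentiable)

lemma partial_deriv_eqI:
  "((\<lambda>t. f (x(i := t))) has_real_derivative D) (at (x i)) \<Longrightarrow> partial_deriv i f x = D"
  unfolding partial_deriv_def by (rule DERIV_imp_deriv)

lemma Ck_on_add:
  assumes "openin (Rn n) U" "Ck_on n k U f" "Ck_on n k U g"
  shows "Ck_on n k U (\<lambda>x. f x + g x)"
  using assms(2,3)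
proof (induction k arbitrary: f g)
  case 0
  then show ?case by (simp add: continuous_map_add)
next
  case (Suc k)
  have d: "((\<lambda>t. f (x(i := t)) + g (x(i := t))) has_real_derivative
      partial_deriv i f x + partial_deriv i g x) (at (x i))" if "x \<in> U" "i < n" for x i
    using that Suc.prems by (intro DERIV_add has_real_derivative_partial_deriv) auto
  have pd: "partial_deriv i (\<lambda>x. f x + g x) x = partial_deriv i f x + partial_deriv i g x" if "x \<in> U" "i < n" for x i
    using d[OF that] by (rule partial_deriv_eqI)
  have "Ck_on n k U (partial_deriv i (\<lambda>x. f x + g x))" if "i < n" for i
    using Ck_on_cong[OF assms(1), of "partial_deriv i (\<lambda>x. f x + g x)"
        "\<lambda>x. partial_deriv i f x + partial_deriv i g x" k] pd Suc that by auto
  moreover have "(\<lambda>t. f (x(i := t)) + g (x(i := t))) differentiable (at (x i))" if "x \<in> U" "i < n" for x i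
    using d[OF that] by (auto simp: real_differentiable_def)
  ultimately show ?case
    using Suc.prems by (auto intro: continuous_map_add)
qed

lemma Ck_on_mult:
  assumes "openin (Rn n) U" "Ck_on n k U f" "Ck_on n k U g"
  shows "Ck_on n k U (\<lambda>x. f x * g x)"
  using assms(2,3)
proof (induction k arbitrary: f g)
  case 0
  then show ?case by (simp add: continuous_map_real_mult)
next
  case (Suc k)
  have d: "((\<lambda>t. f (x(i := t)) * g (x(i := t))) has_real_derivative
      partial_deriv i f x * g x + f x * partial_deriv i g x) (at (x i))" if "x \<in> U" "i < n" for x i
    using DERIV_mult[OF has_real_derivative_partial_deriv[of f x i] has_real_derivative_partial_deriv[of g x i]]
      that Suc.prems by (simp add: algebra_simps)
  have pd: "partial_deriv i (\<lambda>x. f x * g x) x = partial_deriv i f x * g x + f x * partial_deriv i g x" if "x \<in> U" "i < n" for x i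
    using d[OF that] by (rule partial_deriv_eqI)
  have "Ck_on n k U (\<lambda>x. partial_deriv i f x * g x + f x * partial_deriv i g x)" if "i < n" for i
    using that Suc.prems Suc.prems[THEN Ck_on_Suc_imp] by (intro Ck_on_add[OF assms(1)] Suc.IH) auto
  then have "Ck_on n k U (partial_deriv i (\<lambda>x. f x * g x))" if "i < n" for i
    using Ck_on_cong[OF assms(1), of "partial_deriv i (\<lambda>x. f x * g x)"
        "\<lambda>x. partial_deriv i f x * g x + f x * partial_deriv i g x" k] pd that by auto
  moreover have "(\<lambda>t. f (x(i := t)) * g (x(i := t))) differentiable (at (x i))" if "x \<in> U" "i < n" for x i
    using d[OF that] by (auto simp: real_differentiable_def)
  ultimately show ?case
    using Suc.prems by (auto intro: continuous_map_real_mult)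
qed

lemma Ck_on_exp:
  assumes "openin (Rn n) U" "Ck_on n k U f"
  shows "Ck_on n k U (\<lambda>x. exp (f x))"
  using assms(2)
proof (induction k arbitrary: f)
  case 0
  have "continuous_map (subtopology (Rn n) U) euclideanreal (exp \<circ> f)"
    using 0 by (intro continuous_map_compose[where X' = euclideanreal]) (auto intro: continuous_intros)
  then show ?case by (simp add: o_def)
next
  case (Suc k)
  have d: "((\<lambda>t. exp (f (x(i := t)))) has_real_derivative exp (f x) * partial_deriv i f x) (at (x i))"
    if "x \<in> U" "i < n" for x i
    using DERIV_fun_exp[OF has_real_derivative_partial_deriv[of f x i]] that Suc.prems by simp
  have pd: "partial_deriv i (\<lambda>x. exp (f x)) x = exp (f x) * partial_deriv i f x" if "x \<in> U" "i < n" for x i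
    using d[OF that] by (rule partial_deriv_eqI)
  have "Ck_on n k U (\<lambda>x. exp (f x) * partial_deriv i f x)" if "i < n" for i
    using that Suc.prems Suc.prems[THEN Ck_on_Suc_imp] by (intro Ck_on_mult[OF assms(1)] Suc.IH) auto
  then have "Ck_on n k U (partial_deriv i (\<lambda>x. exp (f x)))" if "i < n" for i
    using Ck_on_cong[OF assms(1), of "partial_deriv i (\<lambda>x. exp (f x))"
        "\<lambda>x. exp (f x) * partial_deriv i f x" k] pd that by auto
  moreover have "(\<lambda>t. exp (f (x(i := t)))) differentiable (at (x i))" if "x \<in> U" "i < n" for x i
    using d[OF that] by (auto simp: real_differentiable_def)
  moreover have "continuous_map (subtopology (Rn n) U) euclideanreal (exp \<circ> f)"
    using Suc.prems by (intro continuous_map_compose[where X' = euclideanreal]) (auto intro: continuous_intros)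
  ultimately show ?case
    using Suc.prems by (auto simp: o_def)
qed

text \<open>The derivative of \<open>1 / f\<close> is \<open>- f' / f^2\<close>, a polynomial in
  \<open>f'\<close> and \<open>1 / f\<close>. Only the inverse of the same \<open>f\<close> recurs,
  so \<open>f\<close> stays fixed in the induction; the derivative is written as a nested product so
  that \<open>Ck_on_mult\<close> applies factor by factor.\<close>

lemma Ck_on_inverse:
  assumes "openin (Rn n) U" "Ck_on n k U f" "\<And>x. x \<in> U \<Longrightarrow> f x \<noteq> 0"
  shows "Ck_on n k U (\<lambda>x. inverse (f x))"
  using assms(2)
proof (induction k)
  case 0
  with assms(3) show ?case by (auto intro: continuous_map_real_inverse)
next
  case (Suc k)
  have d: "((\<lambda>t. inverse (f (x(i := t)))) has_real_derivative
      (-1) * (partial_deriv i f x * (inverse (f x) * inverse (f x)))) (at (x i))" if "x \<in> U" "i < n" for x i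
    using DERIV_inverse_fun[OF has_real_derivative_partial_deriv[of f x i]] that Suc.prems assms(3)
    by (auto simp: algebra_simps)
  have pd: "partial_deriv i (\<lambda>x. inverse (f x)) x = (-1) * (partial_deriv i f x * (inverse (f x) * inverse (f x)))" if "x \<in> U" "i < n" for x i
    using d[OF that] by (rule partial_deriv_eqI)
  have "Ck_on n k U (\<lambda>x. (-1) * (partial_deriv i f x * (inverse (f x) * inverse (f x))))" if "i < n" for i
    using that Suc.prems Suc.prems[THEN Ck_on_Suc_imp] by (intro Ck_on_mult[OF assms(1)] Ck_on_const Suc.IH) auto
  then have "Ck_on n k U (partial_deriv i (\<lambda>x. inverse (f x)))" if "i < n" for i
    using Ck_on_cong[OF assms(1), of "partial_deriv i (\<lambda>x. inverse (f x))"
        "\<lambda>x. (-1) * (partial_deriv i f x * (inverse (f x) * inverse (f x)))" k] pd that by auto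
  moreover have "(\<lambda>t. inverse (f (x(i := t)))) differentiable (at (x i))" if "x \<in> U" "i < n" for x i
    using d[OF that] by (auto simp: real_differentiable_def)
  ultimately show ?case
    using Suc.prems assms(3) by (auto intro: continuous_map_real_inverse)
qed

section \<open>Closure properties of smooth functions\<close>

lemma smooth_on_cong:
  "openin (Rn n) U \<Longrightarrow> (\<And>x. x \<in> U \<Longrightarrow> f x = g x) \<Longrightarrow> smooth_on n U f \<longleftrightarrow> smooth_on n U g"
  unfolding smooth_on_def using Ck_on_cong by blast

lemma smooth_on_const: "smooth_on n U (\<lambda>_. c)"
  by (simp add: smooth_on_def Ck_on_const)

lemma smooth_on_coord: "j < n \<Longrightarrow> smooth_on n U (\<lambda>x. x j)"
  by (simp add: smooth_on_def Ck_on_coord)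

lemma smooth_on_add:
  "openin (Rn n) U \<Longrightarrow> smooth_on n U f \<Longrightarrow> smooth_on n U g \<Longrightarrow> smooth_on n U (\<lambda>x. f x + g x)"
  by (simp add: smooth_on_def Ck_on_add)

lemma smooth_on_mult:
  "openin (Rn n) U \<Longrightarrow> smooth_on n U f \<Longrightarrow> smooth_on n U g \<Longrightarrow> smooth_on n U (\<lambda>x. f x * g x)"
  by (simp add: smooth_on_def Ck_on_mult)

lemma smooth_on_exp: "openin (Rn n) U \<Longrightarrow> smooth_on n U f \<Longrightarrow> smooth_on n U (\<lambda>x. exp (f x))"
  by (simp add: smooth_on_def Ck_on_exp)

lemma smooth_on_divide:
  "openin (Rn n) U \<Longrightarrow> smooth_on n U f \<Longrightarrow> smooth_on n U g \<Longrightarrow> (\<And>x. x \<in> U \<Longrightarrow> g x \<noteq> 0) \<Longrightarrow>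
    smooth_on n U (\<lambda>x. f x / g x)"
  unfolding divide_inverse by (simp add: smooth_on_def Ck_on_mult Ck_on_inverse)

lemma smooth_on_minus: "openin (Rn n) U \<Longrightarrow> smooth_on n U f \<Longrightarrow> smooth_on n U (\<lambda>x. - f x)"
  using smooth_on_mult[OF _ smooth_on_const[of n U "-1"]] by simp

lemma smooth_on_diff:
  "openin (Rn n) U \<Longrightarrow> smooth_on n U f \<Longrightarrow> smooth_on n U g \<Longrightarrow> smooth_on n U (\<lambda>x. f x - g x)"
  using smooth_on_add[OF _ _ smooth_on_minus, of n U f g] by simp

lemma smooth_on_sum:
  assumes "openin (Rn n) U" "\<And>i. i \<in> I \<Longrightarrow> smooth_on n U (f i)"
  shows "smooth_on n U (\<lambda>x. \<Sum>i\<in>I. f i x)"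
  using assms(2)
proof (induction I rule: infinite_finite_induct)
  case (insert i I)
  then show ?case by (simp add: smooth_on_add[OF assms(1)])
qed (simp_all add: smooth_on_const)

lemmas smooth_on_intros = smooth_on_const smooth_on_coord smooth_on_add smooth_on_mult smooth_on_exp
  smooth_on_divide smooth_on_minus smooth_on_diff smooth_on_sum

lemma smooth_onD:
  assumes "smooth_on n U f"
  shows "continuous_map (subtopology (Rn n) U) euclideanreal f"
    and "i < n \<Longrightarrow> x \<in> U \<Longrightarrow> (\<lambda>t. f (x(i := t))) differentiable (at (x i))"
    and "i < n \<Longrightarrow> continuous_map (subtopology (Rn n) U) euclideanreal (partial_deriv i f)"
proof -
  have "Ck_on n (Suc 0) U f"
    using assms by (simp only: smooth_on_def)
  then show "continuous_map (subtopology (Rn n) U) euclideanreal f"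
    and "i < n \<Longrightarrow> x \<in> U \<Longrightarrow> (\<lambda>t. f (x(i := t))) differentiable (at (x i))"
    and "i < n \<Longrightarrow> continuous_map (subtopology (Rn n) U) euclideanreal (partial_deriv i f)"
    by auto
qed

section \<open>Topology and measure on n-dimensional space\<close>

text \<open>Extension by zero embeds n-space into the space of all real sequences, a type with a
  second countable topology. Second countability passes to the subspace and back through the
  homeomorphism.\<close>

lemma Rn_homeomorphic_subspace:
  "Rn n homeomorphic_space subtopology euclidean {f :: nat \<Rightarrow> real. \<forall>i\<ge>n. f i = 0}"
proof -
  let ?e = "\<lambda>(f :: nat \<Rightarrow> real) i. if i < n then f i else 0"
  have "continuous_map (Rn n) (product_topology (\<lambda>_. euclideanreal) (UNIV :: nat set)) ?e"
    using continuous_map_Rn_component[of _ n UNIV] by (auto simp: continuous_map_componentwise)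
  moreover have "continuous_map (product_topology (\<lambda>_. euclideanreal) (UNIV :: nat set)) (Rn n) (\<lambda>f. restrict f {..<n})"
    using continuous_map_product_projection[of _ "UNIV :: nat set" "\<lambda>_. euclideanreal"]
    by (auto simp: continuous_map_Rn_iff)
  ultimately have "homeomorphic_maps (Rn n) (subtopology euclidean {f :: nat \<Rightarrow> real. \<forall>i\<ge>n. f i = 0})
      ?e (\<lambda>f. restrict f {..<n})"
    unfolding homeomorphic_maps_def euclidean_product_topology
    by (auto simp: continuous_map_in_subtopology continuous_map_from_subtopology topspace_Rn
        extensional_def fun_eq_iff)
  then show ?thesis
    by (auto simp: homeomorphic_space_def)
qed

lemma second_countable_euclidean: "second_countable (euclidean :: 'a :: second_countable_topology topology)"
proof -
  obtain B :: "'a set set" where B: "countable B" "topological_basis B"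
    using ex_countable_basis by blast
  show ?thesis
    unfolding second_countable_def
  proof (intro exI[of _ B] conjI ballI allI impI)
    show "openin euclidean V" if "V \<in> B" for V
      using topological_basis_open[OF B(2) that] by simp
    show "\<exists>V\<in>B. x \<in> V \<and> V \<subseteq> U" if "openin euclidean U \<and> x \<in> U" for U x
      using that topological_basisE[OF B(2), of U x] by (metis open_openin)
  qed (fact B(1))
qed

lemma second_countable_Rn: "second_countable (Rn n)"
  using homeomorphic_space_second_countability[OF Rn_homeomorphic_subspace[of n]]
    second_countable_subtopology[OF second_countable_euclidean] by blast

lemma connected_space_Rn: "connected_space (Rn n)"
  using connectedin_topspace[of euclideanreal] by (auto simp: Rn_def connected_space_product_topology)

lemma Hausdorff_space_Rn: "Hausdorff_space (Rn n)"
  by (simp add: Rn_def Hausdorff_space_product_topology)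

text \<open>For countably many real lines the Borel sets of the product topology form the product
  sigma-algebra. An open set is pulled back by restriction to an open set \<open>V\<close> of
  sequences and recovered as the preimage of \<open>V\<close> under extension by zero, which is
  measurable coordinate by coordinate.\<close>

lemma openin_Rn_sets:
  assumes "openin (Rn n) U"
  shows "U \<in> sets (PiM {..<n} (\<lambda>_. lborel))"
proof -
  let ?e = "\<lambda>(f :: nat \<Rightarrow> real) i. if i < n then f i else 0"
  define V where "V = {f :: nat \<Rightarrow> real. restrict f {..<n} \<in> U}"
  have "continuous_map (product_topology (\<lambda>_. euclideanreal) (UNIV :: nat set)) (Rn n) (\<lambda>f. restrict f {..<n})"
    using continuous_map_product_projection[of _ "UNIV :: nat set" "\<lambda>_. euclideanreal"]
    by (auto simp: continuous_map_Rn_iff)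
  from openin_continuous_map_preimage[OF this assms] have "open V"
    by (simp add: euclidean_product_topology V_def)
  then have V: "V \<in> sets (PiM UNIV (\<lambda>_. borel))"
    by (simp add: sets_PiM_equal_borel)
  have e: "?e \<in> measurable (PiM {..<n} (\<lambda>_. lborel)) (PiM UNIV (\<lambda>_. borel :: real measure))"
  proof (rule measurable_PiM_single')
    fix i :: nat
    show "(\<lambda>f. if i < n then f i else 0) \<in> borel_measurable (PiM {..<n} (\<lambda>_. lborel))"
      using measurable_component_singleton[of i "{..<n}" "\<lambda>_. lborel :: real measure"] by (cases "i < n") auto
  qed (auto simp: space_PiM)
  have "?e -` V \<inter> space (PiM {..<n} (\<lambda>_. lborel)) \<in> sets (PiM {..<n} (\<lambda>_. lborel))"
    using measurable_sets[OF e V] .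
  also have "?e -` V \<inter> space (PiM {..<n} (\<lambda>_. lborel)) = U"
  proof -
    have "restrict (?e f) {..<n} = f" if "f \<in> extensional {..<n}" for f
      using that by (auto simp: extensional_def fun_eq_iff)
    moreover have "U \<subseteq> extensional {..<n}"
      using openin_subset[OF assms] by (simp add: topspace_Rn)
    ultimately show ?thesis
      by (auto simp: V_def space_PiM PiE_def simp del: restrict_apply)
  qed
  finally show ?thesis .
qed

section \<open>Product Lebesgue measure and integral inequalities in one variable\<close>

interpretation lborel_product: product_sigma_finite "\<lambda>_ :: nat. lborel :: real measure"
  by standard

text \<open>One side of the box is \<open>{0}\<close>, so a factor of the product measure vanishes.
  Such a slice later contains the chart image of everything that the first chart of the cover
  misses.\<close>

lemma null_sets_coordinate_zero:
  fixes n :: nat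
  assumes "i < n"
  shows "{x \<in> space (PiM {..<n} (\<lambda>_. lborel)). x i = 0} \<in> null_sets (PiM {..<n} (\<lambda>_. lborel :: real measure))"
proof -
  let ?A = "\<lambda>j. if j = i then {0 :: real} else UNIV"
  have "{x \<in> space (PiM {..<n} (\<lambda>_. lborel)). x i = 0} = Pi\<^sub>E {..<n} ?A"
    using assms by (auto simp: space_PiM PiE_def Pi_def split: if_splits)
  moreover have "Pi\<^sub>E {..<n} ?A \<in> sets (PiM {..<n} (\<lambda>_. lborel))"
    by (rule sets_PiM_I_finite) auto
  moreover have "emeasure (PiM {..<n} (\<lambda>_. lborel)) (Pi\<^sub>E {..<n} ?A) = (\<Prod>j<n. emeasure lborel (?A j))"
    by (rule lborel_product.emeasure_PiM) auto
  moreover have "(\<Prod>j<n. emeasure lborel (?A j)) = 0"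
    using assms by (intro prod_zero) auto
  ultimately show ?thesis
    by (auto simp: null_sets_def)
qed

text \<open>The function \<open>v\<close> will be the speed of a curve, of which only the pointwise
  bound is known. If its integral is infinite there is nothing to show; otherwise the derivative,
  gauge integrable and hence measurable, is dominated and so Lebesgue integrable.\<close>

lemma ennreal_increment_le_nn_integral:
  fixes f f' v :: "real \<Rightarrow> real"
  assumes "continuous_on {0..1} f" "finite S"
    and deriv: "\<And>t. t \<in> {0<..<1} - S \<Longrightarrow> (f has_real_derivative f' t) (at t)"
    and bound: "\<And>t. t \<in> {0<..<1} - S \<Longrightarrow> \<bar>f' t\<bar> \<le> v t"
  shows "ennreal \<bar>f 1 - f 0\<bar> \<le> (\<integral>\<^sup>+t\<in>{0..1}. ennreal (v t) \<partial>lborel)"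
proof (cases "(\<integral>\<^sup>+t\<in>{0..1}. ennreal (v t) \<partial>lborel) = \<infinity>")
  case False
  \<comment> \<open>The derivative is extended by 0 to the endpoints and the finite exceptional set,
    which the fundamental theorem tolerates.\<close>
  define g where "g t = (if t \<in> {0<..<1} - S then f' t else 0)" for t
  have "(g has_integral f 1 - f 0) {0..1}"
    using assms(1,2) deriv
    by (intro fundamental_theorem_of_calculus_interior_strong[of S])
      (auto simp: g_def has_real_derivative_iff_has_vector_derivative)
  then have g: "g integrable_on {0..1}" "integral {0..1} g = f 1 - f 0"
    by (auto simp: integrable_on_def)
  have "(\<integral>\<^sup>+t. ennreal (norm (g t)) \<partial>lebesgue_on {0..1}) = (\<integral>\<^sup>+t\<in>{0..1}. ennreal (norm (g t)) \<partial>lebesgue)"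
    by (subst nn_integral_restrict_space) auto
  also have "\<dots> = (\<integral>\<^sup>+t\<in>{0..1}. ennreal (norm (g t)) \<partial>lborel)"
    by (rule nn_integral_completion)
  also have "\<dots> \<le> (\<integral>\<^sup>+t\<in>{0..1}. ennreal (v t) \<partial>lborel)"
    using bound by (intro nn_integral_mono) (auto simp: g_def indicator_def intro!: ennreal_leI)
  finally have le: "(\<integral>\<^sup>+t. ennreal (norm (g t)) \<partial>lebesgue_on {0..1}) \<le> (\<integral>\<^sup>+t\<in>{0..1}. ennreal (v t) \<partial>lborel)" .
  have int: "integrable (lebesgue_on {0..1}) g"
    using le False integrable_imp_measurable[OF g(1)] by (intro integrableI_bounded) (auto simp: less_top[symmetric] top_unique)
  have "ennreal \<bar>f 1 - f 0\<bar> = ennreal (norm (integral\<^sup>L (lebesgue_on {0..1}) g))"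
    using int g(2) by (subst lebesgue_integral_eq_integral) auto
  also have "\<dots> \<le> (\<integral>\<^sup>+t. ennreal (norm (g t)) \<partial>lebesgue_on {0..1})"
    using int by (rule integral_norm_bound_ennreal)
  finally show ?thesis
    using le by simp
qed simp

text \<open>Completing the square, \<open>(\<phi>' + \<alpha> \<phi>)\<^sup>2 \<ge> 0\<close> bounds the integrand from below by the derivative of
  \<open>- \<alpha> \<phi>\<^sup>2 exp (2 \<alpha> t)\<close>.\<close>

lemma weighted_hardy_nonneg:
  fixes \<phi> \<phi>' q :: "real \<Rightarrow> real"
  assumes deriv: "\<And>t. (\<phi> has_real_derivative \<phi>' t) (at t)"
    and cont: "continuous_on UNIV \<phi>'"
    and supp: "\<And>t. R \<le> \<bar>t\<bar> \<Longrightarrow> \<phi> t = 0"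
    and "C \<ge> 0"
    and q: "\<And>t. q t \<ge> C * (((\<phi>' t)\<^sup>2 - \<alpha>\<^sup>2 * (\<phi> t)\<^sup>2) * exp (2 * \<alpha> * t))"
    and q_nonneg: "\<And>t. R \<le> \<bar>t\<bar> \<Longrightarrow> q t \<ge> 0"
  shows "(\<integral>t. q t \<partial>lborel) \<ge> 0"
\<comment> \<open>A non-integrable \<open>q\<close> has Bochner integral 0, so only the integrable
  case needs work.\<close>
proof (cases "integrable lborel q")
  case True
  \<comment> \<open>\<open>R\<close> may be negative; \<open>r\<close> makes \<open>{- r..r}\<close>
    nonempty with endpoints in the zero region of \<open>\<phi>\<close>, so the boundary terms
    \<open>G r\<close> and \<open>G (- r)\<close> vanish.\<close>
  define r where "r = max R 0"
  define G where "G t = - C * \<alpha> * ((\<phi> t)\<^sup>2 * exp (2 * \<alpha> * t))" for t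
  define G' where "G' t = - C * \<alpha> * ((2 * \<phi> t * \<phi>' t + 2 * \<alpha> * (\<phi> t)\<^sup>2) * exp (2 * \<alpha> * t))" for t
  have dG: "(G has_real_derivative G' t) (at t)" for t
    unfolding G_def G'_def
    by (rule derivative_eq_intros deriv refl | simp add: algebra_simps power2_eq_square)+
  have c\<phi>: "continuous_on UNIV \<phi>"
    using deriv by (intro DERIV_continuous_on) auto
  have cG': "continuous_on UNIV G'"
    unfolding G'_def by (intro continuous_intros c\<phi> cont)
  have r: "- r \<le> r" by (simp add: r_def)
  have FTC: "has_bochner_integral lborel (\<lambda>t. indicator {-r..r} t *\<^sub>R G' t) (G r - G (- r))"
    using dG cG' r
    by (intro has_bochner_integral_FTC_Icc)
      (auto simp: has_real_derivative_iff_has_vector_derivative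
        intro: has_vector_derivative_at_within continuous_on_subset)
  have "G r - G (- r) = 0"
    using supp[of r] supp[of "- r"] by (simp add: G_def r_def)
  moreover have "indicator {-r..r} t *\<^sub>R G' t \<le> q t" for t
  proof (cases "t \<in> {-r..r}")
    case True
    have "0 \<le> C * ((\<phi>' t + \<alpha> * \<phi> t)\<^sup>2 * exp (2 * \<alpha> * t))"
      using \<open>C \<ge> 0\<close> by simp
    also have "\<dots> = C * (((\<phi>' t)\<^sup>2 - \<alpha>\<^sup>2 * (\<phi> t)\<^sup>2) * exp (2 * \<alpha> * t)) - G' t"
      by (simp add: G'_def power2_eq_square algebra_simps)
    finally show ?thesis
      using q[of t] True by simp
  next
    case False
    then show ?thesis
      using q_nonneg[of t] by (auto simp: r_def)
  qed
  ultimately show ?thesis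
    using integral_mono[OF _ True, of "\<lambda>t. indicator {-r..r} t *\<^sub>R G' t"] FTC
    by (simp add: has_bochner_integral_iff)
qed (simp add: not_integrable_integral_eq)

section \<open>Diagonal metrics\<close>

text \<open>\<open>metric_inv\<close> unpacks the optional result of a matrix inversion. The
  explicit diagonal matrix \<open>B\<close> shows that the Gram matrix is a unit, hence that
  inversion succeeds with some \<open>C\<close>; associativity then identifies \<open>C\<close> with
  \<open>B\<close>.\<close>

lemma
  assumes g: "\<And>i j. i < n \<Longrightarrow> j < n \<Longrightarrow> g c p i j = (if i = j then d i else 0)"
    and d: "\<And>i. i < n \<Longrightarrow> d i \<noteq> 0"
  shows metric_inv_diagonal: "i < n \<Longrightarrow> j < n \<Longrightarrow> metric_inv n g c p i j = (if i = j then inverse (d i) else 0)"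
    and det_gram_diagonal: "Determinant.det (gram n g c p) = (\<Prod>i<n. d i)"
proof -
  let ?A = "gram n g c p"
  define B where "B = mat n n (\<lambda>(i, j). if i = j then inverse (d i) else 0 :: real)"
  have A: "?A \<in> carrier_mat n n" and B: "B \<in> carrier_mat n n"
    by (auto simp: gram_def B_def)
  have AB: "?A * B = 1\<^sub>m n" and BA: "B * ?A = 1\<^sub>m n"
    using d by (auto simp: gram_def B_def g scalar_prod_def if_distrib[of "\<lambda>x. x * _"] if_distrib[of "\<lambda>x. _ * x"]
        sum.delta cong: if_cong intro!: eq_matI)
  have "?A \<in> Units (ring_mat TYPE(real) n ())"
    using A B AB BA by (auto simp: Units_def ring_mat_def)
  then obtain C where C: "mat_inverse ?A = Some C"
    using mat_inverse(1)[OF A, of "()"] by (cases "mat_inverse ?A") auto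
  have CA: "C * ?A = 1\<^sub>m n" and Cc: "C \<in> carrier_mat n n"
    using mat_inverse(2)[OF A C] by auto
  have "C = C * (?A * B)"
    using Cc by (simp add: AB)
  also have "\<dots> = (C * ?A) * B"
    using assoc_mult_mat[OF Cc A B] by simp
  also have "\<dots> = B"
    using B by (simp add: CA)
  finally have "C = B" .
  then show "i < n \<Longrightarrow> j < n \<Longrightarrow> metric_inv n g c p i j = (if i = j then inverse (d i) else 0)"
    using C by (simp add: metric_inv_def B_def)
  have "upper_triangular ?A"
    by (auto simp: gram_def g)
  then have "Determinant.det ?A = prod_list (diag_mat ?A)"
    using A by (rule det_upper_triangular)
  also have "\<dots> = (\<Prod>i<n. d i)"
    by (simp add: diag_mat_def gram_def g prod.list_conv_set_nth atLeast0LessThan)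
  finally show "Determinant.det ?A = (\<Prod>i<n. d i)" .
qed

context
  fixes n :: nat and \<A> :: "'a chart set" and g :: "'a form2" and p :: 'a and d :: "nat \<Rightarrow> real"
  assumes g: "\<And>i j. i < n \<Longrightarrow> j < n \<Longrightarrow> g (base_chart \<A> p) p i j = (if i = j then d i else 0)"
    and d: "\<And>i. i < n \<Longrightarrow> d i \<noteq> 0"
begin

lemma metric_inv_base_chart:
  "i < n \<Longrightarrow> j < n \<Longrightarrow> metric_inv n g (base_chart \<A> p) p i j = (if i = j then inverse (d i) else 0)"
  using metric_inv_diagonal[of n g "base_chart \<A> p" p d] g d by blast

lemma grad_norm_sq_diagonal:
  "grad_norm_sq n \<A> g f p = (\<Sum>i<n. (chart_deriv (base_chart \<A> p) i f p)\<^sup>2 / d i)"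
  by (simp add: grad_norm_sq_def Let_def metric_inv_base_chart if_distrib[of "\<lambda>x. x * _"]
      sum.delta power2_eq_square divide_simps cong: if_cong)

text \<open>Since the entries are \<open>\<kappa> i * d i\<close>, raising an index by the inverse
  metric leaves the diagonal matrix of the \<open>\<kappa> i\<close>. For the second fundamental
  form these are the principal curvatures.\<close>

lemma metric_trace_diagonal:
  assumes "\<And>i j. i < n \<Longrightarrow> j < n \<Longrightarrow> B (base_chart \<A> p) p i j = (if i = j then \<kappa> i * d i else 0)"
  shows "metric_trace n \<A> g B p = (\<Sum>i<n. \<kappa> i)"
proof -
  have "metric_trace n \<A> g B p = (\<Sum>i<n. \<Sum>j<n. if i = j then \<kappa> i else 0)"
    unfolding metric_trace_def Let_def
    by (intro sum.cong refl) (auto simp: metric_inv_base_chart assms d)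
  then show ?thesis
    by (simp add: sum.delta)
qed

lemma form_norm_sq_diagonal:
  assumes B: "\<And>i j. i < n \<Longrightarrow> j < n \<Longrightarrow> B (base_chart \<A> p) p i j = (if i = j then \<kappa> i * d i else 0)"
  shows "form_norm_sq n \<A> g B p = (\<Sum>i<n. (\<kappa> i)\<^sup>2)"
proof -
  let ?I = "metric_inv n g (base_chart \<A> p) p" and ?B = "B (base_chart \<A> p) p"
  have "(\<Sum>k<n. \<Sum>l<n. ?I i k * ?I j l * ?B i j * ?B k l) = (if i = j then (\<kappa> i)\<^sup>2 else 0)"
    if ij: "i < n" "j < n" for i j
  proof -
    have "(\<Sum>k<n. \<Sum>l<n. ?I i k * ?I j l * ?B i j * ?B k l) =
        (\<Sum>k<n. \<Sum>l<n. if l = j then (if k = i then ?I i i * ?I j j * ?B i j * ?B i j else 0) else 0)"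
      using ij by (intro sum.cong refl) (auto simp: metric_inv_base_chart)
    also have "\<dots> = ?I i i * ?I j j * ?B i j * ?B i j"
      using ij by (simp add: sum.delta)
    also have "\<dots> = (if i = j then (\<kappa> i)\<^sup>2 else 0)"
      using ij d[of j] by (simp add: metric_inv_base_chart B power2_eq_square field_simps)
    finally show ?thesis .
  qed
  then have "form_norm_sq n \<A> g B p = (\<Sum>i<n. \<Sum>j<n. if i = j then (\<kappa> i)\<^sup>2 else 0)"
    unfolding form_norm_sq_def Let_def by (intro sum.cong refl) auto
  then show ?thesis
    by (simp add: sum.delta)
qed

end

section \<open>Tubes around totally geodesic subspaces\<close>

text \<open>The product of the sphere of dimension \<open>K\<close> and radius \<open>b\<close> with the hyperbolic space of
  dimension \<open>l\<close> scaled by \<open>a\<close>, where \<open>a = cosh r\<close> and \<open>b = sinh r\<close> for a tube of radius \<open>r\<close>.\<close>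

locale tube =
  fixes l K :: nat and a b :: real
  assumes l_pos: "0 < l" and K_pos: "0 < K" and a_pos: "0 < a" and b_pos: "0 < b"
    and ab: "a\<^sup>2 = 1 + b\<^sup>2"
begin

abbreviation n :: nat where "n \<equiv> l + K"

text \<open>Ambient indices \<open>0..l\<close> carry the hyperbolic factor,
  \<open>Suc l..Suc n\<close> the sphere. The last index of each block is split off because the
  parametrisation treats it apart: \<open>l\<close> pairs with \<open>0\<close> into the null
  combinations \<open>P 0 + P l\<close> and \<open>P 0 - P l\<close>, and \<open>Suc n\<close> is
  the axis through the poles. As ambient index \<open>l\<close> is taken, sphere coordinate
  \<open>i\<close> of a chart belongs to ambient index \<open>Suc i\<close>.\<close>

definition hyp :: "(nat \<Rightarrow> real) \<Rightarrow> (nat \<Rightarrow> real) \<Rightarrow> real" where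
  "hyp x y = - (x 0 * y 0) + (\<Sum>i=1..<l. x i * y i) + x l * y l"

definition sph :: "(nat \<Rightarrow> real) \<Rightarrow> (nat \<Rightarrow> real) \<Rightarrow> real" where
  "sph x y = (\<Sum>i=l..<n. x (Suc i) * y (Suc i)) + x (Suc n) * y (Suc n)"

lemma mink_eq: "mink (Suc n) x y = hyp x y + sph x y"
proof -
  have "{1..Suc n} = {1..l} \<union> {Suc l..Suc n}"
    by auto
  then have "(\<Sum>k=1..Suc n. x k * y k) = (\<Sum>k=1..l. x k * y k) + (\<Sum>k=Suc l..Suc n. x k * y k)"
    by (simp only:) (rule sum.union_disjoint, auto)
  also have "(\<Sum>k=1..l. x k * y k) = (\<Sum>i=1..<l. x i * y i) + x l * y l"
    using l_pos by (simp add: sum.last_plus)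
  also have "(\<Sum>k=Suc l..Suc n. x k * y k) = (\<Sum>i=l..<n. x (Suc i) * y (Suc i)) + x (Suc n) * y (Suc n)"
    by (subst sum.shift_bounds_cl_Suc_ivl) (simp add: sum.last_plus)
  finally show ?thesis
    by (simp add: mink_def hyp_def sph_def)
qed

definition tube_set :: "(nat \<Rightarrow> real) set" where
  "tube_set = {P \<in> extensional {..<n + 2}. hyp P P = - (a\<^sup>2) \<and> sph P P = b\<^sup>2 \<and> 0 < P 0}"

definition tube_space :: "(nat \<Rightarrow> real) topology" where
  "tube_space = subtopology (Rn (n + 2)) tube_set"

definition hdot :: "(nat \<Rightarrow> real) \<Rightarrow> (nat \<Rightarrow> real) \<Rightarrow> real" where
  "hdot z v = (\<Sum>i=1..<l. z i * v i)"

definition sdot :: "(nat \<Rightarrow> real) \<Rightarrow> (nat \<Rightarrow> real) \<Rightarrow> real" where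
  "sdot z v = (\<Sum>i=l..<n. z i * v i)"

text \<open>Up to the factor \<open>2 * b\<close>, the conformal factor of the sphere in
  stereographic coordinates.\<close>

definition conf :: "(nat \<Rightarrow> real) \<Rightarrow> real" where
  "conf z = inverse (1 + sdot z z)"

text \<open>Horospherical coordinates on the hyperbolic factor (the height \<open>z 0\<close> is the logarithm of
  \<open>(P 0 + P l) / a\<close>) and stereographic coordinates on the spherical factor, from the pole
  \<open>P (n + 1) = - \<sigma> b\<close> with \<open>\<sigma> = 1\<close> or \<open>\<sigma> = -1\<close>.\<close>

definition param :: "real \<Rightarrow> (nat \<Rightarrow> real) \<Rightarrow> nat \<Rightarrow> real" where
  "param \<sigma> z = restrict (\<lambda>k.
     if k = 0 then a * ((exp (z 0) + exp (- z 0) + exp (z 0) * hdot z z) / 2)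
     else if k < l then a * (exp (z 0) * z k)
     else if k = l then a * ((exp (z 0) - exp (- z 0) - exp (z 0) * hdot z z) / 2)
     else if k \<le> n then b * (2 * z (k - 1) * conf z)
     else b * (\<sigma> * (1 - sdot z z) * conf z)) {..<n + 2}"

text \<open>The differential of \<open>param \<sigma>\<close> at \<open>z\<close> along
  \<open>v\<close>. In the last component \<open>(1 - sdot z z) * conf z = 2 * conf z - 1\<close>,
  so only the derivative \<open>- 2 * sdot z v * (conf z)^2\<close> of \<open>conf\<close> remains,
  doubled.\<close>

definition dparam :: "real \<Rightarrow> (nat \<Rightarrow> real) \<Rightarrow> (nat \<Rightarrow> real) \<Rightarrow> nat \<Rightarrow> real" where
  "dparam \<sigma> z v k =
    (if k = 0 then a * ((exp (z 0) * v 0 - exp (- z 0) * v 0 + exp (z 0) * v 0 * hdot z z + 2 * exp (z 0) * hdot z v) / 2)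
     else if k < l then a * (exp (z 0) * v 0 * z k + exp (z 0) * v k)
     else if k = l then a * ((exp (z 0) * v 0 + exp (- z 0) * v 0 - exp (z 0) * v 0 * hdot z z - 2 * exp (z 0) * hdot z v) / 2)
     else if k \<le> n then b * (2 * v (k - 1) * conf z - 4 * z (k - 1) * sdot z v * (conf z)\<^sup>2)
     else b * (\<sigma> * (- 4 * sdot z v * (conf z)\<^sup>2)))"

lemma param_simps:
  "param \<sigma> z 0 = a * ((exp (z 0) + exp (- z 0) + exp (z 0) * hdot z z) / 2)"
  "0 < i \<Longrightarrow> i < l \<Longrightarrow> param \<sigma> z i = a * (exp (z 0) * z i)"
  "param \<sigma> z l = a * ((exp (z 0) - exp (- z 0) - exp (z 0) * hdot z z) / 2)"
  "l \<le> i \<Longrightarrow> i < n \<Longrightarrow> param \<sigma> z (Suc i) = b * (2 * z i * conf z)"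
  "param \<sigma> z (Suc n) = b * (\<sigma> * (1 - sdot z z) * conf z)"
  using l_pos by (auto simp: param_def)

lemma dparam_simps:
  "dparam \<sigma> z v 0 = a * ((exp (z 0) * v 0 - exp (- z 0) * v 0 + exp (z 0) * v 0 * hdot z z + 2 * exp (z 0) * hdot z v) / 2)"
  "0 < i \<Longrightarrow> i < l \<Longrightarrow> dparam \<sigma> z v i = a * (exp (z 0) * v 0 * z i + exp (z 0) * v i)"
  "dparam \<sigma> z v l = a * ((exp (z 0) * v 0 + exp (- z 0) * v 0 - exp (z 0) * v 0 * hdot z z - 2 * exp (z 0) * hdot z v) / 2)"
  "l \<le> i \<Longrightarrow> i < n \<Longrightarrow> dparam \<sigma> z v (Suc i) = b * (2 * v i * conf z - 4 * z i * sdot z v * (conf z)\<^sup>2)"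
  "dparam \<sigma> z v (Suc n) = b * (\<sigma> * (- 4 * sdot z v * (conf z)\<^sup>2))"
  using l_pos by (auto simp: dparam_def)

lemma sdot_nonneg: "0 \<le> sdot z z"
  by (auto simp: sdot_def intro: sum_nonneg)

lemma sdot_pos: "0 < 1 + sdot z z" "1 + sdot z z \<noteq> 0"
  using sdot_nonneg[of z] by linarith+

lemma hdot_nonneg: "0 \<le> hdot z z"
  by (auto simp: hdot_def intro: sum_nonneg)

lemma conf_pos: "0 < conf z"
  using sdot_pos[of z] by (simp add: conf_def)

lemma conf_mult: "conf z * (1 + sdot z z) = 1"
  using sdot_pos[of z] by (simp add: conf_def)

lemma exp_mult_exp_minus: "exp t * exp (- t) = (1 :: real)"
  by (simp add: exp_minus)

text \<open>With \<open>u = z 0\<close> and horospherical coordinates \<open>x\<close>, the null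
  combinations are \<open>P 0 + P l = a e^u\<close> and
  \<open>P 0 - P l = a (e^(- u) + e^u |x|^2)\<close>. Their product is
  \<open>a^2 (1 + e^(2 u) |x|^2)\<close>, and the middle sum cancels its second term.\<close>

lemma hyp_param_param: "hyp (param \<sigma> z) (param \<sigma> z) = - (a\<^sup>2)"
proof -
  have "(\<Sum>i=1..<l. param \<sigma> z i * param \<sigma> z i) = a\<^sup>2 * (exp (z 0))\<^sup>2 * hdot z z"
    unfolding hdot_def sum_distrib_left
    by (intro sum.cong) (auto simp: param_simps power2_eq_square)
  then have "hyp (param \<sigma> z) (param \<sigma> z) = - (a\<^sup>2) * (exp (z 0) * exp (- z 0))"
    unfolding hyp_def param_simps by (simp only:) (simp add: field_simps power2_eq_square del: exp_minus)
  then show ?thesis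
    by (simp only: exp_mult_exp_minus mult_1_right)
qed

lemma hyp_param_dparam: "hyp (param \<sigma> z) (dparam \<sigma> z v) = 0"
proof -
  have "(\<Sum>i=1..<l. param \<sigma> z i * dparam \<sigma> z v i) =
      (\<Sum>i=1..<l. a\<^sup>2 * (exp (z 0))\<^sup>2 * v 0 * (z i * z i) + a\<^sup>2 * (exp (z 0))\<^sup>2 * (z i * v i))"
    by (intro sum.cong) (auto simp: param_simps dparam_simps power2_eq_square algebra_simps)
  also have "\<dots> = a\<^sup>2 * (exp (z 0))\<^sup>2 * v 0 * hdot z z + a\<^sup>2 * (exp (z 0))\<^sup>2 * hdot z v"
    unfolding hdot_def sum.distrib sum_distrib_left[symmetric] ..
  finally show ?thesis
    unfolding hyp_def param_simps dparam_simps
    by (simp only:) (simp add: field_simps power2_eq_square del: exp_minus)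
qed

text \<open>This is the horospherical metric \<open>a^2 (du^2 + e^(2 u) |dx|^2)\<close>; the terms
  with \<open>hdot z v\<close>, \<open>hdot z w\<close> and \<open>hdot z z\<close> cancel between
  the null pair and the middle coordinates. The polarised form, for two vectors, also yields the
  orthogonality of the coordinate vectors.\<close>

lemma hyp_dparam_dparam:
  "hyp (dparam \<sigma> z v) (dparam \<sigma> z w) = a\<^sup>2 * (v 0 * w 0 + (exp (z 0))\<^sup>2 * hdot v w)"
proof -
  have "(\<Sum>i=1..<l. dparam \<sigma> z v i * dparam \<sigma> z w i) =
      (\<Sum>i=1..<l. a\<^sup>2 * (exp (z 0))\<^sup>2 * v 0 * w 0 * (z i * z i) + a\<^sup>2 * (exp (z 0))\<^sup>2 * w 0 * (z i * v i)
        + a\<^sup>2 * (exp (z 0))\<^sup>2 * v 0 * (z i * w i) + a\<^sup>2 * (exp (z 0))\<^sup>2 * (v i * w i))"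
    by (intro sum.cong) (auto simp: dparam_simps power2_eq_square algebra_simps)
  also have "\<dots> = a\<^sup>2 * (exp (z 0))\<^sup>2 * v 0 * w 0 * hdot z z + a\<^sup>2 * (exp (z 0))\<^sup>2 * w 0 * hdot z v
      + a\<^sup>2 * (exp (z 0))\<^sup>2 * v 0 * hdot z w + a\<^sup>2 * (exp (z 0))\<^sup>2 * hdot v w"
    unfolding hdot_def sum.distrib sum_distrib_left[symmetric] ..
  finally have "hyp (dparam \<sigma> z v) (dparam \<sigma> z w) =
      a\<^sup>2 * (v 0 * w 0 * (exp (z 0) * exp (- z 0)) + (exp (z 0))\<^sup>2 * hdot v w)"
    unfolding hyp_def dparam_simps
    by (simp only:) (simp add: field_simps power2_eq_square del: exp_minus)
  then show ?thesis
    by (simp only: exp_mult_exp_minus mult_1_right)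
qed

lemma sph_param_param:
  assumes "\<sigma>\<^sup>2 = 1"
  shows "sph (param \<sigma> z) (param \<sigma> z) = b\<^sup>2"
proof -
  have "(\<Sum>i=l..<n. param \<sigma> z (Suc i) * param \<sigma> z (Suc i)) = (\<Sum>i=l..<n. 4 * b\<^sup>2 * (conf z)\<^sup>2 * (z i * z i))"
    by (intro sum.cong) (auto simp: param_simps power2_eq_square)
  also have "\<dots> = 4 * b\<^sup>2 * (conf z)\<^sup>2 * sdot z z"
    unfolding sdot_def sum_distrib_left[symmetric] ..
  finally have "sph (param \<sigma> z) (param \<sigma> z) =
      4 * b\<^sup>2 * (conf z)\<^sup>2 * sdot z z + \<sigma>\<^sup>2 * (b * (1 - sdot z z) * conf z)\<^sup>2"
    unfolding sph_def param_simps by (simp only:) (simp add: algebra_simps power2_eq_square)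
  also have "\<dots> = (b * (conf z * (1 + sdot z z)))\<^sup>2"
    unfolding assms by (simp add: algebra_simps power2_eq_square)
  finally show ?thesis
    by (simp add: conf_mult)
qed

lemma sph_param_dparam:
  assumes "\<sigma>\<^sup>2 = 1"
  shows "sph (param \<sigma> z) (dparam \<sigma> z v) = 0"
proof -
  have "(\<Sum>i=l..<n. param \<sigma> z (Suc i) * dparam \<sigma> z v (Suc i)) =
      (\<Sum>i=l..<n. 4 * b\<^sup>2 * (conf z)\<^sup>2 * (z i * v i) + (- 8) * b\<^sup>2 * (conf z)^3 * sdot z v * (z i * z i))"
    by (intro sum.cong) (auto simp: param_simps dparam_simps power2_eq_square power3_eq_cube algebra_simps)
  also have "\<dots> = 4 * b\<^sup>2 * (conf z)\<^sup>2 * sdot z v + (- 8) * b\<^sup>2 * (conf z)^3 * sdot z v * sdot z z"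
    unfolding sum.distrib sum_distrib_left[symmetric] by (simp only: sdot_def)
  finally have "sph (param \<sigma> z) (dparam \<sigma> z v) =
      4 * b\<^sup>2 * (conf z)\<^sup>2 * sdot z v + (- 8) * b\<^sup>2 * (conf z)^3 * sdot z v * sdot z z
      - \<sigma>\<^sup>2 * (4 * b\<^sup>2 * (1 - sdot z z) * (conf z)^3 * sdot z v)"
    unfolding sph_def param_simps dparam_simps
    by (simp only:) (simp add: algebra_simps power2_eq_square power3_eq_cube)
  also have "\<dots> = 4 * b\<^sup>2 * (conf z)\<^sup>2 * sdot z v * (1 - conf z * (1 + sdot z z))"
    unfolding assms by (simp add: algebra_simps power2_eq_square power3_eq_cube)
  finally show ?thesis
    by (simp add: conf_mult)
qed

text \<open>The round metric in stereographic coordinates. All further terms carry the factor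
  \<open>1 - conf z * (1 + sdot z z) = 0\<close>, and the sign \<open>\<sigma>\<close> occurs only
  squared, so both poles are covered.\<close>

lemma sph_dparam_dparam:
  assumes "\<sigma>\<^sup>2 = 1"
  shows "sph (dparam \<sigma> z v) (dparam \<sigma> z w) = 4 * b\<^sup>2 * (conf z)\<^sup>2 * sdot v w"
proof -
  have "(\<Sum>i=l..<n. dparam \<sigma> z v (Suc i) * dparam \<sigma> z w (Suc i)) =
      (\<Sum>i=l..<n. 4 * b\<^sup>2 * (conf z)\<^sup>2 * (v i * w i) + (- 8) * b\<^sup>2 * (conf z)^3 * sdot z v * (z i * w i)
        + (- 8) * b\<^sup>2 * (conf z)^3 * sdot z w * (z i * v i)
        + 16 * b\<^sup>2 * (conf z)^4 * sdot z v * sdot z w * (z i * z i))"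
    by (intro sum.cong)
      (auto simp: dparam_simps power2_eq_square power3_eq_cube power4_eq_xxxx algebra_simps)
  also have "\<dots> = 4 * b\<^sup>2 * (conf z)\<^sup>2 * sdot v w + (- 8) * b\<^sup>2 * (conf z)^3 * sdot z v * sdot z w
      + (- 8) * b\<^sup>2 * (conf z)^3 * sdot z w * sdot z v
      + 16 * b\<^sup>2 * (conf z)^4 * sdot z v * sdot z w * sdot z z"
    unfolding sum.distrib sum_distrib_left[symmetric] by (simp only: sdot_def)
  finally have "sph (dparam \<sigma> z v) (dparam \<sigma> z w) = 4 * b\<^sup>2 * (conf z)\<^sup>2 * sdot v w
      - 16 * b\<^sup>2 * (conf z)^3 * sdot z v * sdot z w + 16 * b\<^sup>2 * (conf z)^4 * sdot z v * sdot z w * sdot z z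
      + \<sigma>\<^sup>2 * (16 * b\<^sup>2 * (conf z)^4 * sdot z v * sdot z w)"
    unfolding sph_def dparam_simps
    by (simp only:) (simp add: algebra_simps power2_eq_square power3_eq_cube power4_eq_xxxx)
  also have "\<dots> = 4 * b\<^sup>2 * (conf z)\<^sup>2 * sdot v w
      - 16 * b\<^sup>2 * (conf z)^3 * sdot z v * sdot z w * (1 - conf z * (1 + sdot z z))"
    unfolding assms by (simp add: algebra_simps power2_eq_square power3_eq_cube power4_eq_xxxx)
  finally show ?thesis
    by (simp add: conf_mult)
qed

lemma param_in_tube_set:
  assumes "\<sigma>\<^sup>2 = 1"
  shows "param \<sigma> z \<in> tube_set"
proof -
  have "0 < param \<sigma> z 0"
    using a_pos hdot_nonneg[of z] by (auto simp: param_simps intro!: mult_pos_pos add_pos_nonneg)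
  moreover have "param \<sigma> z \<in> extensional {..<n + 2}"
    by (simp add: param_def)
  ultimately show ?thesis
    using assms by (simp add: tube_set_def hyp_param_param sph_param_param)
qed

text \<open>Stated along an arbitrary curve of coordinates, so that it serves both the coordinate
  lines of partial derivatives and the curves that define the Riemannian distance.\<close>

lemma param_has_real_derivative:
  assumes "\<And>i. i < n \<Longrightarrow> ((\<lambda>s. z s i) has_real_derivative v i) (at t)" and k: "k < n + 2"
  shows "((\<lambda>s. param \<sigma> (z s) k) has_real_derivative dparam \<sigma> (z t) v k) (at t)"
proof -
  have h: "((\<lambda>s. hdot (z s) (z s)) has_real_derivative 2 * hdot (z t) v) (at t)"
    unfolding hdot_def sum_distrib_left
    by (rule derivative_eq_intros assms refl | simp add: mult.commute)+
  have s: "((\<lambda>s. sdot (z s) (z s)) has_real_derivative 2 * sdot (z t) v) (at t)"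
    unfolding sdot_def sum_distrib_left
    by (rule derivative_eq_intros assms refl | simp add: mult.commute)+
  have q: "((\<lambda>s. conf (z s)) has_real_derivative - 2 * sdot (z t) v * (conf (z t))\<^sup>2) (at t)"
    unfolding conf_def using sdot_pos(2)[of "z t"]
    by (auto intro!: derivative_eq_intros s simp: power2_eq_square)
  have 0: "((\<lambda>s. z s 0) has_real_derivative v 0) (at t)"
    using l_pos by (intro assms) auto
  consider "k = 0" | "0 < k" "k < l" | "k = l" | "l < k" "k \<le> n" | "k = Suc n"
    using k by linarith
  then show ?thesis
  proof cases
    case 1
    show ?thesis
      unfolding 1 param_simps dparam_simps
      by (auto intro!: derivative_eq_intros h 0 simp: field_simps)
  next
    case 2
    show ?thesis
      unfolding param_simps(2)[OF 2] dparam_simps(2)[OF 2]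
      using 2 by (auto intro!: derivative_eq_intros 0 assms simp: algebra_simps)
  next
    case 3
    show ?thesis
      unfolding 3 param_simps dparam_simps
      by (auto intro!: derivative_eq_intros h 0 simp: field_simps)
  next
    case 4
    then obtain i where i: "k = Suc i" "l \<le> i" "i < n"
      by (cases k) auto
    show ?thesis
      unfolding i(1) param_simps(4)[OF i(2,3)] dparam_simps(4)[OF i(2,3)]
      using i by (auto intro!: derivative_eq_intros q assms simp: algebra_simps power2_eq_square)
  next
    case 5
    \<comment> \<open>Multiplying by \<open>conf * (1 + sdot z z) = 1\<close> makes both summands of
      the product rule multiples of \<open>conf^2\<close>; they then add up to the single term in
      \<open>dparam\<close>.\<close>
    have "conf (z t) = conf (z t) * (conf (z t) * (1 + sdot (z t) (z t)))"
      by (simp only: conf_mult mult_1_right)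
    then have c: "conf (z t) = (conf (z t))\<^sup>2 * (1 + sdot (z t) (z t))"
      by (simp only: power2_eq_square mult.assoc)
    have "\<sigma> * (- 2 * sdot (z t) v) * conf (z t) + \<sigma> * (1 - sdot (z t) (z t)) * (- 2 * sdot (z t) v * (conf (z t))\<^sup>2)
        = \<sigma> * (- 4 * sdot (z t) v * (conf (z t))\<^sup>2)"
      by (subst c) (simp add: algebra_simps)
    moreover have "((\<lambda>s. b * (\<sigma> * (1 - sdot (z s) (z s)) * conf (z s))) has_real_derivative
        b * (\<sigma> * (- 2 * sdot (z t) v) * conf (z t) + \<sigma> * (1 - sdot (z t) (z t)) * (- 2 * sdot (z t) v * (conf (z t))\<^sup>2))) (at t)"
      by (auto intro!: derivative_eq_intros s q)
    ultimately show ?thesis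
      unfolding 5 param_simps dparam_simps by simp
  qed
qed

end

lemma continuous_map_real_ln:
  "continuous_map X euclideanreal f \<Longrightarrow> (\<And>x. x \<in> topspace X \<Longrightarrow> f x \<noteq> 0) \<Longrightarrow>
    continuous_map X euclideanreal (\<lambda>x. ln (f x))"
  by (simp add: continuous_map_atin tendsto_ln)

lemma mink_sum_left: "mink d (\<lambda>k. \<Sum>i\<in>I. v i * V i k) y = (\<Sum>i\<in>I. v i * mink d (V i) y)"
proof -
  have "(\<Sum>k=1..d. (\<Sum>i\<in>I. v i * V i k) * y k) = (\<Sum>i\<in>I. v i * (\<Sum>k=1..d. V i k * y k))"
    unfolding sum_distrib_right sum_distrib_left by (subst sum.swap) (simp add: mult.assoc)
  moreover have "- ((\<Sum>i\<in>I. v i * V i 0) * y 0) = (\<Sum>i\<in>I. v i * (- (V i 0 * y 0)))"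
    by (simp add: sum_distrib_right mult.assoc sum_negf)
  ultimately show ?thesis
    unfolding mink_def distrib_left sum.distrib by simp
qed

lemma mink_cong: "(\<And>k. k \<le> d \<Longrightarrow> x k = x' k) \<Longrightarrow> (\<And>k. k \<le> d \<Longrightarrow> y k = y' k) \<Longrightarrow> mink d x y = mink d x' y'"
  by (simp add: mink_def)

context tube
begin

section \<open>Charts of the tube\<close>

definition tube_dom :: "real \<Rightarrow> (nat \<Rightarrow> real) set" where
  "tube_dom \<sigma> = {P \<in> tube_set. 0 < b + \<sigma> * P (Suc n)}"

definition coord :: "real \<Rightarrow> (nat \<Rightarrow> real) \<Rightarrow> nat \<Rightarrow> real" where
  "coord \<sigma> P = restrict (\<lambda>i.
     if i = 0 then ln ((P 0 + P l) / a)
     else if i < l then P i / (P 0 + P l)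
     else P (Suc i) / (b + \<sigma> * P (Suc n))) {..<n}"

definition tube_chart :: "real \<Rightarrow> (nat \<Rightarrow> real) chart" where
  "tube_chart \<sigma> = (tube_dom \<sigma>, coord \<sigma>)"

definition atlas :: "(nat \<Rightarrow> real) chart set" where
  "atlas = {tube_chart 1, tube_chart (- 1)}"

lemma fst_tube_chart [simp]: "fst (tube_chart \<sigma>) = tube_dom \<sigma>"
  and snd_tube_chart [simp]: "snd (tube_chart \<sigma>) = coord \<sigma>"
  by (simp_all add: tube_chart_def)

lemma n_pos: "0 < n"
  using l_pos by simp

lemma topspace_tube_space: "topspace tube_space = tube_set"
  by (auto simp: tube_space_def topspace_Rn tube_set_def)

lemma tube_dom_subset: "tube_dom \<sigma> \<subseteq> tube_set"
  by (auto simp: tube_dom_def)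

lemma tube_setD:
  assumes "P \<in> tube_set"
  shows "P \<in> extensional {..<n + 2}" "hyp P P = - (a\<^sup>2)" "sph P P = b\<^sup>2" "0 < P 0"
  using assms by (auto simp: tube_set_def)

text \<open>Dropping the nonnegative middle squares in \<open>hyp P P = - (a^2)\<close> leaves
  \<open>(P l)^2 < (P 0)^2\<close>. The logarithm and the quotients in \<open>coord\<close> depend
  on this.\<close>

lemma height_pos:
  assumes "P \<in> tube_set"
  shows "0 < P 0 + P l"
proof -
  have "0 \<le> (\<Sum>i=1..<l. P i * P i)"
    by (intro sum_nonneg) auto
  then have "(P l)\<^sup>2 < (P 0)\<^sup>2"
    using tube_setD(2)[OF assms] a_pos by (simp add: hyp_def power2_eq_square add_pos_pos)
      (smt (verit) mult_pos_pos)
  then have "\<bar>P l\<bar> < P 0"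
    using tube_setD(4)[OF assms] power2_less_imp_less[of "\<bar>P l\<bar>" "P 0"] by simp
  then show ?thesis
    by linarith
qed

lemma last_eq: "\<sigma>\<^sup>2 = 1 \<Longrightarrow> b + \<sigma> * param \<sigma> z (Suc n) = 2 * b * conf z"
proof -
  assume "\<sigma>\<^sup>2 = 1"
  have "b + \<sigma> * param \<sigma> z (Suc n) = b * (conf z * (1 + sdot z z)) + \<sigma>\<^sup>2 * (b * (1 - sdot z z) * conf z)"
    by (simp add: param_simps conf_mult power2_eq_square)
  then show ?thesis
    unfolding \<open>\<sigma>\<^sup>2 = 1\<close> by (simp add: algebra_simps)
qed

text \<open>This is the stereographic denominator of the chart with the opposite sign; it vanishes
  exactly over the pole omitted there, where \<open>sdot z z = 0\<close>.\<close>

lemma last_eq': "\<sigma>\<^sup>2 = 1 \<Longrightarrow> b - \<sigma> * param \<sigma> z (Suc n) = 2 * b * conf z * sdot z z"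
proof -
  assume "\<sigma>\<^sup>2 = 1"
  have "b - \<sigma> * param \<sigma> z (Suc n) = b * (conf z * (1 + sdot z z)) - \<sigma>\<^sup>2 * (b * (1 - sdot z z) * conf z)"
    by (simp add: param_simps conf_mult power2_eq_square)
  then show ?thesis
    unfolding \<open>\<sigma>\<^sup>2 = 1\<close> by (simp add: algebra_simps)
qed

lemma param_in_tube_dom: "\<sigma>\<^sup>2 = 1 \<Longrightarrow> param \<sigma> z \<in> tube_dom \<sigma>"
  using b_pos conf_pos[of z] by (simp add: tube_dom_def param_in_tube_set last_eq)

lemma param_height: "param \<sigma> z 0 + param \<sigma> z l = a * exp (z 0)"
  by (simp add: param_simps field_simps)

lemma param_extensional: "param \<sigma> z \<in> extensional {..<n + 2}"
  by (simp add: param_def)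

lemma coord_extensional: "coord \<sigma> P \<in> extensional {..<n}"
  by (simp add: coord_def)

lemma coord_simps:
  "coord \<sigma> P 0 = ln ((P 0 + P l) / a)"
  "0 < i \<Longrightarrow> i < l \<Longrightarrow> coord \<sigma> P i = P i / (P 0 + P l)"
  "l \<le> i \<Longrightarrow> i < n \<Longrightarrow> coord \<sigma> P i = P (Suc i) / (b + \<sigma> * P (Suc n))"
  using l_pos by (auto simp: coord_def)

lemma coord_param_hyp:
  assumes "i < l"
  shows "coord \<tau> (param \<sigma> z) i = z i"
proof (cases "i = 0")
  case True
  have "coord \<tau> (param \<sigma> z) 0 = z 0"
    unfolding coord_simps param_height using a_pos by simp
  with True show ?thesis
    by simp
next
  case False
  then have "coord \<tau> (param \<sigma> z) i = param \<sigma> z i / (a * exp (z 0))"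
    using coord_simps(2)[of i \<tau> "param \<sigma> z"] assms by (simp add: param_height)
  with False assms a_pos show ?thesis
    by (simp add: param_simps)
qed

text \<open>The two stereographic projections differ by the inversion \<open>z / |z|^2\<close>. The
  second equation also holds at \<open>sdot z z = 0\<close>, where both sides are divisions by
  zero.\<close>

lemma coord_param_sph:
  assumes "l \<le> i" "i < n" "\<sigma>\<^sup>2 = 1"
  shows "coord \<sigma> (param \<sigma> z) i = z i"
    and "coord (- \<sigma>) (param \<sigma> z) i = z i / sdot z z"
  using assms b_pos conf_pos[of z] by (simp_all add: coord_simps last_eq last_eq' param_simps(4))

lemma coord_param:
  assumes "z \<in> extensional {..<n}" "\<sigma>\<^sup>2 = 1"
  shows "coord \<sigma> (param \<sigma> z) = z"
proof (rule extensionalityI[OF coord_extensional assms(1)])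
  fix i assume "i \<in> {..<n}"
  then show "coord \<sigma> (param \<sigma> z) i = z i"
    using coord_param_hyp[of i \<sigma> \<sigma> z] coord_param_sph(1)[of i \<sigma> z] assms(2) by (cases "i < l") auto
qed

text \<open>In the combinations \<open>h\<close>, \<open>w\<close> and \<open>s\<close>,
  \<open>t\<close> the two equations of the tube read \<open>h w = a^2 + sum of (P i)^2\<close> and
  \<open>s t = sum of (P (Suc i))^2\<close>. Dividing by \<open>h^2\<close> and \<open>s^2\<close>
  expresses \<open>hdot\<close> and \<open>sdot\<close> of the coordinates through \<open>h\<close>,
  \<open>w\<close>, \<open>s\<close>, \<open>t\<close> alone, after which each component is a
  rational identity.\<close>

lemma param_coord:
  assumes P: "P \<in> tube_dom \<sigma>" and \<sigma>: "\<sigma>\<^sup>2 = 1"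
  shows "param \<sigma> (coord \<sigma> P) = P"
proof -
  let ?z = "coord \<sigma> P"
  define h w s t where "h = P 0 + P l" and "w = P 0 - P l"
    and "s = b + \<sigma> * P (Suc n)" and "t = b - \<sigma> * P (Suc n)"
  note defs = h_def w_def s_def t_def
  have PT: "P \<in> tube_set"
    using P by (simp add: tube_dom_def)
  have h: "0 < h" and s: "0 < s"
    using P height_pos[OF PT] by (auto simp: tube_dom_def defs)
  have E: "exp (?z 0) = h / a" "exp (- ?z 0) = a / h"
    using h a_pos by (simp_all add: coord_simps exp_minus flip: h_def)
  have "hdot ?z ?z * h\<^sup>2 = (\<Sum>i=1..<l. P i * P i)"
    unfolding hdot_def sum_distrib_right
    using h by (intro sum.cong refl) (simp add: coord_simps power2_eq_square flip: h_def)
  also have "\<dots> = h * w - a\<^sup>2"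
    using tube_setD(2)[OF PT] by (simp add: hyp_def defs algebra_simps)
  finally have hd: "hdot ?z ?z = w / h - a\<^sup>2 / h\<^sup>2"
    using h by (simp add: field_simps power2_eq_square)
  have "sdot ?z ?z * s\<^sup>2 = (\<Sum>i=l..<n. P (Suc i) * P (Suc i))"
    unfolding sdot_def sum_distrib_right
    using s by (intro sum.cong refl) (simp add: coord_simps power2_eq_square flip: s_def)
  also have "\<dots> = b\<^sup>2 - \<sigma>\<^sup>2 * (P (Suc n) * P (Suc n))"
    unfolding \<sigma> using tube_setD(3)[OF PT] by (simp add: sph_def)
  also have "\<dots> = t * s"
    by (simp add: defs algebra_simps power2_eq_square)
  finally have sd: "sdot ?z ?z = t / s"
    using s by (simp add: field_simps power2_eq_square)
  have "s + t = 2 * b"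
    by (simp add: defs)
  then have cf: "conf ?z = s / (2 * b)"
    using s b_pos by (simp add: conf_def sd field_simps)
  show ?thesis
  proof (rule extensionalityI)
    show "param \<sigma> ?z \<in> extensional {..<n + 2}"
      by (simp add: param_def)
    show "P \<in> extensional {..<n + 2}"
      using tube_setD(1)[OF PT] .
    fix k assume "k \<in> {..<n + 2}"
    then consider "k = 0" | "0 < k" "k < l" | "k = l" | "l < k" "k \<le> n" | "k = Suc n"
      by fastforce
    then show "param \<sigma> ?z k = P k"
    proof cases
      case 1
      have "a * ((h / a + a / h + h / a * (w / h - a\<^sup>2 / h\<^sup>2)) / 2) = (h + w) / 2"
        using h a_pos by (simp add: field_simps power2_eq_square)
      then show ?thesis
        unfolding 1 param_simps E hd by (simp add: defs)
    next
      case 2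
      then show ?thesis
        using h a_pos by (simp add: param_simps E coord_simps flip: h_def)
    next
      case 3
      have "a * ((h / a - a / h - h / a * (w / h - a\<^sup>2 / h\<^sup>2)) / 2) = (h - w) / 2"
        using h a_pos by (simp add: field_simps power2_eq_square)
      then show ?thesis
        unfolding 3 param_simps E hd by (simp add: defs)
    next
      case 4
      then obtain i where i: "k = Suc i" "l \<le> i" "i < n"
        by (cases k) auto
      then show ?thesis
        using s b_pos by (simp add: param_simps cf coord_simps flip: s_def)
    next
      case 5
      have "b * (\<sigma> * (1 - t / s) * (s / (2 * b))) = \<sigma> * ((s - t) / 2)"
        using s b_pos by (simp add: field_simps)
      also have "\<dots> = \<sigma>\<^sup>2 * P (Suc n)"
        by (simp add: defs power2_eq_square)
      finally show ?thesis
        unfolding 5 param_simps cf sd by (simp add: \<sigma>)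
    qed
  qed
qed

lemma inj_on_coord: "\<sigma>\<^sup>2 = 1 \<Longrightarrow> inj_on (coord \<sigma>) (tube_dom \<sigma>)"
  by (metis inj_onI param_coord)

lemma chart_inv_tube_chart:
  assumes "z \<in> extensional {..<n}" "\<sigma>\<^sup>2 = 1"
  shows "chart_inv (tube_chart \<sigma>) z = param \<sigma> z"
  unfolding chart_inv_def using assms
  by (auto intro!: inv_into_f_eq inj_on_coord param_in_tube_dom coord_param)

lemma coord_image: "\<sigma>\<^sup>2 = 1 \<Longrightarrow> coord \<sigma> ` tube_dom \<sigma> = extensional {..<n}"
  using coord_param[of _ \<sigma>] param_in_tube_dom[of \<sigma>] coord_extensional[of \<sigma>]
  by (auto simp: image_iff) (metis)

lemma continuous_map_tube_component:
  "k < n + 2 \<Longrightarrow> continuous_map (subtopology tube_space U) euclideanreal (\<lambda>P. P k)"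
  unfolding tube_space_def subtopology_subtopology by (rule continuous_map_Rn_component)

lemma openin_extensional: "openin (Rn n) (extensional {..<n})"
  by (metis openin_topspace topspace_Rn)

lemma smooth_on_hdot: "openin (Rn n) U \<Longrightarrow> smooth_on n U (\<lambda>z. hdot z z)"
  and smooth_on_sdot: "openin (Rn n) U \<Longrightarrow> smooth_on n U (\<lambda>z. sdot z z)"
  unfolding hdot_def sdot_def by (auto intro!: smooth_on_intros)

lemma smooth_on_param:
  assumes U: "openin (Rn n) U" and k: "k < n + 2"
  shows "smooth_on n U (\<lambda>z. param \<sigma> z k)"
proof -
  have conf: "smooth_on n U conf"
    using smooth_on_divide[OF U smooth_on_const smooth_on_add[OF U smooth_on_const smooth_on_sdot[OF U]], of 1 1]
      sdot_pos(2) by (simp add: conf_def[abs_def] inverse_eq_divide)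
  have 0: "smooth_on n U (\<lambda>z. z 0)"
    using n_pos by (rule smooth_on_coord)
  have half: "smooth_on n U (\<lambda>z. f z / 2)" if "smooth_on n U f" for f
    using smooth_on_divide[OF U that smooth_on_const[of n U 2]] by simp
  consider "k = 0" | "0 < k" "k < l" | "k = l" | "l < k" "k \<le> n" | "k = Suc n"
    using k by linarith
  then show ?thesis
  proof cases
    case 1
    show ?thesis
      unfolding 1 param_simps by (intro smooth_on_mult smooth_on_const half smooth_on_add smooth_on_exp
          smooth_on_minus smooth_on_hdot 0 U)
  next
    case 2
    then show ?thesis
      unfolding param_simps(2)[OF 2] by (intro smooth_on_mult smooth_on_const smooth_on_exp smooth_on_coord 0 U) auto
  next
    case 3
    show ?thesis
      unfolding 3 param_simps by (intro smooth_on_mult smooth_on_const half smooth_on_diff smooth_on_exp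
          smooth_on_minus smooth_on_hdot 0 U)
  next
    case 4
    then obtain i where i: "k = Suc i" "l \<le> i" "i < n"
      by (cases k) auto
    show ?thesis
      unfolding i(1) param_simps(4)[OF i(2,3)]
      by (intro smooth_on_mult smooth_on_const smooth_on_coord conf U i)
  next
    case 5
    show ?thesis
      unfolding 5 param_simps
      by (intro smooth_on_mult smooth_on_diff smooth_on_const smooth_on_sdot conf U)
  qed
qed

lemma continuous_map_param: "\<sigma>\<^sup>2 = 1 \<Longrightarrow> continuous_map (Rn n) tube_space (param \<sigma>)"
  using smooth_onD(1)[OF smooth_on_param[OF openin_extensional]]
  unfolding tube_space_def continuous_map_in_subtopology continuous_map_Rn_iff
  by (auto simp: param_in_tube_set param_extensional[simplified] subtopology_superset topspace_Rn)

lemma continuous_map_coord: "continuous_map (subtopology tube_space (tube_dom \<sigma>)) (Rn n) (coord \<sigma>)"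
  unfolding continuous_map_Rn_iff
proof (intro conjI ballI allI impI coord_extensional)
  let ?X = "subtopology tube_space (tube_dom \<sigma>)"
  fix i assume "i < n"
  have h: "P 0 + P l \<noteq> 0" and s: "b + \<sigma> * P (Suc n) \<noteq> 0" if "P \<in> topspace ?X" for P
    using that height_pos[of P] by (auto simp: tube_dom_def)
  have c: "continuous_map ?X euclideanreal (\<lambda>P. P k)" if "k < n + 2" for k
    using that by (rule continuous_map_tube_component)
  consider "i = 0" | "0 < i" "i < l" | "l \<le> i"
    by linarith
  then show "continuous_map ?X euclideanreal (\<lambda>P. coord \<sigma> P i)"
  proof cases
    case 1
    show ?thesis
      unfolding 1 coord_simps using h a_pos
      by (intro continuous_map_real_ln continuous_map_real_divide continuous_map_add c continuous_map_const[THEN iffD2]) auto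
  next
    case 2
    show ?thesis
      unfolding coord_simps(2)[OF 2] using h 2
      by (intro continuous_map_real_divide continuous_map_add c) auto
  next
    case 3
    show ?thesis
      unfolding coord_simps(3)[OF 3 \<open>i < n\<close>] using s \<open>i < n\<close>
      by (intro continuous_map_real_divide continuous_map_add continuous_map_real_mult c continuous_map_const[THEN iffD2]) auto
  qed
qed

lemma openin_tube_dom: "openin tube_space (tube_dom \<sigma>)"
proof -
  have "continuous_map tube_space euclideanreal (\<lambda>P. b + \<sigma> * P (Suc n))"
    using continuous_map_tube_component[of "Suc n" UNIV]
    by (intro continuous_map_add continuous_map_real_mult continuous_map_const[THEN iffD2]) auto
  from openin_continuous_map_preimage[OF this, of "{0<..}"] show ?thesis
    by (simp add: tube_dom_def topspace_tube_space)
qed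

text \<open>The points of chart \<open>\<sigma>\<close> outside the opposite chart lie over a pole,
  which is the origin of the sphere coordinates.\<close>

lemma transition_image:
  assumes "\<sigma>\<^sup>2 = 1"
  shows "coord \<sigma> ` (tube_dom \<sigma> \<inter> tube_dom (- \<sigma>)) = {z \<in> extensional {..<n}. 0 < sdot z z}"
proof -
  have "coord \<sigma> P \<in> {z \<in> extensional {..<n}. 0 < sdot z z}" if "P \<in> tube_dom \<sigma> \<inter> tube_dom (- \<sigma>)" for P
  proof -
    define z where "z = coord \<sigma> P"
    have P: "P = param \<sigma> z"
      using param_coord[OF _ assms, of P] that by (simp add: z_def)
    then have "0 < 2 * b * conf z * sdot z z"
      using that by (simp add: tube_dom_def flip: last_eq'[OF assms])
    then show ?thesis
      using b_pos conf_pos[of z] sdot_nonneg[of z] coord_extensional[of \<sigma> P]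
      by (auto simp: zero_less_mult_iff simp flip: z_def)
  qed
  moreover have "z \<in> coord \<sigma> ` (tube_dom \<sigma> \<inter> tube_dom (- \<sigma>))" if "z \<in> extensional {..<n}" "0 < sdot z z" for z
  proof (rule image_eqI)
    show "z = coord \<sigma> (param \<sigma> z)"
      using that assms by (simp add: coord_param)
    have "0 < b - \<sigma> * param \<sigma> z (Suc n)"
      unfolding last_eq'[OF assms] using that b_pos conf_pos[of z] by simp
    then show "param \<sigma> z \<in> tube_dom \<sigma> \<inter> tube_dom (- \<sigma>)"
      using assms by (simp add: param_in_tube_dom) (simp add: tube_dom_def param_in_tube_set)
  qed
  ultimately show ?thesis
    by blast
qed

lemma openin_transition_image: "openin (Rn n) {z \<in> extensional {..<n}. 0 < sdot z z}"
proof -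
  have "continuous_map (Rn n) euclideanreal (\<lambda>z. sdot z z)"
    using smooth_onD(1)[OF smooth_on_sdot[OF openin_extensional]]
    by (simp add: subtopology_superset topspace_Rn)
  from openin_continuous_map_preimage[OF this, of "{0<..}"] show ?thesis
    by (simp add: topspace_Rn)
qed

lemma atlas_cases:
  assumes "c \<in> atlas"
  obtains \<sigma> where "c = tube_chart \<sigma>" "\<sigma> = 1 \<or> \<sigma> = - 1" "\<sigma>\<^sup>2 = 1"
  using assms by (auto simp: atlas_def)

lemma smooth_atlas_tube: "smooth_atlas n tube_space atlas"
  unfolding smooth_atlas_def
proof (intro conjI ballI allI impI)
  fix c assume "c \<in> atlas"
  then obtain \<sigma> where c: "c = tube_chart \<sigma>" and \<sigma>: "\<sigma> = 1 \<or> \<sigma> = - 1" "\<sigma>\<^sup>2 = 1"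
    by (rule atlas_cases)
  show "openin tube_space (fst c)"
    by (simp add: c openin_tube_dom)
  show "openin (Rn n) (snd c ` fst c)"
    by (simp add: c coord_image \<sigma> openin_extensional)
  have "homeomorphic_maps (subtopology tube_space (tube_dom \<sigma>)) (Rn n) (coord \<sigma>) (param \<sigma>)"
    unfolding homeomorphic_maps_def
  proof (intro conjI ballI)
    show "continuous_map (Rn n) (subtopology tube_space (tube_dom \<sigma>)) (param \<sigma>)"
      using \<sigma>(2) by (simp add: continuous_map_in_subtopology continuous_map_param param_in_tube_dom)
    show "param \<sigma> (coord \<sigma> P) = P" if "P \<in> topspace (subtopology tube_space (tube_dom \<sigma>))" for P
      using that \<sigma>(2) by (simp add: param_coord)
    show "coord \<sigma> (param \<sigma> z) = z" if "z \<in> topspace (Rn n)" for z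
      using that \<sigma>(2) by (simp add: coord_param topspace_Rn)
  qed (rule continuous_map_coord)
  from homeomorphic_maps_imp_map[OF this]
  show "homeomorphic_map (subtopology tube_space (fst c)) (subtopology (Rn n) (snd c ` fst c)) (snd c)"
    using \<sigma>(2) by (simp add: c coord_image subtopology_superset topspace_Rn)
  fix c' i assume c'_atlas: "c' \<in> atlas" and i: "i < n"
  from c'_atlas obtain \<tau> where c': "c' = tube_chart \<tau>" and "\<tau> = 1 \<or> \<tau> = - 1" "\<tau>\<^sup>2 = 1"
    by (rule atlas_cases)
  then have "\<tau> = \<sigma> \<or> \<tau> = - \<sigma>"
    using \<sigma> by auto
  then show "smooth_on n (snd c ` (fst c \<inter> fst c')) (\<lambda>x. snd c' (chart_inv c x) i)"
  proof
    assume \<tau>: "\<tau> = \<sigma>"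
    have "smooth_on n (extensional {..<n}) (\<lambda>x. coord \<sigma> (chart_inv (tube_chart \<sigma>) x) i) \<longleftrightarrow>
        smooth_on n (extensional {..<n}) (\<lambda>x. x i)"
      using \<sigma> by (intro smooth_on_cong openin_extensional) (simp add: chart_inv_tube_chart coord_param)
    then show ?thesis
      using i by (simp add: c c' \<tau> coord_image \<sigma> smooth_on_coord)
  next
    \<comment> \<open>The transition map is the identity on the hyperbolic coordinates and the
      inversion on the sphere coordinates, smooth where \<open>sdot z z > 0\<close>.\<close>
    assume \<tau>: "\<tau> = - \<sigma>"
    let ?V = "{z \<in> extensional {..<n}. 0 < sdot z z}"
    have "smooth_on n ?V (\<lambda>z. if i < l then z i else z i / sdot z z)"
      using i by (cases "i < l") (auto intro!: smooth_on_coord smooth_on_divide smooth_on_sdot openin_transition_image)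
    also have "smooth_on n ?V (\<lambda>z. if i < l then z i else z i / sdot z z) \<longleftrightarrow>
        smooth_on n ?V (\<lambda>x. coord (- \<sigma>) (chart_inv (tube_chart \<sigma>) x) i)"
      using i \<sigma> by (intro smooth_on_cong openin_transition_image)
        (simp add: chart_inv_tube_chart coord_param_hyp coord_param_sph)
    finally show ?thesis
      by (simp add: c c' \<tau> transition_image \<sigma>)
  qed
next
  have "tube_dom 1 \<union> tube_dom (- 1) = tube_set"
    using b_pos by (auto simp: tube_dom_def)
  then show "(\<Union>c\<in>atlas. fst c) = topspace tube_space"
    by (simp add: atlas_def topspace_tube_space)
qed

text \<open>Each chart domain is a continuous image of n-space, hence connected, and the two domains
  meet. For \<open>K = 1\<close> the overlap itself is disconnected, but one common point is
  enough.\<close>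

lemma connected_tube_space: "connected_space tube_space"
proof -
  have dom: "connectedin tube_space (tube_dom \<sigma>)" if "\<sigma>\<^sup>2 = 1" for \<sigma>
  proof -
    have "connectedin tube_space (param \<sigma> ` topspace (Rn n))"
      using continuous_map_param[OF that] connected_space_Rn
      by (intro connectedin_continuous_map_image) (auto simp: connectedin_topspace)
    also have "param \<sigma> ` topspace (Rn n) = tube_dom \<sigma>"
      using that param_in_tube_dom[of \<sigma>] param_coord[of _ \<sigma>] coord_extensional
      by (auto simp: topspace_Rn image_iff) (metis)
    finally show ?thesis .
  qed
  \<comment> \<open>With all coordinates 1, \<open>sdot z z = K > 0\<close>, which is the condition
    for the overlap.\<close>
  define z :: "nat \<Rightarrow> real" where "z = restrict (\<lambda>_. 1) {..<n}"
  have "sdot z z = (\<Sum>i=l..<n. 1)"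
    unfolding sdot_def z_def by (intro sum.cong) auto
  then have "z \<in> coord 1 ` (tube_dom 1 \<inter> tube_dom (- 1))"
    using K_pos by (subst transition_image) (auto simp: z_def)
  then have "tube_dom 1 \<inter> tube_dom (- 1) \<noteq> {}"
    by blast
  then have "connectedin tube_space (tube_dom 1 \<union> tube_dom (- 1))"
    using dom by (intro connectedin_Un) auto
  also have "tube_dom 1 \<union> tube_dom (- 1) = topspace tube_space"
    using b_pos by (auto simp: tube_dom_def topspace_tube_space)
  finally show ?thesis
    by (simp add: connectedin_topspace)
qed

lemma smooth_manifold_tube: "smooth_manifold n tube_space atlas"
  unfolding smooth_manifold_def
proof (intro conjI)
  show "Hausdorff_space tube_space"
    unfolding tube_space_def by (rule Hausdorff_space_subtopology[OF Hausdorff_space_Rn])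
  show "second_countable tube_space"
    unfolding tube_space_def by (rule second_countable_subtopology[OF second_countable_Rn])
  show "topspace tube_space \<noteq> {}"
    using param_in_tube_set[of 1 "\<lambda>_. 0"] by (auto simp: topspace_tube_space)
qed (fact connected_tube_space smooth_atlas_tube)+


section \<open>Metric and curvature of the tube\<close>

definition unit :: "nat \<Rightarrow> nat \<Rightarrow> real" where
  "unit i j = (if j = i then 1 else 0)"

definition mfactor :: "(nat \<Rightarrow> real) \<Rightarrow> nat \<Rightarrow> real" where
  "mfactor z i = (if i = 0 then a\<^sup>2 else if i < l then a\<^sup>2 * (exp (z 0))\<^sup>2 else 4 * b\<^sup>2 * (conf z)\<^sup>2)"

definition curv :: "nat \<Rightarrow> real" where
  "curv i = (if i < l then b / a else a / b)"

text \<open>The derivative in the radius \<open>r\<close> of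
  \<open>(cosh r * x, sinh r * y)\<close>, rewritten in terms of the point. It is linear in
  \<open>P\<close>, so its derivative along a tangent vector is \<open>normal\<close> of that
  vector.\<close>

definition normal :: "(nat \<Rightarrow> real) \<Rightarrow> nat \<Rightarrow> real" where
  "normal P k = (if k \<le> l then b / a * P k else a / b * P k)"

lemma mfactor_pos: "0 < mfactor z i"
  using a_pos b_pos conf_pos[of z] by (auto simp: mfactor_def)

lemma hdot_unit:
  "hdot (unit i) (unit j) = (if i = j \<and> 0 < i \<and> i < l then 1 else 0)"
proof -
  have "hdot (unit i) (unit j) = (\<Sum>k=1..<l. if k = i then if i = j then 1 else 0 else 0)"
    unfolding hdot_def by (intro sum.cong) (auto simp: unit_def)
  then show ?thesis
    by (auto simp: sum.delta)
qed

lemma sdot_unit: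
  "sdot (unit i) (unit j) = (if i = j \<and> l \<le> i \<and> i < n then 1 else 0)"
proof -
  have "sdot (unit i) (unit j) = (\<Sum>k=l..<n. if k = i then if i = j then 1 else 0 else 0)"
    unfolding sdot_def by (intro sum.cong) (auto simp: unit_def)
  then show ?thesis
    by (auto simp: sum.delta)
qed

lemma hyp_dparam_unit:
  "hyp (dparam \<sigma> z (unit i)) (dparam \<sigma> z (unit j)) = (if i = j \<and> i < l then mfactor z i else 0)"
  using l_pos by (auto simp: hyp_dparam_dparam hdot_unit mfactor_def) (auto simp: unit_def)

lemma sph_dparam_unit:
  "\<sigma>\<^sup>2 = 1 \<Longrightarrow> i < n \<Longrightarrow> sph (dparam \<sigma> z (unit i)) (dparam \<sigma> z (unit j)) = (if i = j \<and> l \<le> i then mfactor z i else 0)"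
  using l_pos by (auto simp: sph_dparam_dparam sdot_unit mfactor_def)

lemma mink_dparam:
  assumes "\<sigma>\<^sup>2 = 1"
  shows "mink (n + 1) (dparam \<sigma> z v) (dparam \<sigma> z w) = (\<Sum>i<n. mfactor z i * v i * w i)"
proof -
  have "(\<Sum>i<n. mfactor z i * v i * w i) = (\<Sum>i=0..<l. mfactor z i * v i * w i) + (\<Sum>i=l..<n. mfactor z i * v i * w i)"
    unfolding lessThan_atLeast0 by (rule sum.atLeastLessThan_concat[symmetric]) auto
  also have "(\<Sum>i=0..<l. mfactor z i * v i * w i) = a\<^sup>2 * v 0 * w 0 + (\<Sum>i=1..<l. mfactor z i * v i * w i)"
    using l_pos by (simp add: sum.atLeast_Suc_lessThan mfactor_def)
  also have "(\<Sum>i=1..<l. mfactor z i * v i * w i) = a\<^sup>2 * (exp (z 0))\<^sup>2 * hdot v w"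
    unfolding hdot_def sum_distrib_left by (intro sum.cong) (auto simp: mfactor_def)
  also have "(\<Sum>i=l..<n. mfactor z i * v i * w i) = 4 * b\<^sup>2 * (conf z)\<^sup>2 * sdot v w"
    unfolding sdot_def sum_distrib_left using l_pos by (intro sum.cong) (auto simp: mfactor_def)
  finally have "(\<Sum>i<n. mfactor z i * v i * w i) =
      a\<^sup>2 * v 0 * w 0 + a\<^sup>2 * (exp (z 0))\<^sup>2 * hdot v w + 4 * b\<^sup>2 * (conf z)\<^sup>2 * sdot v w" .
  moreover have "mink (n + 1) (dparam \<sigma> z v) (dparam \<sigma> z w) =
      a\<^sup>2 * v 0 * w 0 + a\<^sup>2 * (exp (z 0))\<^sup>2 * hdot v w + 4 * b\<^sup>2 * (conf z)\<^sup>2 * sdot v w"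
    using assms by (simp add: mink_eq hyp_dparam_dparam sph_dparam_dparam distrib_left mult.assoc)
  ultimately show ?thesis
    by (simp only:)
qed

lemma param_update_derivative:
  assumes z: "z \<in> extensional {..<n}" and \<sigma>: "\<sigma>\<^sup>2 = 1" and i: "i < n" and k: "k < n + 2"
  shows "((\<lambda>t. chart_inv (tube_chart \<sigma>) (z(i := t)) k) has_real_derivative dparam \<sigma> z (unit i) k) (at (z i))"
proof -
  have "((\<lambda>t. (z(i := t)) j) has_real_derivative unit i j) (at (z i))" for j
    by (cases "j = i") (auto simp: unit_def)
  then have "((\<lambda>t. param \<sigma> (z(i := t)) k) has_real_derivative dparam \<sigma> (z(i := z i)) (unit i) k) (at (z i))"
    using k by (intro param_has_real_derivative)
  then show ?thesis
    using z i \<sigma> by (simp add: chart_inv_tube_chart fun_upd_extensional)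
qed

lemma vec_deriv_id:
  assumes "P \<in> tube_dom \<sigma>" "\<sigma>\<^sup>2 = 1" "i < n" "k < n + 2"
  shows "vec_deriv (tube_chart \<sigma>) i (\<lambda>P. P) P k = dparam \<sigma> (coord \<sigma> P) (unit i) k"
  unfolding vec_deriv_def chart_deriv_def
  using param_update_derivative[OF coord_extensional assms(2-4), of \<sigma> P]
  by (intro partial_deriv_eqI) simp

lemma vec_deriv_normal:
  assumes "P \<in> tube_dom \<sigma>" "\<sigma>\<^sup>2 = 1" "i < n" "k < n + 2"
  shows "vec_deriv (tube_chart \<sigma>) i normal P k = normal (dparam \<sigma> (coord \<sigma> P) (unit i)) k"
proof -
  have "((\<lambda>t. r * chart_inv (tube_chart \<sigma>) ((coord \<sigma> P)(i := t)) k) has_real_derivative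
      r * dparam \<sigma> (coord \<sigma> P) (unit i) k) (at (coord \<sigma> P i))" for r
    by (intro DERIV_cmult param_update_derivative coord_extensional assms)
  from this[of "if k \<le> l then b / a else a / b"] show ?thesis
    unfolding vec_deriv_def chart_deriv_def normal_def
    by (intro partial_deriv_eqI) (cases "k \<le> l"; simp)
qed

lemma induced_metric_tube:
  assumes "P \<in> tube_dom \<sigma>" "\<sigma>\<^sup>2 = 1" "i < n" "j < n"
  shows "induced_metric n (\<lambda>P. P) (tube_chart \<sigma>) P i j = (if i = j then mfactor (coord \<sigma> P) i else 0)"
proof -
  have "induced_metric n (\<lambda>P. P) (tube_chart \<sigma>) P i j =
      mink (n + 1) (dparam \<sigma> (coord \<sigma> P) (unit i)) (dparam \<sigma> (coord \<sigma> P) (unit j))"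
    unfolding induced_metric_def using assms by (intro mink_cong vec_deriv_id) auto
  then show ?thesis
    using assms by (simp add: mink_eq hyp_dparam_unit sph_dparam_unit)
qed

lemma hyp_normal: "hyp (normal x) y = b / a * hyp x y"
proof -
  have "(\<Sum>i=1..<l. normal x i * y i) = b / a * (\<Sum>i=1..<l. x i * y i)"
    unfolding sum_distrib_left by (intro sum.cong) (auto simp: normal_def)
  then show ?thesis
    unfolding hyp_def by (simp add: normal_def algebra_simps)
qed

lemma sph_normal: "sph (normal x) y = a / b * sph x y"
proof -
  have "(\<Sum>i=l..<n. normal x (Suc i) * y (Suc i)) = a / b * (\<Sum>i=l..<n. x (Suc i) * y (Suc i))"
    unfolding sum_distrib_left by (intro sum.cong) (auto simp: normal_def)
  then show ?thesis
    unfolding sph_def by (simp add: normal_def algebra_simps)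
qed

lemma hyp_commute: "hyp x y = hyp y x"
  and sph_commute: "sph x y = sph y x"
  by (simp_all add: hyp_def sph_def mult.commute)

lemma mink_dparam_point:
  assumes "P \<in> tube_dom \<sigma>" "\<sigma>\<^sup>2 = 1"
  shows "hyp P (dparam \<sigma> (coord \<sigma> P) v) = 0" "sph P (dparam \<sigma> (coord \<sigma> P) v) = 0"
  using hyp_param_dparam[of \<sigma> "coord \<sigma> P" v] sph_param_dparam[OF assms(2), of "coord \<sigma> P" v]
  by (simp_all add: param_coord[OF assms])

text \<open>\<open>normal\<close> is the scalar \<open>b / a\<close> on the hyperbolic block and
  \<open>a / b\<close> on the spherical one. Tangent vectors are orthogonal to \<open>P\<close> in
  each block separately, so the projection term of the connection vanishes and the shape operator is
  this pair of scalars.\<close>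

lemma second_fundamental_form_tube:
  assumes "P \<in> tube_dom \<sigma>" "\<sigma>\<^sup>2 = 1" "i < n" "j < n"
  shows "second_fundamental_form n (\<lambda>P. P) normal (tube_chart \<sigma>) P i j =
    (if i = j then curv i * mfactor (coord \<sigma> P) i else 0)"
proof -
  let ?d = "\<lambda>i. dparam \<sigma> (coord \<sigma> P) (unit i)"
  have "mink (n + 1) (vec_deriv (tube_chart \<sigma>) i normal P) P = mink (n + 1) (normal (?d i)) P"
    using assms by (intro mink_cong vec_deriv_normal) auto
  then have "hyp_connection (n + 1) (\<lambda>P. P) normal (tube_chart \<sigma>) i P k = normal (?d i) k" if "k \<le> n + 1" for k
    using assms that
    by (simp add: hyp_connection_def vec_deriv_normal mink_eq hyp_normal sph_normal mink_dparam_point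
        hyp_commute[of "?d i" P] sph_commute[of "?d i" P])
  then have "second_fundamental_form n (\<lambda>P. P) normal (tube_chart \<sigma>) P i j = mink (n + 1) (normal (?d i)) (?d j)"
    unfolding second_fundamental_form_def using assms by (intro mink_cong vec_deriv_id) auto
  then show ?thesis
    using assms by (simp add: mink_eq hyp_normal sph_normal hyp_dparam_unit sph_dparam_unit curv_def)
qed

lemma mink_point: "P \<in> tube_set \<Longrightarrow> mink (Suc n) P P = - 1"
  using ab by (simp add: mink_eq tube_setD)

lemma smooth_fun_component:
  assumes "k < n + 2"
  shows "smooth_fun n atlas (\<lambda>P. P k)"
  unfolding smooth_fun_def
proof
  fix c assume "c \<in> atlas"
  then obtain \<sigma> where c: "c = tube_chart \<sigma>" and \<sigma>: "\<sigma> = 1 \<or> \<sigma> = - 1" "\<sigma>\<^sup>2 = 1"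
    by (rule atlas_cases)
  have "smooth_on n (extensional {..<n}) ((\<lambda>P. P k) \<circ> chart_inv c) \<longleftrightarrow>
      smooth_on n (extensional {..<n}) (\<lambda>z. param \<sigma> z k)"
    using \<sigma>(2) by (intro smooth_on_cong openin_extensional) (simp add: c chart_inv_tube_chart)
  then show "smooth_on n (snd c ` fst c) ((\<lambda>P. P k) \<circ> chart_inv c)"
    using smooth_on_param[OF openin_extensional assms] \<sigma>(2) by (simp add: c coord_image)
qed

lemma smooth_fun_cmult:
  assumes "smooth_fun n atlas f"
  shows "smooth_fun n atlas (\<lambda>P. r * f P)"
  unfolding smooth_fun_def
proof
  fix c assume "c \<in> atlas"
  moreover from this obtain \<sigma> where c: "c = tube_chart \<sigma>" and \<sigma>: "\<sigma> = 1 \<or> \<sigma> = - 1" "\<sigma>\<^sup>2 = 1"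
    by (rule atlas_cases)
  ultimately show "smooth_on n (snd c ` fst c) ((\<lambda>P. r * f P) \<circ> chart_inv c)"
    using assms smooth_on_mult[OF openin_extensional smooth_on_const, of "f \<circ> chart_inv c" r]
    by (auto simp: smooth_fun_def coord_image o_def)
qed

section \<open>The inclusion of the tube as a two-sided immersion\<close>

lemma immersion_tube: "immersion n tube_space atlas (\<lambda>P. P)"
  unfolding immersion_def
proof (intro conjI ballI allI impI)
  fix P assume "P \<in> topspace tube_space"
  then show "P \<in> topspace (hyperbolic_space (n + 1))"
    by (simp add: hyperbolic_space_def topspace_Rn topspace_tube_space tube_setD tube_setD(1)[simplified] mink_point)
next
  fix k assume "k \<le> n + 1"
  then show "smooth_fun n atlas (\<lambda>P. P k)"
    by (intro smooth_fun_component) simp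
next
  fix c P and v :: "nat \<Rightarrow> real" and j
  assume c_atlas: "c \<in> atlas" and P: "P \<in> fst c" and j: "j < n"
    and 0: "\<forall>k\<le>n + 1. (\<Sum>i<n. v i * vec_deriv c i (\<lambda>P. P) P k) = 0"
  from c_atlas obtain \<sigma> where c: "c = tube_chart \<sigma>" and \<sigma>: "\<sigma> = 1 \<or> \<sigma> = - 1" "\<sigma>\<^sup>2 = 1"
    by (rule atlas_cases)
  \<comment> \<open>The vanishing combination is paired with the \<open>j\<close>-th coordinate
    vector; the diagonal metric leaves \<open>v j\<close> times a positive factor.\<close>
  have "0 = mink (n + 1) (\<lambda>_. 0) (vec_deriv c j (\<lambda>P. P) P)"
    by (simp add: mink_def)
  also have "\<dots> = mink (n + 1) (\<lambda>k. \<Sum>i<n. v i * vec_deriv c i (\<lambda>P. P) P k) (vec_deriv c j (\<lambda>P. P) P)"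
    using 0 by (intro mink_cong) auto
  also have "\<dots> = (\<Sum>i<n. v i * induced_metric n (\<lambda>P. P) c P i j)"
    unfolding mink_sum_left induced_metric_def ..
  also have "\<dots> = (\<Sum>i<n. if i = j then v j * mfactor (coord \<sigma> P) j else 0)"
    using P \<sigma>(2) j by (intro sum.cong) (auto simp: c induced_metric_tube)
  also have "\<dots> = v j * mfactor (coord \<sigma> P) j"
    using j by (simp add: sum.delta)
  finally show "v j = 0"
    using mfactor_pos[of "coord \<sigma> P" j] by simp
qed

lemma unit_normal_tube: "unit_normal n tube_space atlas (\<lambda>P. P) normal"
  unfolding unit_normal_def
proof (intro conjI ballI allI impI)
  fix k assume "k \<le> n + 1"
  then have "smooth_fun n atlas (\<lambda>P. (if k \<le> l then b / a else a / b) * P k)"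
    by (intro smooth_fun_cmult smooth_fun_component) simp
  then show "smooth_fun n atlas (\<lambda>P. normal P k)"
    by (cases "k \<le> l") (simp_all add: normal_def)
next
  fix P assume "P \<in> topspace tube_space"
  then have P: "P \<in> tube_set"
    by (simp add: topspace_tube_space)
  have NF: "hyp (normal P) P = - (a * b)" "sph (normal P) P = a * b"
    using a_pos b_pos by (simp_all add: hyp_normal sph_normal tube_setD[OF P] power2_eq_square)
  then show "mink (n + 1) (normal P) P = 0"
    by (simp add: mink_eq)
  have "hyp (normal P) (normal P) = - (b\<^sup>2)" "sph (normal P) (normal P) = a\<^sup>2"
    using NF a_pos b_pos
    by (simp_all add: hyp_normal sph_normal hyp_commute[of P "normal P"] sph_commute[of P "normal P"] power2_eq_square)
  then show "mink (n + 1) (normal P) (normal P) = 1"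
    by (simp add: mink_eq ab)
next
  fix c P i assume c_atlas: "c \<in> atlas" and P: "P \<in> fst c" and i: "i < n"
  from c_atlas obtain \<sigma> where c: "c = tube_chart \<sigma>" and \<sigma>: "\<sigma> = 1 \<or> \<sigma> = - 1" "\<sigma>\<^sup>2 = 1"
    by (rule atlas_cases)
  have "mink (n + 1) (normal P) (vec_deriv c i (\<lambda>P. P) P) =
      mink (n + 1) (normal P) (dparam \<sigma> (coord \<sigma> P) (unit i))"
    unfolding c using P \<sigma> i by (intro mink_cong vec_deriv_id) (auto simp: c)
  then show "mink (n + 1) (normal P) (vec_deriv c i (\<lambda>P. P) P) = 0"
    using P \<sigma>(2) by (simp add: mink_eq hyp_normal sph_normal mink_dparam_point c)
qed

lemma two_sided_immersion_tube: "two_sided_immersion n tube_space atlas (\<lambda>P. P) normal"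
  by (simp add: two_sided_immersion_def smooth_manifold_tube immersion_tube unit_normal_tube)

text \<open>\<open>chart_cover\<close> is a Hilbert choice: only its defining property can be used,
  and only after a sequence of charts with that property has been exhibited. Which of the two charts
  comes first stays unknown.\<close>

lemma chart_cover_tube:
  "range (chart_cover atlas) \<subseteq> atlas" "(\<Union>k. fst (chart_cover atlas k)) = tube_set"
proof -
  have U: "(\<Union>c\<in>atlas. fst c) = tube_set"
    using smooth_atlas_tube by (simp add: smooth_atlas_def topspace_tube_space)
  let ?c = "\<lambda>k :: nat. if k = 0 then tube_chart 1 else tube_chart (- 1)"
  have "atlas \<subseteq> range ?c"
  proof
    fix c assume "c \<in> atlas"
    then have "c = ?c 0 \<or> c = ?c 1"
      by (auto simp: atlas_def)
    then show "c \<in> range ?c"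
      using rangeI[of ?c 0] rangeI[of ?c 1] by (elim disjE) simp_all
  qed
  then have "range ?c = atlas"
    by (auto simp: atlas_def)
  moreover have "(\<Union>c'\<in>range ?c. fst c') = (\<Union>k. fst (?c k))"
    by (simp only: image_image)
  ultimately have "\<exists>c :: nat \<Rightarrow> _. range c \<subseteq> atlas \<and> (\<Union>k. fst (c k)) = (\<Union>c'\<in>atlas. fst c')"
    by (intro exI[of _ ?c]) (simp only:, simp)
  from someI_ex[OF this, folded chart_cover_def]
  show "range (chart_cover atlas) \<subseteq> atlas" "(\<Union>k. fst (chart_cover atlas k)) = tube_set"
    by (simp_all add: U)
qed

lemma base_chart_tube:
  assumes "P \<in> tube_set"
  obtains \<sigma> where "base_chart atlas P = tube_chart \<sigma>" "\<sigma>\<^sup>2 = 1" "P \<in> tube_dom \<sigma>"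
proof -
  have "\<exists>k. P \<in> fst (chart_cover atlas k)"
    using assms chart_cover_tube(2) by blast
  then have "P \<in> fst (base_chart atlas P)"
    unfolding base_chart_def base_index_def by (rule LeastI_ex)
  moreover have "base_chart atlas P \<in> atlas"
    unfolding base_chart_def using chart_cover_tube(1) by blast
  from this obtain \<sigma> where "base_chart atlas P = tube_chart \<sigma>" "\<sigma> = 1 \<or> \<sigma> = - 1" "\<sigma>\<^sup>2 = 1"
    by (rule atlas_cases)
  ultimately show thesis
    using that by simp
qed

section \<open>Mean curvature, squared norm of the second fundamental form, and gradient\<close>

lemma mean_curvature_tube:
  assumes "P \<in> tube_set"
  shows "mean_curvature n atlas (\<lambda>P. P) normal P = (l * (b / a) + K * (a / b)) / n"
proof -
  obtain \<sigma> where \<sigma>: "base_chart atlas P = tube_chart \<sigma>" "\<sigma>\<^sup>2 = 1" "P \<in> tube_dom \<sigma>"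
    using base_chart_tube[OF assms] .
  have "metric_trace n atlas (induced_metric n (\<lambda>P. P)) (second_fundamental_form n (\<lambda>P. P) normal) P = (\<Sum>i<n. curv i)"
    using mfactor_pos \<sigma>
    by (intro metric_trace_diagonal[where d = "mfactor (coord \<sigma> P)"])
      (auto simp: induced_metric_tube second_fundamental_form_tube less_imp_neq[symmetric])
  also have "(\<Sum>i<n. curv i) = (\<Sum>i<l. b / a) + (\<Sum>i=l..<n. a / b)"
    unfolding lessThan_atLeast0 by (subst sum.atLeastLessThan_concat[of 0 l n, symmetric]) (auto simp: curv_def)
  finally show ?thesis
    by (simp add: mean_curvature_def)
qed

lemma form_norm_sq_tube:
  assumes "P \<in> tube_set"
  shows "form_norm_sq n atlas (induced_metric n (\<lambda>P. P)) (second_fundamental_form n (\<lambda>P. P) normal) P =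
    l * (b / a)\<^sup>2 + K * (a / b)\<^sup>2"
proof -
  obtain \<sigma> where \<sigma>: "base_chart atlas P = tube_chart \<sigma>" "\<sigma>\<^sup>2 = 1" "P \<in> tube_dom \<sigma>"
    using base_chart_tube[OF assms] .
  have "form_norm_sq n atlas (induced_metric n (\<lambda>P. P)) (second_fundamental_form n (\<lambda>P. P) normal) P = (\<Sum>i<n. (curv i)\<^sup>2)"
    using mfactor_pos \<sigma>
    by (intro form_norm_sq_diagonal[where d = "mfactor (coord \<sigma> P)"])
      (auto simp: induced_metric_tube second_fundamental_form_tube less_imp_neq[symmetric])
  also have "(\<Sum>i<n. (curv i)\<^sup>2) = (\<Sum>i<l. (b / a)\<^sup>2) + (\<Sum>i=l..<n. (a / b)\<^sup>2)"
    unfolding lessThan_atLeast0 by (subst sum.atLeastLessThan_concat[of 0 l n, symmetric]) (auto simp: curv_def)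
  finally show ?thesis
    by simp
qed

lemma grad_norm_sq_tube:
  assumes "base_chart atlas P = tube_chart \<sigma>" "\<sigma>\<^sup>2 = 1" "P \<in> tube_dom \<sigma>"
  shows "grad_norm_sq n atlas (induced_metric n (\<lambda>P. P)) f P =
    (\<Sum>i<n. (chart_deriv (tube_chart \<sigma>) i f P)\<^sup>2 / mfactor (coord \<sigma> P) i)"
  using mfactor_pos assms
  by (subst grad_norm_sq_diagonal[where d = "mfactor (coord \<sigma> P)"])
    (auto simp: induced_metric_tube less_imp_neq[symmetric])

lemma embedding_map_tube: "embedding_map tube_space (hyperbolic_space (n + 1)) (\<lambda>P. P)"
proof -
  have "embedding_map tube_space (Rn (n + 2)) (\<lambda>P. P)"
    unfolding embedding_map_def topspace_tube_space
    by (simp add: tube_space_def homeomorphic_map_id[unfolded id_def])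
  moreover have "tube_set \<subseteq> {x. mink (n + 1) x x = - 1 \<and> x 0 > 0}"
    by (auto simp: mink_point tube_setD)
  ultimately show ?thesis
    by (simp add: hyperbolic_space_def embedding_map_in_subtopology topspace_tube_space)
qed

lemma not_compact_tube_space: "\<not> compact_space tube_space"
proof
  assume "compact_space tube_space"
  then have "compactin euclideanreal ((\<lambda>P. P 0) ` tube_set)"
    using image_compactin[of tube_space tube_set euclideanreal "\<lambda>P. P 0"]
      continuous_map_tube_component[of 0 UNIV]
    by (simp add: compact_space_def topspace_tube_space)
  then have "bounded ((\<lambda>P. P 0) ` tube_set)"
    by (simp add: compact_imp_bounded)
  then obtain B where "\<forall>x\<in>(\<lambda>P. P 0) ` tube_set. norm x \<le> B"
    unfolding bounded_iff by blast
  then have B: "P 0 \<le> B" if "P \<in> tube_set" for P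
    using that by fastforce
  \<comment> \<open>Chosen so that \<open>a * exp (z 0) / 2\<close>, a lower bound for
    \<open>P 0\<close>, equals \<open>\<bar>B\<bar> + 1\<close>.\<close>
  define z :: "nat \<Rightarrow> real" where "z i = ln (2 * (\<bar>B\<bar> + 1) / a)" for i
  have "a * exp (z 0) = 2 * (\<bar>B\<bar> + 1)"
    unfolding z_def using a_pos by (subst exp_ln) (auto intro!: divide_pos_pos)
  moreover have "a * exp (z 0) / 2 \<le> param 1 z 0"
    using a_pos hdot_nonneg[of z] by (simp add: param_simps field_simps)
  ultimately show False
    using B[OF param_in_tube_set[of 1 z]] by simp
qed

end

section \<open>Riemannian measure and stability\<close>

lemma power_commute_square: "(x\<^sup>2) ^ k = (x ^ k)\<^sup>2" for x :: real
  by (simp add: mult.commute flip: power_mult)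

text \<open>The Riemannian measure is built by \<open>measure_of\<close> from an explicit set
  function. Once that function agrees with a measure \<open>D\<close> on the sigma-algebra,
  \<open>measure_of\<close> returns \<open>D\<close> itself, and countable additivity of the
  explicit formula follows without a separate proof.\<close>

lemma measure_of_emeasure:
  assumes "A \<subseteq> Pow \<Omega>" "sets D = sigma_sets \<Omega> A"
  shows "measure_of \<Omega> A (emeasure D) = D"
proof (rule measure_eqI)
  show S: "sets (measure_of \<Omega> A (emeasure D)) = sets D"
    using assms by simp
  show "emeasure (measure_of \<Omega> A (emeasure D)) X = emeasure D X" if "X \<in> sets (measure_of \<Omega> A (emeasure D))" for X
    using that unfolding S
    by (intro emeasure_measure_of[OF refl assms(1)])
      (simp_all only: S emeasure_positive emeasure_countably_additive)
qed

context tube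
begin

abbreviation \<mu> :: "(nat \<Rightarrow> real) measure" where
  "\<mu> \<equiv> riem_measure n tube_space atlas (induced_metric n (\<lambda>P. P))"

text \<open>The product of the lengths of the \<open>n\<close> orthogonal coordinate vectors.
  Written without a root it visibly splits into \<open>exp ((l - 1) * z 0)\<close> and a function
  independent of the height.\<close>

definition vol_density :: "(nat \<Rightarrow> real) \<Rightarrow> real" where
  "vol_density z = a * (a * exp (z 0)) ^ (l - 1) * (2 * b * conf z) ^ K"

lemma vol_density_pos: "0 < vol_density z"
  using a_pos b_pos conf_pos[of z] by (simp add: vol_density_def)

lemma prod_mfactor: "(\<Prod>i<n. mfactor z i) = (vol_density z)\<^sup>2"
proof -
  have "(\<Prod>i<n. mfactor z i) = (\<Prod>i=0..<l. mfactor z i) * (\<Prod>i=l..<n. mfactor z i)"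
    unfolding lessThan_atLeast0 by (rule prod.atLeastLessThan_concat[symmetric]) auto
  also have "(\<Prod>i=0..<l. mfactor z i) = a\<^sup>2 * (\<Prod>i=1..<l. (a * exp (z 0))\<^sup>2)"
    using l_pos by (simp add: prod.atLeast_Suc_lessThan mfactor_def power_mult_distrib)
  also have "\<dots> = a\<^sup>2 * ((a * exp (z 0)) ^ (l - 1))\<^sup>2"
    by (simp only: prod_constant card_atLeastLessThan power_commute_square)
  also have "(\<Prod>i=l..<n. mfactor z i) = (\<Prod>i=l..<n. (2 * b * conf z)\<^sup>2)"
    using l_pos by (intro prod.cong) (auto simp: mfactor_def power_mult_distrib)
  also have "\<dots> = ((2 * b * conf z) ^ K)\<^sup>2"
    by (simp only: prod_constant card_atLeastLessThan power_commute_square diff_add_inverse)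
  finally show ?thesis
    by (simp only: vol_density_def power_mult_distrib mult.assoc)
qed

lemma measurable_vol_density: "vol_density \<in> borel_measurable (PiM {..<n} (\<lambda>_. lborel))"
proof -
  have [measurable]: "(\<lambda>z. z i) \<in> borel_measurable (PiM {..<n} (\<lambda>_. lborel :: real measure))" if "i < n" for i
    using measurable_component_singleton[of i "{..<n}" "\<lambda>_. lborel :: real measure"] that by simp
  have [measurable]: "(\<lambda>z. sdot z z) \<in> borel_measurable (PiM {..<n} (\<lambda>_. lborel :: real measure))"
    unfolding sdot_def by (intro borel_measurable_sum borel_measurable_times) auto
  have [measurable]: "(\<lambda>z. z 0) \<in> borel_measurable (PiM {..<n} (\<lambda>_. lborel :: real measure))"
    using n_pos by simp
  show ?thesis
    unfolding vol_density_def[abs_def] conf_def by measurable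
qed

lemma measurable_param:
  assumes "\<sigma>\<^sup>2 = 1"
  shows "param \<sigma> \<in> measurable (PiM {..<n} (\<lambda>_. lborel)) (sigma tube_set {U. openin tube_space U})"
proof (rule measurable_measure_of)
  show "{U. openin tube_space U} \<subseteq> Pow tube_set"
    using openin_subset[of tube_space] by (auto simp: topspace_tube_space)
  show "param \<sigma> \<in> space (PiM {..<n} (\<lambda>_. lborel)) \<rightarrow> tube_set"
    using assms by (simp add: param_in_tube_set)
  fix U assume "U \<in> {U. openin tube_space U}"
  then have "openin (Rn n) {z \<in> topspace (Rn n). param \<sigma> z \<in> U}"
    using continuous_map_param[OF assms] by (intro openin_continuous_map_preimage) auto
  moreover have "{z \<in> topspace (Rn n). param \<sigma> z \<in> U} = param \<sigma> -` U \<inter> space (PiM {..<n} (\<lambda>_. lborel))"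
    by (auto simp: topspace_Rn space_PiM PiE_def)
  ultimately show "param \<sigma> -` U \<inter> space (PiM {..<n} (\<lambda>_. lborel)) \<in> sets (PiM {..<n} (\<lambda>_. lborel))"
    using openin_Rn_sets by metis
qed

text \<open>The first chart of the chosen cover misses only a set whose image in every other chart is a
  null set, the slice over one pole of the sphere.\<close>

lemma riem_measure_tube:
  obtains \<sigma> where "\<sigma>\<^sup>2 = 1" "\<And>P. P \<in> tube_dom \<sigma> \<Longrightarrow> base_chart atlas P = tube_chart \<sigma>"
    "\<mu> = distr (density (PiM {..<n} (\<lambda>_. lborel)) (\<lambda>z. ennreal (vol_density z)))
       (sigma tube_set {U. openin tube_space U}) (param \<sigma>)"
proof -
  let ?L = "PiM {..<n} (\<lambda>_. lborel :: real measure)" and ?\<Omega> = "{U. openin tube_space U}"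
  let ?c = "chart_cover atlas"
  have "?c 0 \<in> atlas"
    using chart_cover_tube(1) by blast
  then obtain \<sigma> where c0: "?c 0 = tube_chart \<sigma>" and \<sigma>1: "\<sigma> = 1 \<or> \<sigma> = - 1" and \<sigma>: "\<sigma>\<^sup>2 = 1"
    by (rule atlas_cases)
  \<comment> \<open>The first chart claims every point of its domain, so all pieces with
    \<open>k > 0\<close> lie outside \<open>tube_dom \<sigma>\<close>.\<close>
  have index0: "base_index atlas P = 0 \<longleftrightarrow> P \<in> tube_dom \<sigma>" if "P \<in> tube_set" for P
  proof
    assume "base_index atlas P = 0"
    have "\<exists>k. P \<in> fst (?c k)"
      using that chart_cover_tube(2) by blast
    then have "P \<in> fst (?c (base_index atlas P))"
      unfolding base_index_def by (rule LeastI_ex)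
    then show "P \<in> tube_dom \<sigma>"
      unfolding \<open>base_index atlas P = 0\<close> c0 by simp
  next
    assume "P \<in> tube_dom \<sigma>"
    then have "P \<in> fst (?c 0)"
      by (simp add: c0)
    then show "base_index atlas P = 0"
      unfolding base_index_def by (simp add: Least_eq_0)
  qed
  define D where "D = distr (density ?L (\<lambda>z. ennreal (vol_density z))) (sigma tube_set ?\<Omega>) (param \<sigma>)"
  have \<Omega>: "?\<Omega> \<subseteq> Pow tube_set"
    using openin_subset[of tube_space] by (auto simp: topspace_tube_space)
  have pm: "param \<sigma> \<in> measurable (density ?L (\<lambda>z. ennreal (vol_density z))) (sigma tube_set ?\<Omega>)"
    using measurable_param[OF \<sigma>] by simp
  have vm: "(\<lambda>z. ennreal (vol_density z)) \<in> borel_measurable ?L"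
    using measurable_vol_density by simp
  let ?g = "induced_metric n (\<lambda>P. P)"
  let ?I = "\<lambda>E k. \<integral>\<^sup>+x. ennreal (sqrt (Determinant.det (gram n ?g (?c k) (chart_inv (?c k) x)))) *
      indicator (snd (?c k) ` {p\<in>E. base_index atlas p = k}) x \<partial>?L"
  have "(\<Sum>k. ?I E k) = emeasure D E" if E: "E \<in> sigma_sets tube_set ?\<Omega>" for E
  proof -
    have ET: "E \<subseteq> tube_set"
      using sigma_sets_into_sp[OF \<Omega> E] .
    have "?I E k = 0" if "k \<noteq> 0" for k
    proof -
      have "?c k \<in> atlas"
        using chart_cover_tube(1) by blast
      then obtain \<tau> where ck: "?c k = tube_chart \<tau>" "\<tau> = 1 \<or> \<tau> = - 1" "\<tau>\<^sup>2 = 1"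
        by (rule atlas_cases)
      have "coord \<tau> P \<in> {x \<in> space ?L. x l = 0}" if P: "P \<in> E" "base_index atlas P = k" for P
      proof -
        have PT: "P \<in> tube_set"
          using P ET by auto
        then have "P \<notin> tube_dom \<sigma>"
          using index0[OF PT] P \<open>k \<noteq> 0\<close> by simp
        \<comment> \<open>Outside \<open>tube_dom \<sigma>\<close> the last component alone has
          modulus at least the radius \<open>b\<close>, so the sphere equation forces the other
          sphere components to vanish. \<open>K > 0\<close> provides one of them, at ambient index
          \<open>Suc l\<close>, that is chart coordinate \<open>l\<close>.\<close>
        then have "b \<le> - \<sigma> * P (Suc n)"
          using PT by (simp add: tube_dom_def)
        then have "b\<^sup>2 \<le> (P (Suc n))\<^sup>2"
          using power_mono[of b "- \<sigma> * P (Suc n)" 2] b_pos by (simp add: power_mult_distrib \<sigma>)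
        moreover have "(\<Sum>i=l..<n. P (Suc i) * P (Suc i)) + (P (Suc n))\<^sup>2 = b\<^sup>2"
          using tube_setD(3)[OF PT] by (simp add: sph_def power2_eq_square)
        moreover have "P (Suc l) * P (Suc l) \<le> (\<Sum>i=l..<n. P (Suc i) * P (Suc i))"
          using K_pos by (intro member_le_sum) auto
        ultimately have "P (Suc l) * P (Suc l) \<le> 0"
          by linarith
        then have "P (Suc l) = 0"
          by (metis mult_eq_0_iff zero_le_square order_antisym)
        then have "coord \<tau> P l = 0"
          using K_pos by (simp add: coord_simps(3))
        then show ?thesis
          using coord_extensional[of \<tau> P] by (simp add: space_PiM PiE_def)
      qed
      then have "coord \<tau> ` {p\<in>E. base_index atlas p = k} \<subseteq> {x \<in> space ?L. x l = 0}"
        by blast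
      moreover have "AE x in ?L. x \<notin> {x \<in> space ?L. x l = 0}"
        using K_pos by (intro AE_not_in null_sets_coordinate_zero) auto
      ultimately have "AE x in ?L. x \<notin> coord \<tau> ` {p\<in>E. base_index atlas p = k}"
        by (auto elim!: eventually_mono)
      then have "AE x in ?L. ennreal (sqrt (Determinant.det (gram n ?g (?c k) (chart_inv (?c k) x)))) *
          indicator (snd (?c k) ` {p\<in>E. base_index atlas p = k}) x = 0"
        by eventually_elim (simp add: ck)
      from nn_integral_cong_AE[OF this] show ?thesis
        by simp
    qed
    then have "(\<Sum>k. ?I E k) = (\<Sum>k\<in>{0}. ?I E k)"
      by (intro suminf_finite) auto
    also have "\<dots> = ?I E 0"
      by (simp only: sum.insert finite.emptyI empty_iff not_False_eq_True sum.empty add_0_right)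
    also have "\<dots> = (\<integral>\<^sup>+x. ennreal (vol_density x) * indicator (param \<sigma> -` E \<inter> space ?L) x \<partial>?L)"
    proof (rule nn_integral_cong)
      fix z assume z: "z \<in> space ?L"
      then have ze: "z \<in> extensional {..<n}"
        by (simp add: space_PiM PiE_def)
      have g: "?g (tube_chart \<sigma>) (param \<sigma> z) i j = (if i = j then mfactor z i else 0)" if "i < n" "j < n" for i j
        using induced_metric_tube[OF param_in_tube_dom[OF \<sigma>] \<sigma> that, of z] by (simp only: coord_param[OF ze \<sigma>])
      have "mfactor z i \<noteq> 0" for i
        using mfactor_pos[of z i] by simp
      then have "Determinant.det (gram n ?g (tube_chart \<sigma>) (param \<sigma> z)) = (\<Prod>i<n. mfactor z i)"
        using g by (intro det_gram_diagonal)
      then have "sqrt (Determinant.det (gram n ?g (?c 0) (chart_inv (?c 0) z))) = vol_density z"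
        using vol_density_pos[of z] by (simp add: c0 chart_inv_tube_chart ze \<sigma> prod_mfactor)
      moreover have "z \<in> coord \<sigma> ` {p\<in>E. base_index atlas p = 0} \<longleftrightarrow> param \<sigma> z \<in> E"
      proof
        assume "z \<in> coord \<sigma> ` {p\<in>E. base_index atlas p = 0}"
        then obtain P where P: "P \<in> E" "base_index atlas P = 0" "z = coord \<sigma> P"
          by blast
        then have "P \<in> tube_dom \<sigma>"
          using index0[of P] ET by auto
        then show "param \<sigma> z \<in> E"
          using P by (simp add: param_coord \<sigma>)
      next
        assume "param \<sigma> z \<in> E"
        moreover have "base_index atlas (param \<sigma> z) = 0"
          using index0[of "param \<sigma> z"] by (simp add: param_in_tube_set param_in_tube_dom \<sigma>)
        ultimately show "z \<in> coord \<sigma> ` {p\<in>E. base_index atlas p = 0}"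
          using coord_param[OF ze \<sigma>] by (intro image_eqI[of _ _ "param \<sigma> z"]) auto
      qed
      ultimately show "ennreal (sqrt (Determinant.det (gram n ?g (?c 0) (chart_inv (?c 0) z)))) *
          indicator (snd (?c 0) ` {p\<in>E. base_index atlas p = 0}) z =
          ennreal (vol_density z) * indicator (param \<sigma> -` E \<inter> space ?L) z"
        using z by (simp add: c0 indicator_def)
    qed
    also have "\<dots> = emeasure D E"
    proof -
      have ES: "E \<in> sets (sigma tube_set ?\<Omega>)"
        using E \<Omega> by simp
      have "emeasure D E = emeasure (density ?L (\<lambda>z. ennreal (vol_density z))) (param \<sigma> -` E \<inter> space ?L)"
        unfolding D_def using emeasure_distr[OF pm ES] by simp
      also have "\<dots> = (\<integral>\<^sup>+x. ennreal (vol_density x) * indicator (param \<sigma> -` E \<inter> space ?L) x \<partial>?L)"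
        using measurable_sets[OF measurable_param[OF \<sigma>] ES] by (intro emeasure_density vm)
      finally show ?thesis ..
    qed
    finally show ?thesis .
  qed
  then have "\<mu> = measure_of tube_set ?\<Omega> (emeasure D)"
    unfolding riem_measure_def topspace_tube_space by (intro measure_of_eq \<Omega>)
  also have "\<dots> = D"
    using \<Omega> by (intro measure_of_emeasure) (simp_all add: D_def)
  finally have "\<mu> = D" .
  moreover have "base_chart atlas P = tube_chart \<sigma>" if "P \<in> tube_dom \<sigma>" for P
    using index0[OF subsetD[OF tube_dom_subset that]] that by (simp add: base_chart_def c0)
  ultimately show thesis
    using that[OF \<sigma>] by (simp add: D_def)
qed


text \<open>The height is one continuous function on the whole tube, given by the same formula in
  both charts. Integration by parts will run along the height, and this bound on the support removes
  its boundary terms.\<close>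

lemma coord_0_bounded_on_compact:
  assumes "compactin tube_space T"
  obtains R where "\<And>z \<sigma>. \<sigma>\<^sup>2 = 1 \<Longrightarrow> param \<sigma> z \<in> T \<Longrightarrow> \<bar>z 0\<bar> \<le> R"
proof -
  let ?s = "\<lambda>P. ln ((P 0 + P l) / a)"
  have c: "continuous_map tube_space euclideanreal (\<lambda>P. P k)" if "k < n + 2" for k
    using continuous_map_tube_component[OF that, of UNIV] by simp
  have h: "(P 0 + P l) / a \<noteq> 0" if "P \<in> topspace tube_space" for P
    using height_pos[of P] that a_pos by (simp add: topspace_tube_space)
  have "continuous_map tube_space euclideanreal ?s"
    using h a_pos
    by (intro continuous_map_real_ln continuous_map_real_divide continuous_map_add c continuous_map_const[THEN iffD2]) auto
  then have "compactin euclideanreal (?s ` T)"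
    using assms image_compactin by blast
  then have "bounded (?s ` T)"
    by (simp add: compact_imp_bounded)
  then obtain R where R: "\<forall>x\<in>?s ` T. norm x \<le> R"
    unfolding bounded_iff by blast
  show thesis
  proof
    fix z \<sigma> assume "\<sigma>\<^sup>2 = 1" "param \<sigma> z \<in> T"
    then have "norm (?s (param \<sigma> z)) \<le> R"
      using R by blast
    then show "\<bar>z 0\<bar> \<le> R"
      using a_pos by (simp add: param_height)
  qed
qed

text \<open>The gradient is bounded below by its component along the height of the horospherical
  coordinates, and the stability inequality holds on every line in that direction.\<close>

lemma strongly_stable_tube:
  assumes stab: "4 * real K * a\<^sup>2 = (real l + 1)\<^sup>2 * b\<^sup>2"
  shows "strongly_stable n tube_space atlas (\<lambda>P. P) normal"
  unfolding strongly_stable_def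
proof
  fix f assume f: "f \<in> test_functions n tube_space atlas"
  \<comment> \<open>The volume density depends on the height through
    \<open>exp ((l - 1) * z 0) = exp (2 * \<alpha> * z 0)\<close>, so \<open>\<alpha>^2\<close> is
    the Hardy constant of this weight.\<close>
  define \<alpha> where "\<alpha> = (real l - 1) / 2"
  obtain \<sigma> where \<sigma>: "\<sigma>\<^sup>2 = 1"
    and base: "\<And>P. P \<in> tube_dom \<sigma> \<Longrightarrow> base_chart atlas P = tube_chart \<sigma>"
    and \<mu>: "\<mu> = distr (density (PiM {..<n} (\<lambda>_. lborel)) (\<lambda>z. ennreal (vol_density z)))
       (sigma tube_set {U. openin tube_space U}) (param \<sigma>)"
    by (rule riem_measure_tube) (rule that; assumption)
  have \<sigma>_cases: "\<sigma> = 1 \<or> \<sigma> = - 1"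
    using \<sigma> by (simp add: power2_eq_1_iff)
  have chart: "tube_chart \<sigma> \<in> atlas"
    using \<sigma>_cases by (auto simp: atlas_def)
  \<comment> \<open>The hypothesis turns \<open>K (a / b)^2\<close> into
    \<open>(l + 1)^2 / 4\<close>. With \<open>u = 1 / a^2\<close> everything collects to
    \<open>u ((l + 1)^2 / 4 - l)\<close>, and \<open>(l + 1)^2 - 4 l = (l - 1)^2\<close>.\<close>
  have \<kappa>: "real l * (b / a)\<^sup>2 + real K * (a / b)\<^sup>2 - real n = \<alpha>\<^sup>2 / a\<^sup>2"
  proof -
    define u where "u = inverse (a\<^sup>2)"
    have u: "a\<^sup>2 * u = 1"
      using a_pos by (simp add: u_def)
    have b: "b\<^sup>2 = a\<^sup>2 - 1" "b\<^sup>2 \<noteq> 0"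
      using b_pos ab by simp_all
    have "(a\<^sup>2 - 1) * u = 1 - u"
      by (simp add: left_diff_distrib u)
    then have bu: "b\<^sup>2 * u = 1 - u"
      by (simp only: b)
    have "real l * (b / a)\<^sup>2 = real l * (b\<^sup>2 * u)"
      by (simp add: u_def divide_inverse power_mult_distrib power_inverse)
    moreover have "real K * (a / b)\<^sup>2 = (real l + 1)\<^sup>2 / 4"
      using stab b(2) by (simp add: power_divide field_simps)
    moreover have "4 * real K * (a\<^sup>2 * u) = (real l + 1)\<^sup>2 * (b\<^sup>2 * u)"
      using stab by (simp only: mult.assoc[symmetric])
    then have "real K = (real l + 1)\<^sup>2 * (b\<^sup>2 * u) / 4"
      by (simp add: u)
    ultimately have "real l * (b / a)\<^sup>2 + real K * (a / b)\<^sup>2 - real n =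
        real l * (1 - u) + (real l + 1)\<^sup>2 / 4 - (real l + (real l + 1)\<^sup>2 * (1 - u) / 4)"
      by (simp only: bu of_nat_add)
    also have "\<dots> = \<alpha>\<^sup>2 * u"
      by (simp add: \<alpha>_def power2_eq_square field_simps)
    finally show ?thesis
      by (simp add: u_def divide_inverse)
  qed
  define F where "F = f \<circ> chart_inv (tube_chart \<sigma>)"
  have smooth: "smooth_on n (extensional {..<n}) F"
    using f chart \<sigma> by (auto simp: test_functions_def smooth_fun_def F_def coord_image)
  have F: "F z = f (param \<sigma> z)" if "z \<in> extensional {..<n}" for z
    using that \<sigma> by (simp add: F_def chart_inv_tube_chart)
  let ?T = "tube_space closure_of {P \<in> topspace tube_space. f P \<noteq> 0}"
  have "compactin tube_space ?T"
    using f by (simp add: test_functions_def)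
  then obtain R where R: "\<And>z \<sigma>. \<sigma>\<^sup>2 = 1 \<Longrightarrow> param \<sigma> z \<in> ?T \<Longrightarrow> \<bar>z 0\<bar> \<le> R"
    by (rule coord_0_bounded_on_compact) (rule that; assumption)
  \<comment> \<open>The margin 1 puts such points strictly outside the bound \<open>R\<close> valid
    on the support.\<close>
  have supp: "f (param \<sigma> z) = 0" if "R + 1 \<le> \<bar>z 0\<bar>" for z
  proof (rule ccontr)
    assume "f (param \<sigma> z) \<noteq> 0"
    then have "param \<sigma> z \<in> {P \<in> topspace tube_space. f P \<noteq> 0}"
      by (simp add: topspace_tube_space param_in_tube_set \<sigma>)
    then have "param \<sigma> z \<in> ?T"
      by (rule subsetD[OF closure_of_subset, rotated]) auto
    from R[OF \<sigma> this] that show False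
      by simp
  qed
  define h where "h P = grad_norm_sq n atlas (induced_metric n (\<lambda>P. P)) f P -
      (form_norm_sq n atlas (induced_metric n (\<lambda>P. P)) (second_fundamental_form n (\<lambda>P. P) normal) P - real n) * (f P)\<^sup>2" for P
  have h: "(partial_deriv 0 F z)\<^sup>2 / a\<^sup>2 - \<alpha>\<^sup>2 / a\<^sup>2 * (F z)\<^sup>2 \<le> h (param \<sigma> z)" if z: "z \<in> extensional {..<n}" for z
  proof -
    have "(chart_deriv (tube_chart \<sigma>) 0 f (param \<sigma> z))\<^sup>2 / mfactor z 0
        \<le> (\<Sum>i<n. (chart_deriv (tube_chart \<sigma>) i f (param \<sigma> z))\<^sup>2 / mfactor z i)"
      using n_pos mfactor_pos[of z] by (intro member_le_sum) (auto intro!: divide_nonneg_pos)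
    also have "\<dots> = grad_norm_sq n atlas (induced_metric n (\<lambda>P. P)) f (param \<sigma> z)"
      using grad_norm_sq_tube[OF base[OF param_in_tube_dom[OF \<sigma>]] \<sigma> param_in_tube_dom[OF \<sigma>], of f z]
      by (simp only: coord_param[OF z \<sigma>])
    finally have "(partial_deriv 0 F z)\<^sup>2 / a\<^sup>2 \<le> grad_norm_sq n atlas (induced_metric n (\<lambda>P. P)) f (param \<sigma> z)"
      by (simp add: chart_deriv_def F_def[symmetric] coord_param[OF z \<sigma>] mfactor_def)
    then show ?thesis
      unfolding h_def form_norm_sq_tube[OF param_in_tube_set[OF \<sigma>]] \<kappa>
      by (simp add: F[OF z])
  qed
  have "0 \<le> (\<integral>P. h P \<partial>\<mu>)"
  proof (cases "integrable \<mu> h")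
    case True
    let ?L = "PiM {..<n} (\<lambda>_. lborel :: real measure)"
    let ?I = "{1..<n}"
    have I: "{..<n} = insert 0 ?I"
      using n_pos by auto
    have pm: "param \<sigma> \<in> measurable (density ?L (\<lambda>z. ennreal (vol_density z))) (sigma tube_set {U. openin tube_space U})"
      using measurable_param[OF \<sigma>] by simp
    have hm: "h \<in> borel_measurable (sigma tube_set {U. openin tube_space U})"
      using borel_measurable_integrable[OF True] unfolding \<mu> by simp
    have hp: "(\<lambda>z. h (param \<sigma> z)) \<in> borel_measurable ?L"
      using measurable_compose[OF measurable_param[OF \<sigma>] hm] .
    have nonneg: "AE z in ?L. 0 \<le> vol_density z"
      using vol_density_pos by (simp add: less_imp_le)
    define q where "q z = vol_density z *\<^sub>R h (param \<sigma> z)" for z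
    have "integrable (density ?L (\<lambda>z. ennreal (vol_density z))) (\<lambda>z. h (param \<sigma> z))"
      using True unfolding \<mu> by (subst (asm) integrable_distr_eq[OF pm hm])
    then have q: "integrable ?L q"
      unfolding q_def[abs_def]
      by (subst (asm) integrable_density[OF hp measurable_vol_density nonneg])
    have "(\<integral>P. h P \<partial>\<mu>) = (\<integral>z. h (param \<sigma> z) \<partial>density ?L (\<lambda>z. ennreal (vol_density z)))"
      unfolding \<mu> by (rule integral_distr[OF pm hm])
    also have "\<dots> = (\<integral>z. q z \<partial>?L)"
      unfolding q_def[abs_def] by (rule integral_density[OF hp measurable_vol_density nonneg])
    \<comment> \<open>Fubini with the height innermost; the outer integral is nonnegative as soon as
      every inner one is.\<close>
    also have "\<dots> = (\<integral>x. (\<integral>y. q (x(0 := y)) \<partial>lborel) \<partial>PiM ?I (\<lambda>_. lborel))"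
      using q unfolding I by (intro lborel_product.product_integral_insert) auto
    also have "0 \<le> \<dots>"
    proof (rule integral_nonneg_AE, rule AE_I2)
      fix x assume "x \<in> space (PiM ?I (\<lambda>_. lborel :: real measure))"
      then have x: "x \<in> extensional {..<n}"
        by (auto simp: space_PiM PiE_def extensional_def)
      have xy: "x(0 := y) \<in> extensional {..<n}" for y
        using x n_pos by (rule fun_upd_extensional)
      have "sdot (x(0 := y)) (x(0 := y)) = sdot x x" for y
        unfolding sdot_def using l_pos by (intro sum.cong) auto
      then have conf: "conf (x(0 := y)) = conf x" for y
        by (simp add: conf_def)
      \<comment> \<open>Along a line in the height direction \<open>conf\<close> is constant. The
        division by \<open>a^2\<close> absorbs the factor \<open>1 / a^2\<close> in the lower bound
        for \<open>h\<close>, so that \<open>C\<close> fits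
        \<open>weighted_hardy_nonneg\<close>.\<close>
      define C where "C = a * a ^ (l - 1) * (2 * b * conf x) ^ K / a\<^sup>2"
      have "exp y ^ (l - 1) = exp (2 * \<alpha> * y)" for y
        using l_pos by (simp add: \<alpha>_def exp_of_nat_mult[symmetric] of_nat_diff)
      then have vd: "vol_density (x(0 := y)) = C * a\<^sup>2 * exp (2 * \<alpha> * y)" for y
        using a_pos by (simp add: vol_density_def conf C_def power_mult_distrib)
      have C: "0 \<le> C"
        using a_pos b_pos conf_pos[of x] by (simp add: C_def)
      define \<phi> \<phi>' where "\<phi> y = F (x(0 := y))" and "\<phi>' y = partial_deriv 0 F (x(0 := y))" for y
      have deriv: "(\<phi> has_real_derivative \<phi>' y) (at y)" for y
        using has_real_derivative_partial_deriv[OF smooth_onD(2)[OF smooth n_pos xy[of y]]]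
        by (simp only: \<phi>_def[abs_def] \<phi>'_def fun_upd_upd fun_upd_same)
      have "continuous_map euclideanreal euclideanreal (partial_deriv 0 F \<circ> (\<lambda>y. x(0 := y)))"
        using continuous_map_fun_upd[OF x n_pos] smooth_onD(3)[OF smooth n_pos]
        by (intro continuous_map_compose[where X' = "Rn n"]) (auto simp: subtopology_superset topspace_Rn)
      then have cont: "continuous_on UNIV \<phi>'"
        by (simp add: \<phi>'_def[abs_def] o_def)
      have \<phi>0: "\<phi> y = 0" if "R + 1 \<le> \<bar>y\<bar>" for y
        using supp[of "x(0 := y)"] that by (simp add: \<phi>_def F[OF xy])
      have ineq: "C * (((\<phi>' y)\<^sup>2 - \<alpha>\<^sup>2 * (\<phi> y)\<^sup>2) * exp (2 * \<alpha> * y)) \<le> q (x(0 := y))" for y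
      proof -
        have "C * (((\<phi>' y)\<^sup>2 - \<alpha>\<^sup>2 * (\<phi> y)\<^sup>2) * exp (2 * \<alpha> * y)) =
            C * a\<^sup>2 * exp (2 * \<alpha> * y) * ((\<phi>' y)\<^sup>2 / a\<^sup>2 - \<alpha>\<^sup>2 / a\<^sup>2 * (\<phi> y)\<^sup>2)"
          using a_pos by (simp add: field_simps)
        also have "\<dots> \<le> C * a\<^sup>2 * exp (2 * \<alpha> * y) * h (param \<sigma> (x(0 := y)))"
          using h[OF xy, of y] C by (intro mult_left_mono) (auto simp: \<phi>_def \<phi>'_def)
        finally show ?thesis
          by (simp add: q_def vd)
      qed
      \<comment> \<open>Here \<open>\<phi>\<close> vanishes, and the lower bound reduces to its
        nonnegative term in \<open>\<phi>'\<close>.\<close>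
      moreover have "0 \<le> q (x(0 := y))" if "R + 1 \<le> \<bar>y\<bar>" for y
      proof -
        have "0 \<le> C * ((\<phi>' y)\<^sup>2 * exp (2 * \<alpha> * y))"
          using C by simp
        then show ?thesis
          using ineq[of y] \<phi>0[OF that] by simp
      qed
      ultimately show "0 \<le> (\<integral>y. q (x(0 := y)) \<partial>lborel)"
        using weighted_hardy_nonneg[OF deriv cont \<phi>0 C, where q = "\<lambda>y. q (x(0 := y))"] by blast
    qed
    finally show ?thesis .
  qed (simp add: not_integrable_integral_eq)
  then show "0 \<le> stability_form n tube_space atlas (\<lambda>P. P) normal f"
    by (simp add: stability_form_def h_def Let_def)
qed

end

text \<open>A nonzero element of a negative definite subspace would contradict stability, so only
  the zero subspace enters the supremum.\<close>

lemma strong_morse_index_stable: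
  assumes "strongly_stable n X \<A> F N"
  shows "strong_morse_index n X \<A> F N = 0"
proof -
  have "dim V = 0" if V: "subspace V" "V \<subseteq> test_functions n X \<A>"
    "\<forall>f\<in>V. f \<noteq> 0 \<longrightarrow> stability_form n X \<A> F N f < 0" for V
  proof -
    have "V \<subseteq> {0}"
      using V(2,3) assms by (force simp: strongly_stable_def)
    moreover obtain B where "B \<subseteq> V" "independent B" "card B = dim V"
      using real_vector.basis_exists by metis
    ultimately have "B \<subseteq> {0}" "0 \<notin> B"
      using real_vector.dependent_zero by auto
    then have "B = {}"
      by auto
    with \<open>card B = dim V\<close> show ?thesis
      by simp
  qed
  then have "strong_morse_index n X \<A> F N \<le> 0"
    unfolding strong_morse_index_def by (intro Sup_least) (auto simp: zero_enat_def)
  then show ?thesis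
    by simp
qed

section \<open>Completeness\<close>

text \<open>With \<open>X = (x 0)^2 - 1\<close>, orthogonality and Cauchy-Schwarz on the spatial
  parts give \<open>(x 0)^2 (w 0)^2 <= ((x 0)^2 - 1) W\<close>, that is
  \<open>W <= (x 0)^2 (W - (w 0)^2)\<close>. So the Euclidean size of a tangent vector's spatial
  part is at most \<open>\<bar>x 0\<bar>\<close> times its Minkowski length, which lets arc length
  control ambient components.\<close>

lemma tangent_component_bound:
  assumes x: "mink d x x = - 1" and t: "mink d x w = 0" and k: "k \<le> d"
  shows "\<bar>w k\<bar> \<le> sqrt (mink d w w) * \<bar>x 0\<bar>" "\<bar>x k\<bar> \<le> \<bar>x 0\<bar>"
proof -
  define X W m where "X = (\<Sum>k=1..d. (x k)\<^sup>2)" and "W = (\<Sum>k=1..d. (w k)\<^sup>2)" and "m = mink d w w"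
  have X: "X = (x 0)\<^sup>2 - 1"
    using x by (simp add: mink_def X_def power2_eq_square)
  have m: "m = W - (w 0)\<^sup>2"
    by (simp add: m_def mink_def W_def power2_eq_square)
  have "(\<Sum>k=1..d. x k * w k) = x 0 * w 0"
    using t by (simp add: mink_def)
  then have cs: "(x 0 * w 0)\<^sup>2 \<le> X * W"
    using Cauchy_Schwarz_ineq_sum[of x w "{1..d}"] by (simp add: X_def W_def)
  have Wm: "W \<le> (x 0)\<^sup>2 * m"
    using cs unfolding X m by (simp add: algebra_simps power_mult_distrib)
  have "0 \<le> X" "0 \<le> W"
    by (auto simp: X_def W_def intro: sum_nonneg)
  then have x1: "1 \<le> (x 0)\<^sup>2"
    using X by simp
  have "(w k)\<^sup>2 \<le> (x 0)\<^sup>2 * m"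
  proof (cases "k = 0")
    case True
    \<comment> \<open>For the time component the bound on \<open>W\<close> is put back into
      Cauchy-Schwarz and the positive factor \<open>(x 0)^2\<close> cancelled.\<close>
    have "(w 0)\<^sup>2 * (x 0)\<^sup>2 \<le> ((x 0)\<^sup>2 - 1) * W"
      using cs by (simp add: X power_mult_distrib mult.commute)
    also have "\<dots> \<le> ((x 0)\<^sup>2 - 1) * ((x 0)\<^sup>2 * m)"
      using Wm x1 by (intro mult_left_mono) auto
    also have "\<dots> = (((x 0)\<^sup>2 - 1) * m) * (x 0)\<^sup>2"
      by simp
    finally have "(w 0)\<^sup>2 \<le> ((x 0)\<^sup>2 - 1) * m"
      using x1 by (subst (asm) mult_le_cancel_right) auto
    moreover have "0 \<le> (x 0)\<^sup>2 * m"
      using Wm \<open>0 \<le> W\<close> by simp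
    then have "0 \<le> m"
      using x1 by (subst (asm) zero_le_mult_iff) auto
    ultimately show ?thesis
      using True by (simp add: algebra_simps)
  next
    case False
    then have "(w k)\<^sup>2 \<le> W"
      unfolding W_def using k by (intro member_le_sum) auto
    with Wm show ?thesis
      by simp
  qed
  then have "sqrt ((w k)\<^sup>2) \<le> sqrt ((x 0)\<^sup>2 * m)"
    by (rule real_sqrt_le_mono)
  then show "\<bar>w k\<bar> \<le> sqrt (mink d w w) * \<bar>x 0\<bar>"
    by (simp add: real_sqrt_mult m_def mult.commute)
  show "\<bar>x k\<bar> \<le> \<bar>x 0\<bar>"
  proof (cases "k = 0")
    case False
    then have "(x k)\<^sup>2 \<le> X"
      unfolding X_def using k by (intro member_le_sum) auto
    then show ?thesis
      using X by (simp add: abs_le_square_iff)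
  qed simp
qed

section \<open>Lengths of curves measured in ambient Minkowski coordinates\<close>

context tube
begin

abbreviation g_tube :: "(nat \<Rightarrow> real) form2" where
  "g_tube \<equiv> induced_metric n (\<lambda>P. P)"

lemma curve_derivative:
  assumes ev: "\<forall>\<^sub>F s in nhds t. \<gamma> s \<in> tube_dom \<sigma>" and \<sigma>: "\<sigma>\<^sup>2 = 1"
    and v: "\<And>i. i < n \<Longrightarrow> ((\<lambda>s. coord \<sigma> (\<gamma> s) i) has_real_derivative v i) (at t)"
    and k: "k < n + 2"
  shows "((\<lambda>s. \<gamma> s k) has_real_derivative dparam \<sigma> (coord \<sigma> (\<gamma> t)) v k) (at t)"
proof -
  have "((\<lambda>s. param \<sigma> (coord \<sigma> (\<gamma> s)) k) has_real_derivative dparam \<sigma> (coord \<sigma> (\<gamma> t)) v k) (at t)"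
    using v k by (rule param_has_real_derivative)
  moreover have "\<forall>\<^sub>F s in nhds t. param \<sigma> (coord \<sigma> (\<gamma> s)) k = \<gamma> s k"
    using ev by eventually_elim (simp add: param_coord \<sigma>)
  ultimately show ?thesis
    using DERIV_cong_ev[of t t "\<lambda>s. param \<sigma> (coord \<sigma> (\<gamma> s)) k" "\<lambda>s. \<gamma> s k"] by blast
qed

lemma coord_differentiable:
  assumes P: "\<gamma> t \<in> tube_dom \<sigma>" and d: "\<And>k. k < n + 2 \<Longrightarrow> (\<lambda>s. \<gamma> s k) differentiable (at (t :: real))"
    and i: "i < n"
  shows "(\<lambda>s. coord \<sigma> (\<gamma> s) i) differentiable (at t)"
proof -
  have h: "0 < \<gamma> t 0 + \<gamma> t l" and s: "b + \<sigma> * \<gamma> t (Suc n) \<noteq> 0"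
    using P height_pos[of "\<gamma> t"] by (auto simp: tube_dom_def)
  obtain D where D: "\<And>k. k < n + 2 \<Longrightarrow> ((\<lambda>s. \<gamma> s k) has_real_derivative D k) (at t)"
    using d unfolding real_differentiable_def by metis
  consider "i = 0" | "0 < i" "i < l" | "l \<le> i"
    by linarith
  then show ?thesis
  proof cases
    case 1
    have "((\<lambda>s. ln ((\<gamma> s 0 + \<gamma> s l) / a)) has_real_derivative ((D 0 + D l) / a) / ((\<gamma> t 0 + \<gamma> t l) / a)) (at t)"
      using h a_pos by (auto intro!: derivative_eq_intros D)
    then show ?thesis
      unfolding 1 coord_simps real_differentiable_def by blast
  next
    case 2
    have "(\<lambda>s. \<gamma> s i / (\<gamma> s 0 + \<gamma> s l)) differentiable (at t)"
      using h 2 by (intro differentiable_divide differentiable_add d) auto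
    then show ?thesis
      unfolding coord_simps(2)[OF 2] .
  next
    case 3
    have "(\<lambda>s. \<gamma> s (Suc i) / (b + \<sigma> * \<gamma> s (Suc n))) differentiable (at t)"
      using s i by (intro differentiable_divide differentiable_add differentiable_mult differentiable_const d) auto
    then show ?thesis
      unfolding coord_simps(3)[OF 3 i] .
  qed
qed

text \<open>\<open>speed\<close> is computed in the base chart, which can jump along the curve. The
  ambient velocity does not depend on charts, so its Minkowski norm gives one expression valid at
  all parameters.\<close>

lemma speed_ambient:
  assumes ev: "\<forall>\<^sub>F s in nhds t. \<gamma> s \<in> tube_set"
    and w: "\<And>k. k < n + 2 \<Longrightarrow> ((\<lambda>s. \<gamma> s k) has_real_derivative w k) (at t)"
  shows "speed n atlas g_tube \<gamma> t = sqrt (mink (n + 1) w w)"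
    and "mink (n + 1) (\<gamma> t) w = 0"
proof -
  have "\<gamma> t \<in> tube_set"
    using ev by (rule eventually_nhds_x_imp_x)
  then obtain \<sigma> where base: "base_chart atlas (\<gamma> t) = tube_chart \<sigma>" and \<sigma>: "\<sigma>\<^sup>2 = 1"
    and dom: "\<gamma> t \<in> tube_dom \<sigma>"
    by (rule base_chart_tube)
  define z v where "z = coord \<sigma> (\<gamma> t)" and "v i = deriv (\<lambda>s. coord \<sigma> (\<gamma> s) i) t" for i
  have v: "((\<lambda>s. coord \<sigma> (\<gamma> s) i) has_real_derivative v i) (at t)" if "i < n" for i
    unfolding v_def DERIV_deriv_iff_real_differentiable
    using w that by (intro coord_differentiable dom) (auto simp: real_differentiable_def)
  \<comment> \<open>The chart condition \<open>b + \<sigma> * P (Suc n) > 0\<close> is open, so the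
    curve stays in the chart near \<open>t\<close>; the chain rule through \<open>param\<close> and
    uniqueness of derivatives then identify \<open>w\<close>.\<close>
  have "isCont (\<lambda>s. b + \<sigma> * \<gamma> s (Suc n)) t"
    using DERIV_isCont[OF w[of "Suc n"]] by (intro continuous_intros) auto
  then have "\<forall>\<^sub>F s in nhds t. 0 < b + \<sigma> * \<gamma> s (Suc n)"
    using dom tendsto_at_iff_tendsto_nhds[of "\<lambda>s. b + \<sigma> * \<gamma> s (Suc n)" t]
    by (intro order_tendstoD(1)[of _ "b + \<sigma> * \<gamma> t (Suc n)"]) (simp_all add: tube_dom_def isCont_def)
  with ev have "\<forall>\<^sub>F s in nhds t. \<gamma> s \<in> tube_dom \<sigma>"
    by eventually_elim (simp add: tube_dom_def)
  from curve_derivative[OF this \<sigma> v] have "w k = dparam \<sigma> z v k" if "k < n + 2" for k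
    using DERIV_unique[OF w[OF that]] that by (simp add: z_def)
  then have cong: "mink (n + 1) w w = mink (n + 1) (dparam \<sigma> z v) (dparam \<sigma> z v)"
    "mink (n + 1) (\<gamma> t) w = mink (n + 1) (\<gamma> t) (dparam \<sigma> z v)"
    by (auto intro!: mink_cong)
  show "mink (n + 1) (\<gamma> t) w = 0"
    unfolding cong z_def using mink_dparam_point[OF dom \<sigma>] by (simp add: mink_eq)
  have "(\<Sum>i<n. \<Sum>j<n. g_tube (tube_chart \<sigma>) (\<gamma> t) i j * v i * v j) =
      (\<Sum>i<n. \<Sum>j<n. if j = i then mfactor z i * v i * v i else 0)"
    by (intro sum.cong refl) (auto simp: induced_metric_tube[OF dom \<sigma>] z_def)
  also have "\<dots> = mink (n + 1) w w"
    unfolding cong by (simp add: mink_dparam[OF \<sigma>, simplified] sum.delta)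
  finally show "speed n atlas g_tube \<gamma> t = sqrt (mink (n + 1) w w)"
    by (simp add: speed_def Let_def base v_def)
qed

lemma tube_dom_cover:
  assumes "P \<in> tube_set"
  obtains \<sigma> where "\<sigma> = 1 \<or> \<sigma> = - 1" "\<sigma>\<^sup>2 = 1" "P \<in> tube_dom \<sigma>"
proof (cases "0 < b + P (Suc n)")
  case True
  with assms that[of 1] show thesis
    by (simp add: tube_dom_def)
next
  case False
  with assms b_pos that[of "- 1"] show thesis
    by (simp add: tube_dom_def)
qed

text \<open>At an interior parameter outside \<open>S\<close>, continuity on \<open>[0, 1]\<close>
  keeps the curve in an open chart domain on a full neighbourhood of \<open>t\<close>.
  Differentiability of the chart coordinates then passes through \<open>param\<close> to the ambient
  components.\<close>

lemma curve_has_derivative: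
  assumes \<gamma>: "continuous_map (top_of_set {0..1}) tube_space \<gamma>"
    and C1: "\<forall>c\<in>atlas. \<forall>i<n. (\<lambda>t. snd c (\<gamma> t) i) C1_differentiable_on {t \<in> {0<..<1} - S. \<gamma> t \<in> fst c}"
    and t: "t \<in> {0<..<1} - S"
  obtains w where "\<And>k. k < n + 2 \<Longrightarrow> ((\<lambda>s. \<gamma> s k) has_real_derivative w k) (at t)"
    "speed n atlas g_tube \<gamma> t = sqrt (mink (n + 1) w w)" "mink (n + 1) (\<gamma> t) w = 0"
proof -
  have near: "\<forall>\<^sub>F s in nhds t. \<gamma> s \<in> U" if "openin tube_space U" "\<gamma> t \<in> U" for U
  proof -
    have "openin (top_of_set {0..1}) {s \<in> topspace (top_of_set {0..1}). \<gamma> s \<in> U}"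
      using \<gamma> that(1) by (rule openin_continuous_map_preimage)
    then obtain T where T: "open T" "{s \<in> {0..1}. \<gamma> s \<in> U} = {0..1} \<inter> T"
      by (auto simp: openin_open)
    have "\<gamma> s \<in> U" if "s \<in> T \<inter> {0<..<1}" for s
    proof -
      have "s \<in> {0..1} \<inter> T"
        using that by auto
      then show ?thesis
        unfolding T(2)[symmetric] by blast
    qed
    moreover have "t \<in> {s \<in> {0..1}. \<gamma> s \<in> U}"
      using t that(2) by auto
    then have "t \<in> T \<inter> {0<..<1}"
      unfolding T(2) using t by blast
    moreover have "open (T \<inter> {0<..<1})"
      using T(1) by (intro open_Int) auto
    ultimately show ?thesis
      unfolding eventually_nhds by blast
  qed
  have "\<gamma> t \<in> tube_set"
    using continuous_map_image_subset_topspace[OF \<gamma>] t by (auto simp: topspace_tube_space)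
  moreover have "openin tube_space tube_set"
    by (metis openin_topspace topspace_tube_space)
  ultimately have ev: "\<forall>\<^sub>F s in nhds t. \<gamma> s \<in> tube_set"
    by (intro near)
  obtain \<sigma> where \<sigma>1: "\<sigma> = 1 \<or> \<sigma> = - 1" and \<sigma>2: "\<sigma>\<^sup>2 = 1" and dom: "\<gamma> t \<in> tube_dom \<sigma>"
    using \<open>\<gamma> t \<in> tube_set\<close> by (rule tube_dom_cover)
  have "tube_chart \<sigma> \<in> atlas"
    using \<sigma>1 by (auto simp: atlas_def)
  with C1 have "\<forall>i<n. (\<lambda>t. coord \<sigma> (\<gamma> t) i) C1_differentiable_on {t \<in> {0<..<1} - S. \<gamma> t \<in> tube_dom \<sigma>}"
    by fastforce
  then have diff: "(\<lambda>t. coord \<sigma> (\<gamma> t) i) differentiable (at t)" if "i < n" for i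
    using that t dom unfolding C1_differentiable_on_eq by auto
  define v where "v i = deriv (\<lambda>s. coord \<sigma> (\<gamma> s) i) t" for i
  have "((\<lambda>s. coord \<sigma> (\<gamma> s) i) has_real_derivative v i) (at t)" if "i < n" for i
    unfolding v_def DERIV_deriv_iff_real_differentiable
    using that by (rule diff)
  then have w: "((\<lambda>s. \<gamma> s k) has_real_derivative dparam \<sigma> (coord \<sigma> (\<gamma> t)) v k) (at t)" if "k < n + 2" for k
    using that \<sigma>2 near[OF openin_tube_dom dom] by (intro curve_derivative)
  show thesis
    using that w speed_ambient[OF ev w] by blast
qed

text \<open>Along a curve the derivative \<open>w 0 / P 0\<close> of \<open>ln (P 0)\<close> is at
  most the speed. The quotient rule bounds the derivative of \<open>P k / P 0\<close> by twice the
  speed, so the quotient is halved to have Lipschitz constant 1.\<close>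

lemma component_bounds_riem_dist:
  assumes k: "k < n + 2"
  shows "ennreal \<bar>ln (Q 0) - ln (P 0)\<bar> \<le> riem_dist n tube_space atlas g_tube P Q"
    and "ennreal \<bar>Q k / Q 0 / 2 - P k / P 0 / 2\<bar> \<le> riem_dist n tube_space atlas g_tube P Q"
proof -
  have "ennreal \<bar>ln (\<gamma> 1 0) - ln (\<gamma> 0 0)\<bar> \<le> curve_length n atlas g_tube \<gamma> \<and>
      ennreal \<bar>\<gamma> 1 k / \<gamma> 1 0 / 2 - \<gamma> 0 k / \<gamma> 0 0 / 2\<bar> \<le> curve_length n atlas g_tube \<gamma>"
    if pw: "piecewise_C1_curve n tube_space atlas \<gamma>" for \<gamma>
  proof -
    obtain S where \<gamma>: "continuous_map (top_of_set {0..1}) tube_space \<gamma>" and S: "finite S"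
      and C1: "\<forall>c\<in>atlas. \<forall>i<n. (\<lambda>t. snd c (\<gamma> t) i) C1_differentiable_on {t \<in> {0<..<1} - S. \<gamma> t \<in> fst c}"
      using pw unfolding piecewise_C1_curve_def by blast
    have \<gamma>T: "\<gamma> t \<in> tube_set" if "t \<in> {0..1}" for t
      using continuous_map_image_subset_topspace[OF \<gamma>] that by (auto simp: topspace_tube_space)
    have cont: "continuous_on {0..1} (\<lambda>t. \<gamma> t j)" if "j < n + 2" for j
      using continuous_map_compose[OF \<gamma> continuous_map_tube_component[OF that, of UNIV, simplified]]
      by (simp add: o_def)
    have pos: "0 < \<gamma> t 0" if "t \<in> {0..1}" for t
      using \<gamma>T[OF that] by (simp add: tube_setD)
    have "\<exists>w. \<forall>t\<in>{0<..<1} - S. (\<forall>j<n + 2. ((\<lambda>s. \<gamma> s j) has_real_derivative w t j) (at t)) \<and>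
        speed n atlas g_tube \<gamma> t = sqrt (mink (n + 1) (w t) (w t)) \<and> mink (n + 1) (\<gamma> t) (w t) = 0"
      by (intro bchoice ballI) (metis curve_has_derivative[OF \<gamma> C1])
    then obtain w where w: "\<And>t j. t \<in> {0<..<1} - S \<Longrightarrow> j < n + 2 \<Longrightarrow> ((\<lambda>s. \<gamma> s j) has_real_derivative w t j) (at t)"
      and sp: "\<And>t. t \<in> {0<..<1} - S \<Longrightarrow> speed n atlas g_tube \<gamma> t = sqrt (mink (n + 1) (w t) (w t))"
      and tan: "\<And>t. t \<in> {0<..<1} - S \<Longrightarrow> mink (n + 1) (\<gamma> t) (w t) = 0"
      by blast
    have bound: "\<bar>w t j\<bar> \<le> speed n atlas g_tube \<gamma> t * \<gamma> t 0" "\<bar>\<gamma> t j\<bar> \<le> \<gamma> t 0"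
      if "t \<in> {0<..<1} - S" "j < n + 2" for t j
      using tangent_component_bound[OF _ tan[OF that(1)], of j] mink_point[OF \<gamma>T[of t]] pos[of t] that
      by (auto simp: sp)
    have "ennreal \<bar>ln (\<gamma> 1 0) - ln (\<gamma> 0 0)\<bar> \<le> curve_length n atlas g_tube \<gamma>"
      unfolding curve_length_def
    proof (rule ennreal_increment_le_nn_integral[OF _ S])
      show "continuous_on {0..1} (\<lambda>t. ln (\<gamma> t 0))"
        using pos by (intro continuous_intros cont) force+
      fix t assume t: "t \<in> {0<..<1} - S"
      then have p: "0 < \<gamma> t 0"
        by (intro pos) auto
      then show "((\<lambda>t. ln (\<gamma> t 0)) has_real_derivative w t 0 / \<gamma> t 0) (at t)"
        using t by (auto intro!: derivative_eq_intros w)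
      show "\<bar>w t 0 / \<gamma> t 0\<bar> \<le> speed n atlas g_tube \<gamma> t"
        using bound(1)[OF t, of 0] p by (simp add: abs_divide divide_le_eq)
    qed
    moreover have "ennreal \<bar>\<gamma> 1 k / \<gamma> 1 0 / 2 - \<gamma> 0 k / \<gamma> 0 0 / 2\<bar> \<le> curve_length n atlas g_tube \<gamma>"
      unfolding curve_length_def
    proof (rule ennreal_increment_le_nn_integral[OF _ S])
      show "continuous_on {0..1} (\<lambda>t. \<gamma> t k / \<gamma> t 0 / 2)"
        using pos k by (intro continuous_intros cont) force+
      fix t assume t: "t \<in> {0<..<1} - S"
      then have p: "0 < \<gamma> t 0"
        by (intro pos) auto
      let ?D = "(w t k * \<gamma> t 0 - \<gamma> t k * w t 0) / (\<gamma> t 0 * \<gamma> t 0) / 2"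
      show "((\<lambda>t. \<gamma> t k / \<gamma> t 0 / 2) has_real_derivative ?D) (at t)"
        using t k p by (intro DERIV_cdivide DERIV_divide w) auto
      let ?s = "speed n atlas g_tube \<gamma> t"
      have "\<bar>w t k * \<gamma> t 0 - \<gamma> t k * w t 0\<bar> \<le> \<bar>w t k\<bar> * \<gamma> t 0 + \<bar>\<gamma> t k\<bar> * \<bar>w t 0\<bar>"
        using p by (intro order_trans[OF abs_triangle_ineq4]) (simp add: abs_mult)
      also have "\<dots> \<le> (?s * \<gamma> t 0) * \<gamma> t 0 + \<gamma> t 0 * (?s * \<gamma> t 0)"
        using bound[OF t k] bound(1)[OF t, of 0] p by (intro add_mono mult_mono) auto
      finally show "\<bar>?D\<bar> \<le> ?s"
        using p by (simp add: abs_divide divide_le_eq field_simps)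
    qed
    ultimately show ?thesis ..
  qed
  then show "ennreal \<bar>ln (Q 0) - ln (P 0)\<bar> \<le> riem_dist n tube_space atlas g_tube P Q"
    "ennreal \<bar>Q k / Q 0 / 2 - P k / P 0 / 2\<bar> \<le> riem_dist n tube_space atlas g_tube P Q"
    unfolding riem_dist_def by (force intro!: INF_greatest)+
qed

lemma sdot_has_real_derivative:
  assumes "\<And>i. i < n \<Longrightarrow> ((\<lambda>s. z s i) has_real_derivative v i) (at t)"
  shows "((\<lambda>s. sdot (z s) (z s)) has_real_derivative 2 * sdot (z t) v) (at t)"
  unfolding sdot_def sum_distrib_left
  by (rule derivative_eq_intros assms refl | simp add: mult.commute)+

text \<open>The straight segment in the coordinates of one chart is a competitor. The height is
  affine along it and stays below \<open>M\<close>; together with \<open>conf <= 1\<close> this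
  bounds every metric factor by the constant in front.\<close>

lemma riem_dist_upper_bound:
  assumes \<sigma>: "\<sigma> = 1 \<or> \<sigma> = - 1" and "z 0 \<le> M" "w 0 \<le> M"
  shows "riem_dist n tube_space atlas g_tube (param \<sigma> z) (param \<sigma> w) \<le>
    ennreal (sqrt ((a\<^sup>2 + a\<^sup>2 * (exp M)\<^sup>2 + 4 * b\<^sup>2) * (\<Sum>i<n. (w i - z i)\<^sup>2)))"
proof -
  have \<sigma>2: "\<sigma>\<^sup>2 = 1"
    using \<sigma> by auto
  define \<zeta> where "\<zeta> t i = z i + t * (w i - z i)" for t :: real and i :: nat
  define v where "v i = w i - z i" for i
  define \<gamma> where "\<gamma> t = param \<sigma> (\<zeta> t)" for t
  have d\<zeta>: "((\<lambda>t. \<zeta> t i) has_real_derivative v i) (at t)" for i t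
    unfolding \<zeta>_def v_def by (auto intro!: derivative_eq_intros)
  have d\<gamma>: "((\<lambda>t. \<gamma> t k) has_real_derivative dparam \<sigma> (\<zeta> t) v k) (at t)" if "k < n + 2" for k t
    unfolding \<gamma>_def using d\<zeta> that by (rule param_has_real_derivative)
  have \<gamma>T: "\<gamma> t \<in> tube_set" for t
    by (simp add: \<gamma>_def param_in_tube_set \<sigma>2)
  have ends: "\<gamma> 0 = param \<sigma> z" "\<gamma> 1 = param \<sigma> w"
    by (simp_all add: \<gamma>_def \<zeta>_def[abs_def])
  have "continuous_map (top_of_set {0..1}) (Rn (n + 2)) \<gamma>"
    unfolding continuous_map_Rn_iff
  proof (intro conjI ballI allI impI)
    show "\<gamma> t \<in> extensional {..<n + 2}" for t
      using \<gamma>T by (simp only: tube_set_def mem_Collect_eq)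
    fix k assume k: "k < n + 2"
    have "continuous_on UNIV (\<lambda>t. \<gamma> t k)"
      using d\<gamma>[OF k] by (intro DERIV_continuous_on) auto
    then show "continuous_map (top_of_set {0..1}) euclideanreal (\<lambda>t. \<gamma> t k)"
      using continuous_on_subset[of UNIV _ "{0..1}"] by simp
  qed
  then have cm: "continuous_map (top_of_set {0..1}) tube_space \<gamma>"
    using \<gamma>T by (simp add: tube_space_def continuous_map_in_subtopology)
  have c\<zeta>: "continuous_on T (\<lambda>t. \<zeta> t i)" for T i
    unfolding \<zeta>_def by (intro continuous_intros)
  have csd: "continuous_on T (\<lambda>t. sdot (\<zeta> t) (\<zeta> t))" "continuous_on T (\<lambda>t. sdot (\<zeta> t) v)" for T
    unfolding sdot_def by (intro continuous_intros c\<zeta>)+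
  have lin: "(\<lambda>t. \<zeta> t i) C1_differentiable_on T" for i T
    unfolding C1_differentiable_on_def using d\<zeta>
    by (intro exI[of _ "\<lambda>_. v i"]) (auto simp: has_real_derivative_iff_has_vector_derivative)
  \<comment> \<open>A competitor has to be C1 in every chart of the atlas. In the opposite chart the
    sphere coordinates of the segment become \<open>\<zeta> / |\<zeta>|^2\<close>, on the parameters
    where that chart is defined.\<close>
  have "(\<lambda>t. coord \<tau> (\<gamma> t) i) C1_differentiable_on {t \<in> {0<..<1} - {}. \<gamma> t \<in> tube_dom \<tau>}" (is "_ C1_differentiable_on ?T")
    if \<tau>: "\<tau> = \<sigma> \<or> \<tau> = - \<sigma>" and i: "i < n" for \<tau> i
  proof (cases "i < l \<or> \<tau> = \<sigma>")
    case True
    then have "coord \<tau> (\<gamma> t) i = \<zeta> t i" for t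
      using i \<sigma>2 by (cases "i < l") (auto simp: \<gamma>_def coord_param_hyp coord_param_sph)
    then show ?thesis
      by (simp add: lin)
  next
    case False
    then have eq: "coord \<tau> (\<gamma> t) i = \<zeta> t i / sdot (\<zeta> t) (\<zeta> t)" for t
      using i \<sigma>2 \<tau> by (auto simp: \<gamma>_def coord_param_sph)
    have pos: "sdot (\<zeta> t) (\<zeta> t) \<noteq> 0" if "t \<in> ?T" for t
    proof -
      have "0 < b - \<sigma> * \<gamma> t (Suc n)"
        using that False \<tau> by (auto simp: tube_dom_def)
      then show ?thesis
        unfolding \<gamma>_def last_eq'[OF \<sigma>2] by auto
    qed
    show ?thesis
      unfolding C1_differentiable_on_def eq
    proof (intro exI conjI ballI)
      let ?D = "\<lambda>t. (v i * sdot (\<zeta> t) (\<zeta> t) - \<zeta> t i * (2 * sdot (\<zeta> t) v)) / (sdot (\<zeta> t) (\<zeta> t) * sdot (\<zeta> t) (\<zeta> t))"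
      show "((\<lambda>t. \<zeta> t i / sdot (\<zeta> t) (\<zeta> t)) has_vector_derivative ?D t) (at t)" if "t \<in> ?T" for t
        unfolding has_real_derivative_iff_has_vector_derivative[symmetric]
        using pos[OF that] by (intro DERIV_divide d\<zeta> sdot_has_real_derivative)
      show "continuous_on ?T ?D"
        using pos by (intro continuous_intros c\<zeta> csd) auto
    qed
  qed
  then have "\<forall>c\<in>atlas. \<forall>i<n. (\<lambda>t. snd c (\<gamma> t) i) C1_differentiable_on {t \<in> {0<..<1} - {}. \<gamma> t \<in> fst c}"
    using \<sigma> by (auto simp: atlas_def)
  then have pw: "piecewise_C1_curve n tube_space atlas \<gamma>"
    unfolding piecewise_C1_curve_def using cm by (intro conjI exI[of _ "{}"]) auto
  define B where "B = a\<^sup>2 + a\<^sup>2 * (exp M)\<^sup>2 + 4 * b\<^sup>2"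
  have sp: "speed n atlas g_tube \<gamma> t \<le> sqrt (B * (\<Sum>i<n. (w i - z i)\<^sup>2))" if t: "t \<in> {0..1}" for t
  proof -
    have "\<zeta> t 0 = (1 - t) * z 0 + t * w 0"
      by (simp add: \<zeta>_def algebra_simps)
    also have "\<dots> \<le> (1 - t) * M + t * M"
      using t assms by (intro add_mono mult_left_mono) auto
    finally have "\<zeta> t 0 \<le> M"
      by (simp add: algebra_simps)
    then have e: "a\<^sup>2 * (exp (\<zeta> t 0))\<^sup>2 \<le> a\<^sup>2 * (exp M)\<^sup>2"
      by (intro mult_left_mono power_mono) auto
    have "conf (\<zeta> t) \<le> 1"
      unfolding conf_def using sdot_nonneg[of "\<zeta> t"] by (simp add: inverse_le_1_iff)
    then have c: "4 * b\<^sup>2 * (conf (\<zeta> t))\<^sup>2 \<le> 4 * b\<^sup>2"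
      using conf_pos[of "\<zeta> t"] by (intro mult_left_le) (auto simp: power_le_one)
    have mf: "mfactor (\<zeta> t) i \<le> B" for i
      using e c unfolding mfactor_def B_def by (auto intro: add_nonneg_nonneg order_trans add_increasing add_increasing2)
    have "speed n atlas g_tube \<gamma> t = sqrt (\<Sum>i<n. mfactor (\<zeta> t) i * v i * v i)"
      using speed_ambient(1)[of \<gamma> t "dparam \<sigma> (\<zeta> t) v"] \<gamma>T d\<gamma> mink_dparam[OF \<sigma>2] by simp
    also have "\<dots> \<le> sqrt (\<Sum>i<n. B * (w i - z i)\<^sup>2)"
      using mf by (intro real_sqrt_le_mono sum_mono) (auto simp: v_def power2_eq_square mult.assoc intro!: mult_right_mono)
    finally show ?thesis
      by (simp add: sum_distrib_left)
  qed
  have "riem_dist n tube_space atlas g_tube (param \<sigma> z) (param \<sigma> w) \<le> curve_length n atlas g_tube \<gamma>"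
    unfolding riem_dist_def using pw ends by (intro INF_lower) auto
  also have "\<dots> \<le> (\<integral>\<^sup>+t. ennreal (sqrt (B * (\<Sum>i<n. (w i - z i)\<^sup>2))) * indicator {0..1 :: real} t \<partial>lborel)"
    unfolding curve_length_def using sp by (intro nn_integral_mono) (auto simp: indicator_def intro: ennreal_leI)
  also have "\<dots> = ennreal (sqrt (B * (\<Sum>i<n. (w i - z i)\<^sup>2)))"
    by (subst nn_integral_cmult_indicator) auto
  finally show ?thesis
    by (simp add: B_def)
qed


lemma complete_immersion_tube: "complete_immersion n tube_space atlas (\<lambda>P. P)"
  unfolding complete_immersion_def complete_metric_def
proof (intro allI impI)
  fix s :: "nat \<Rightarrow> nat \<Rightarrow> real"
  assume "range s \<subseteq> topspace tube_space"
    and cauchy: "\<forall>e>0. \<exists>N. \<forall>i\<ge>N. \<forall>j\<ge>N. riem_dist n tube_space atlas g_tube (s i) (s j) < e"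
  then have sT: "s i \<in> tube_set" for i
    by (auto simp: topspace_tube_space)
  have cauchy_real: "Cauchy (\<lambda>i. f (s i))"
    if f: "\<And>P Q. ennreal \<bar>f Q - f P\<bar> \<le> riem_dist n tube_space atlas g_tube P Q" for f :: "(nat \<Rightarrow> real) \<Rightarrow> real"
  proof (rule metric_CauchyI)
    fix e :: real assume "0 < e"
    then obtain N where N: "\<forall>i\<ge>N. \<forall>j\<ge>N. riem_dist n tube_space atlas g_tube (s i) (s j) < ennreal e"
      using cauchy by (metis ennreal_less_zero_iff)
    have "dist (f (s i)) (f (s j)) < e" if "N \<le> i" "N \<le> j" for i j
    proof -
      have "ennreal \<bar>f (s i) - f (s j)\<bar> < ennreal e"
        using f[of "s i" "s j"] N that le_less_trans by blast
      then show ?thesis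
        by (simp add: dist_real_def ennreal_less_iff)
    qed
    then show "\<exists>N. \<forall>i\<ge>N. \<forall>j\<ge>N. dist (f (s i)) (f (s j)) < e"
      by blast
  qed
  have "Cauchy (\<lambda>i. ln (s i 0))"
    using component_bounds_riem_dist(1)[of 0] by (intro cauchy_real) simp
  then obtain L where "(\<lambda>i. ln (s i 0)) \<longlonglongrightarrow> L"
    using Cauchy_convergent_iff convergent_def by blast
  \<comment> \<open>Convergence of the logarithm makes the limit \<open>exp L\<close> of
    \<open>P 0\<close> positive, as the upper sheet requires; multiplying by it recovers
    \<open>P k\<close> from the quotients \<open>P k / P 0\<close>.\<close>
  from tendsto_exp[OF this] have lim0: "(\<lambda>i. s i 0) \<longlonglongrightarrow> exp L"
    using sT by (simp add: tube_setD)
  have "\<exists>x. (\<lambda>i. s i k) \<longlonglongrightarrow> x" if "k < n + 2" for k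
  proof -
    have "Cauchy (\<lambda>i. s i k / s i 0 / 2)"
      using component_bounds_riem_dist(2)[OF that] by (intro cauchy_real)
    then obtain x where "(\<lambda>i. s i k / s i 0 / 2) \<longlonglongrightarrow> x"
      using Cauchy_convergent_iff convergent_def by blast
    from tendsto_mult[OF tendsto_mult[OF this tendsto_const[of 2]] lim0] show ?thesis
      using sT by (auto simp: tube_setD less_imp_neq[OF tube_setD(4), symmetric])
  qed
  then obtain x where x: "\<And>k. k < n + 2 \<Longrightarrow> (\<lambda>i. s i k) \<longlonglongrightarrow> x k"
    by metis
  \<comment> \<open>Points of coordinate space are \<open>undefined\<close> outside the index range,
    hence the restriction.\<close>
  define p where "p = restrict x {..<n + 2}"
  have p: "(\<lambda>i. s i k) \<longlonglongrightarrow> p k" if "k < n + 2" for k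
    using x[OF that] that by (simp add: p_def)
  have "(\<lambda>i. hyp (s i) (s i)) \<longlonglongrightarrow> hyp p p"
    unfolding hyp_def by (intro tendsto_intros p) auto
  then have "hyp p p = - (a\<^sup>2)"
    by (simp add: tube_setD(2)[OF sT] LIMSEQ_const_iff)
  moreover have "(\<lambda>i. sph (s i) (s i)) \<longlonglongrightarrow> sph p p"
    unfolding sph_def by (intro tendsto_intros p) auto
  then have "sph p p = b\<^sup>2"
    by (simp add: tube_setD(3)[OF sT] LIMSEQ_const_iff)
  moreover have "p 0 = exp L"
    using LIMSEQ_unique[OF p lim0] by simp
  ultimately have pT: "p \<in> tube_set"
    by (simp add: tube_set_def p_def)
  then obtain \<sigma> where \<sigma>: "\<sigma> = 1 \<or> \<sigma> = - 1" "\<sigma>\<^sup>2 = 1" and dom: "p \<in> tube_dom \<sigma>"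
    by (rule tube_dom_cover)
  have h: "p 0 + p l \<noteq> 0" and d: "b + \<sigma> * p (Suc n) \<noteq> 0"
    using dom height_pos[OF pT] by (auto simp: tube_dom_def)
  have coord: "(\<lambda>k. coord \<sigma> (s k) i) \<longlonglongrightarrow> coord \<sigma> p i" if i: "i < n" for i
  proof -
    consider "i = 0" | "0 < i" "i < l" | "l \<le> i"
      by linarith
    then show ?thesis
    proof cases
      case 1
      have "(p 0 + p l) / a \<noteq> 0"
        using h a_pos by simp
      then show ?thesis
        unfolding 1 coord_simps using a_pos by (intro tendsto_intros p) auto
    next
      case 2
      then show ?thesis
        unfolding coord_simps(2)[OF 2] using h by (intro tendsto_intros p) auto
    next
      case 3
      then show ?thesis
        unfolding coord_simps(3)[OF 3 i] using d i by (intro tendsto_intros p) auto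
    qed
  qed
  define z where "z k = coord \<sigma> (s k)" for k
  let ?z = "coord \<sigma> p"
  \<comment> \<open>The constant of \<open>riem_dist_upper_bound\<close> for the height bound
    \<open>?z 0 + 1\<close>, which the convergent heights \<open>z k 0\<close> eventually
    obey.\<close>
  define B where "B = a\<^sup>2 + a\<^sup>2 * (exp (?z 0 + 1))\<^sup>2 + 4 * b\<^sup>2"
  have "(\<lambda>k. b + \<sigma> * s k (Suc n)) \<longlonglongrightarrow> b + \<sigma> * p (Suc n)"
    by (intro tendsto_intros p) auto
  then have "\<forall>\<^sub>F k in sequentially. 0 < b + \<sigma> * s k (Suc n)"
    using dom by (intro order_tendstoD(1)) (auto simp: tube_dom_def)
  moreover have "\<forall>\<^sub>F k in sequentially. z k 0 < ?z 0 + 1"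
    using coord[OF n_pos] unfolding z_def by (intro order_tendstoD(2)) auto
  ultimately have "\<forall>\<^sub>F k in sequentially. riem_dist n tube_space atlas g_tube (s k) p \<le>
      ennreal (sqrt (B * (\<Sum>i<n. (?z i - z k i)\<^sup>2)))"
  proof eventually_elim
    case (elim k)
    then have "s k \<in> tube_dom \<sigma>"
      using sT by (simp add: tube_dom_def)
    then have "param \<sigma> (z k) = s k" "param \<sigma> ?z = p"
      using dom \<sigma> by (simp_all add: z_def param_coord)
    then show ?case
      using riem_dist_upper_bound[OF \<sigma>(1), of "z k" "?z 0 + 1" ?z] elim by (simp add: B_def)
  qed
  moreover have "(\<lambda>k. ennreal (sqrt (B * (\<Sum>i<n. (?z i - z k i)\<^sup>2)))) \<longlonglongrightarrow>
      ennreal (sqrt (B * (\<Sum>i<n. (?z i - ?z i)\<^sup>2)))"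
    unfolding z_def by (intro tendsto_intros coord) auto
  then have "(\<lambda>k. ennreal (sqrt (B * (\<Sum>i<n. (?z i - z k i)\<^sup>2)))) \<longlonglongrightarrow> 0"
    by simp
  ultimately have "(\<lambda>k. riem_dist n tube_space atlas g_tube (s k) p) \<longlonglongrightarrow> 0"
    by (rule tendsto_sandwich[OF always_eventually[OF allI[OF zero_le]] _ tendsto_const])
  then show "\<exists>p\<in>topspace tube_space. (\<lambda>k. riem_dist n tube_space atlas g_tube (s k) p) \<longlonglongrightarrow> 0"
    using pT by (auto simp: topspace_tube_space)
qed

end

section \<open>Choice of the radius, the limit of the curvatures, and the absence of a
  threshold\<close>

lemma stable_tube_exists:
  assumes "m \<ge> 1"
  shows "\<exists>(M :: (nat \<Rightarrow> real) topology) \<A> F N.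
    two_sided_immersion (3 * m) M \<A> F N \<and>
    embedding_map M (hyperbolic_space (3 * m + 1)) F \<and>
    complete_immersion (3 * m) M \<A> F \<and>
    \<not> compact_space M \<and>
    has_constant_mean_curvature (3 * m) M \<A> F N
      (sqrt m * (4 * real m ^ 2 + 12 * real m + 1) / (6 * real m * (2 * real m + 1))) \<and>
    strongly_stable (3 * m) M \<A> F N"
proof -
  \<comment> \<open>The conditions \<open>4 m a^2 = (2 m + 1)^2 b^2\<close> and
    \<open>a^2 - b^2 = 1\<close> force \<open>b / a = 2 sqrt m / (2 m + 1)\<close>, and
    \<open>D^2 = (2 m + 1)^2 - 4 m = 4 m^2 + 1\<close> normalises. Here \<open>r\<close> is
    \<open>sqrt m\<close>, not the radius of the tube; in terms of it \<open>a / b\<close> and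
    \<open>H\<close> become rational.\<close>
  define r where "r = sqrt m"
  define q where "q = 2 * r\<^sup>2 + 1"
  define D where "D = sqrt (4 * (r\<^sup>2)\<^sup>2 + 1)"
  define a where "a = q / D"
  define b where "b = 2 * r / D"
  have r: "0 < r" "real m = r\<^sup>2"
    using assms by (simp_all add: r_def)
  have q: "0 < q"
    by (simp add: q_def add_nonneg_pos)
  have D: "0 < D" "D\<^sup>2 = 4 * (r\<^sup>2)\<^sup>2 + 1"
    by (simp_all add: D_def add_nonneg_pos)
  have a2: "a\<^sup>2 = q\<^sup>2 / D\<^sup>2" and b2: "b\<^sup>2 = 4 * r\<^sup>2 / D\<^sup>2"
    by (simp_all add: a_def b_def power_divide power_mult_distrib)
  have "q\<^sup>2 = D\<^sup>2 + 4 * r\<^sup>2"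
    unfolding D(2) by (simp add: q_def power2_eq_square algebra_simps)
  then have ab: "a\<^sup>2 = 1 + b\<^sup>2"
    using D(1) by (simp add: a2 b2 add_divide_distrib)
  interpret tube "2 * m" m a b
    using assms r q D ab by unfold_locales (auto simp: a_def b_def)
  have ba: "b / a = 2 * r / q" and ab': "a / b = q / (2 * r)"
    using D(1) r q by (simp_all add: a_def b_def)
  have n3: "2 * m + m = 3 * m"
    by simp
  have l: "real (2 * m) + 1 = q"
    by (simp add: q_def r(2))
  have "strongly_stable n tube_space atlas (\<lambda>P. P) normal"
    by (rule strongly_stable_tube, unfold l a2 b2 r(2)) simp
  moreover have "has_constant_mean_curvature n tube_space atlas (\<lambda>P. P) normal
      (sqrt m * (4 * real m ^ 2 + 12 * real m + 1) / (6 * real m * (2 * real m + 1)))"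
    unfolding has_constant_mean_curvature_def topspace_tube_space
  proof
    fix P assume "P \<in> tube_set"
    then have "mean_curvature n atlas (\<lambda>P. P) normal P =
        (real (2 * m) * (b / a) + real m * (a / b)) / real (2 * m + m)"
      by (rule mean_curvature_tube)
    also have "\<dots> = (2 * r\<^sup>2 * (2 * r / q) + r\<^sup>2 * (q / (2 * r))) / (3 * r\<^sup>2)"
      unfolding ba ab' by (simp add: r(2))
    also have "\<dots> = r * (8 * r\<^sup>2 + q\<^sup>2) / (6 * r\<^sup>2 * q)"
      using r(1) q by (simp add: field_simps power2_eq_square)
    also have "8 * r\<^sup>2 + q\<^sup>2 = 4 * (r\<^sup>2)\<^sup>2 + 12 * r\<^sup>2 + 1"
      by (simp add: q_def power2_eq_square algebra_simps)
    finally show "mean_curvature n atlas (\<lambda>P. P) normal P =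
        sqrt m * (4 * real m ^ 2 + 12 * real m + 1) / (6 * real m * (2 * real m + 1))"
      unfolding r_def[symmetric] unfolding r(2) q_def .
  qed
  ultimately show ?thesis
    using two_sided_immersion_tube embedding_map_tube complete_immersion_tube not_compact_tube_space
    unfolding n3 by blast
qed

theorem corollary7p4:
  shows
    "(\<exists>H :: nat \<Rightarrow> real.
        (\<forall>m\<ge>1.
           (\<exists>(M :: (nat \<Rightarrow> real) topology) \<A> F N.
              two_sided_immersion (3 * m) M \<A> F N \<and>
              embedding_map M (hyperbolic_space (3 * m + 1)) F \<and>
              complete_immersion (3 * m) M \<A> F \<and>
              \<not> compact_space M \<and>
              has_constant_mean_curvature (3 * m) M \<A> F N (H m) \<and>
              strongly_stable (3 * m) M \<A> F N) \<and>
           (H m)\<^sup>2 = (4 * real m ^ 2 + 12 * real m + 1)\<^sup>2 / (36 * real m * (2 * real m + 1)\<^sup>2)) \<and>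
        (\<lambda>m. (H m)\<^sup>2 / (3 * real m)) \<longlonglongrightarrow> 1 / 27)
     \<and>
     \<not> (\<exists>T :: real. \<forall>n\<ge>1. \<forall>(M :: (nat \<Rightarrow> real) topology) \<A> F N H.
          two_sided_immersion n M \<A> F N \<longrightarrow>
          complete_immersion n M \<A> F \<longrightarrow>
          has_constant_mean_curvature n M \<A> F N H \<longrightarrow>
          strong_morse_index n M \<A> F N < \<infinity> \<longrightarrow>
          H\<^sup>2 \<ge> T \<longrightarrow>
          compact_space M)"
proof -
  define H where "H m = sqrt m * (4 * real m ^ 2 + 12 * real m + 1) / (6 * real m * (2 * real m + 1))" for m :: nat
  have H2: "(H m)\<^sup>2 = (4 * real m ^ 2 + 12 * real m + 1)\<^sup>2 / (36 * real m * (2 * real m + 1)\<^sup>2)" if "m \<ge> 1" for m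
  proof -
    have "(sqrt m)\<^sup>2 / (6 * real m)\<^sup>2 = 1 / (36 * real m)"
      using that by (simp add: power2_eq_square field_simps)
    moreover have "(H m)\<^sup>2 = (sqrt m)\<^sup>2 / (6 * real m)\<^sup>2 * ((4 * real m ^ 2 + 12 * real m + 1)\<^sup>2 / (2 * real m + 1)\<^sup>2)"
      by (simp only: H_def power_divide power_mult_distrib times_divide_times_eq)
    ultimately show ?thesis
      by simp
  qed
  have lim: "(\<lambda>m. (H m)\<^sup>2 / (3 * real m)) \<longlonglongrightarrow> 1 / 27"
  proof (rule Lim_transform_eventually)
    \<comment> \<open>\<open>(H m)^2 / (3 m)\<close> rewritten in powers of \<open>1 / m\<close>;
      \<open>108 = 36 * 3\<close>, and the limit is \<open>2^2 / 108\<close>.\<close>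
    let ?f = "\<lambda>m :: nat. ((4 + 12 * (1 / real m) + (1 / real m) * (1 / real m)) / (2 + 1 / real m))\<^sup>2 / 108"
    have "?f \<longlonglongrightarrow> ((4 + 12 * 0 + 0 * 0) / (2 + 0))\<^sup>2 / 108"
      by (intro tendsto_intros lim_1_over_n) auto
    then show "?f \<longlonglongrightarrow> 1 / 27"
      by (simp add: power2_eq_square)
    show "\<forall>\<^sub>F m in sequentially. ?f m = (H m)\<^sup>2 / (3 * real m)"
      using eventually_ge_at_top[of 1]
    proof eventually_elim
      case (elim m)
      define x where "x = real m"
      have x: "0 < x" "2 * x + 1 \<noteq> 0"
        using elim by (simp_all add: x_def)
      have "4 + 12 * (1 / x) + (1 / x) * (1 / x) = (4 * x\<^sup>2 + 12 * x + 1) / x\<^sup>2" "2 + 1 / x = (2 * x + 1) / x"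
        using x by (simp_all add: field_simps power2_eq_square)
      then have "(4 + 12 * (1 / x) + (1 / x) * (1 / x)) / (2 + 1 / x) = (4 * x\<^sup>2 + 12 * x + 1) / (x * (2 * x + 1))"
        using x by (simp add: power2_eq_square)
      then have "((4 + 12 * (1 / x) + (1 / x) * (1 / x)) / (2 + 1 / x))\<^sup>2 / 108 =
          (4 * x\<^sup>2 + 12 * x + 1)\<^sup>2 / (36 * x * (2 * x + 1)\<^sup>2) / (3 * x)"
        by (simp add: power_divide power_mult_distrib power2_eq_square)
      then show ?case
        unfolding H2[OF elim] by (simp only: x_def)
    qed
  qed
  have "\<exists>m\<ge>1. T \<le> (H m)\<^sup>2" for T
  proof -
    \<comment> \<open>Half of the limit \<open>1 / 27\<close>: eventually
      \<open>(H m)^2 > 3 m / 54 = m / 18\<close>, so \<open>m >= 18 T\<close> suffices.\<close>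
    have "\<forall>\<^sub>F m in sequentially. 1 / 54 < (H m)\<^sup>2 / (3 * real m)"
      using lim by (rule order_tendstoD) simp
    moreover have "\<forall>\<^sub>F m in sequentially. 18 * T \<le> real m"
      using filterlim_real_sequentially unfolding filterlim_at_top by blast
    ultimately have "\<forall>\<^sub>F m in sequentially. 1 \<le> m \<and> 18 * T \<le> real m \<and> 1 / 54 < (H m)\<^sup>2 / (3 * real m)"
      using eventually_ge_at_top[of 1] by eventually_elim blast
    then obtain m where m: "1 \<le> m" "18 * T \<le> real m" "1 / 54 < (H m)\<^sup>2 / (3 * real m)"
      using eventually_happens'[OF sequentially_bot] by blast
    then have "real m / 18 \<le> (H m)\<^sup>2"
      by (simp add: field_simps)
    with m show ?thesis
      by (intro exI[of _ m]) linarith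
  qed
  then have "\<not> (\<exists>T :: real. \<forall>n\<ge>1. \<forall>(M :: (nat \<Rightarrow> real) topology) \<A> F N H.
          two_sided_immersion n M \<A> F N \<longrightarrow>
          complete_immersion n M \<A> F \<longrightarrow>
          has_constant_mean_curvature n M \<A> F N H \<longrightarrow>
          strong_morse_index n M \<A> F N < \<infinity> \<longrightarrow>
          H\<^sup>2 \<ge> T \<longrightarrow>
          compact_space M)"
  proof (intro notI, elim exE)
    fix T :: real
    assume T: "\<forall>n\<ge>1. \<forall>(M :: (nat \<Rightarrow> real) topology) \<A> F N H.
          two_sided_immersion n M \<A> F N \<longrightarrow>
          complete_immersion n M \<A> F \<longrightarrow>
          has_constant_mean_curvature n M \<A> F N H \<longrightarrow>
          strong_morse_index n M \<A> F N < \<infinity> \<longrightarrow>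
          H\<^sup>2 \<ge> T \<longrightarrow>
          compact_space M"
    assume "\<And>T. \<exists>m\<ge>1. T \<le> (H m)\<^sup>2"
    then obtain m where m: "m \<ge> 1" "T \<le> (H m)\<^sup>2"
      by blast
    from stable_tube_exists[OF m(1), folded H_def] obtain M :: "(nat \<Rightarrow> real) topology" and \<A> F N
      where *: "two_sided_immersion (3 * m) M \<A> F N" "complete_immersion (3 * m) M \<A> F"
        "\<not> compact_space M" "has_constant_mean_curvature (3 * m) M \<A> F N (H m)"
        "strongly_stable (3 * m) M \<A> F N"
      by blast
    have "strong_morse_index (3 * m) M \<A> F N < \<infinity>"
      using strong_morse_index_stable[OF *(5)] by simp
    moreover have "3 * m \<ge> 1"
      using m(1) by simp
    ultimately have "compact_space M"
      using T * m(2) by blast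
    with *(3) show False ..
  qed
  moreover have "\<forall>m\<ge>1. (\<exists>(M :: (nat \<Rightarrow> real) topology) \<A> F N.
              two_sided_immersion (3 * m) M \<A> F N \<and>
              embedding_map M (hyperbolic_space (3 * m + 1)) F \<and>
              complete_immersion (3 * m) M \<A> F \<and>
              \<not> compact_space M \<and>
              has_constant_mean_curvature (3 * m) M \<A> F N (H m) \<and>
              strongly_stable (3 * m) M \<A> F N) \<and>
           (H m)\<^sup>2 = (4 * real m ^ 2 + 12 * real m + 1)\<^sup>2 / (36 * real m * (2 * real m + 1)\<^sup>2)"
    using stable_tube_exists[folded H_def] H2 by blast
  ultimately show ?thesis
    using lim by blast
qed

end
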